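(* There are exactly $245$ inequivalent Hermitian self-dual codes of length $18$ over $GF(4)$. Of these, one is extremal (minimum weight $8$), $30$ have minimum weight $6$, $159$ have minimum weight $4$, and $55$ have minimum weight $2$.
   Context: Let $GF(4)=\{0,1,\omega,\overline{\omega}\}$ with $\overline{\omega}=\omega^2=\omega+1$. A code of length $n$ is a linear subspace $C$ of $GF(4)^n$. The Hermitian inner product on $GF(4)^n$ is $x\cdot y=\sum_{i=1}^n x_iy_i^2$, the Hermitian dual code of $C$ is $C^\perp=\{x\in GF(4)^n\mid x\cdot c=0\text{ for all }c\in C\}$, and $C$ is Hermitian self-dual if $C=C^\perp$. The minimum weight of $C$ is the least number of nonzero coordinates of a nonzero codeword. Two codes $C,C'$ of length $n$ over $GF(4)$ are equivalent if there is an $n\times n$ monomial matrix $M$ over $GF(4)$ with $C'=CM=\{cM\mid c\in C\}$ (the Frobenius conjugation $x\mapsto x^2$ of $GF(4)$ is not allowed as an equivalence operation). A Hermitian self-dual code of length $n$ is called extremal if its minimum weight equals $2\lfloor n/6\rfloor+2$; for $n=18$ this value is $8$. *)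

theory Defs
  imports "HOL-Analysis.Cartesian_Space" "HOL-Library.Numeral_Type"
begin

datatype gf4 = Zero4 | One4 | Omega | Omega_bar

instantiation gf4 :: field
begin

definition zero_gf4 :: gf4 where "0 = Zero4"
definition one_gf4 :: gf4 where "1 = One4"

fun plus_gf4 :: "gf4 \<Rightarrow> gf4 \<Rightarrow> gf4" where
  "Zero4 + y = y"
| "x + Zero4 = x"
| "One4 + One4 = Zero4"
| "One4 + Omega = Omega_bar"
| "One4 + Omega_bar = Omega"
| "Omega + One4 = Omega_bar"
| "Omega + Omega = Zero4"
| "Omega + Omega_bar = One4"
| "Omega_bar + One4 = Omega"
| "Omega_bar + Omega = One4"
| "Omega_bar + Omega_bar = Zero4"

fun times_gf4 :: "gf4 \<Rightarrow> gf4 \<Rightarrow> gf4" where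
  "Zero4 * y = Zero4"
| "x * Zero4 = Zero4"
| "One4 * y = y"
| "x * One4 = x"
| "Omega * Omega = Omega_bar"
| "Omega * Omega_bar = One4"
| "Omega_bar * Omega = One4"
| "Omega_bar * Omega_bar = Omega"

definition uminus_gf4 :: "gf4 \<Rightarrow> gf4" where "- x = (x :: gf4)"
definition minus_gf4 :: "gf4 \<Rightarrow> gf4 \<Rightarrow> gf4" where "x - y = (x + y :: gf4)"

fun inverse_gf4 :: "gf4 \<Rightarrow> gf4" where
  "inverse Zero4 = Zero4"
| "inverse One4 = One4"
| "inverse Omega = Omega_bar"
| "inverse Omega_bar = Omega"

definition divide_gf4 :: "gf4 \<Rightarrow> gf4 \<Rightarrow> gf4" where "x div y = x * inverse (y :: gf4)"

instance
proof
  fix a b c :: gf4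
  show "a + b + c = a + (b + c)" by (cases a; cases b; cases c; simp)
  show "a + b = b + a" by (cases a; cases b; simp)
  show "0 + a = a" by (simp add: zero_gf4_def)
  show "- a + a = 0" by (cases a; simp add: zero_gf4_def uminus_gf4_def)
  show "a - b = a + - b" by (simp add: minus_gf4_def uminus_gf4_def)
  show "a * b * c = a * (b * c)" by (cases a; cases b; cases c; simp)
  show "a * b = b * a" by (cases a; cases b; simp)
  show "1 * a = a" by (cases a; simp add: one_gf4_def)
  show "(a + b) * c = a * c + b * c" by (cases a; cases b; cases c; simp)
  show "(0 :: gf4) \<noteq> 1" by (simp add: zero_gf4_def one_gf4_def)
  show "a \<noteq> 0 \<Longrightarrow> inverse a * a = 1" by (cases a; simp add: zero_gf4_def one_gf4_def)
  show "a div b = a * inverse b" by (simp add: divide_gf4_def)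
  show "inverse (0 :: gf4) = 0" by (simp add: zero_gf4_def)
qed

end

lemma UNIV_gf4: "UNIV = {Zero4, One4, Omega, Omega_bar}"
  using gf4.exhaust by auto

instance gf4 :: finite
  by standard (simp add: UNIV_gf4)

lemma card_gf4: "CARD(gf4) = 4"
  by (simp add: UNIV_gf4)

lemma Omega_bar_eq: "Omega_bar = Omega ^ 2" "Omega_bar = Omega + 1"
  by (simp_all add: power2_eq_square one_gf4_def)

definition hermitian_inner :: "gf4 ^ 'n \<Rightarrow> gf4 ^ 'n \<Rightarrow> gf4" where
  "hermitian_inner x y = (\<Sum>i\<in>UNIV. x $ i * (y $ i) ^ 2)"

definition hermitian_dual :: "(gf4 ^ 'n) set \<Rightarrow> (gf4 ^ 'n) set" where
  "hermitian_dual C = {x. \<forall>c\<in>C. hermitian_inner x c = 0}"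

definition hermitian_self_dual :: "(gf4 ^ 'n) set \<Rightarrow> bool" where
  "hermitian_self_dual C \<longleftrightarrow> vec.subspace C \<and> C = hermitian_dual C"

definition weight :: "gf4 ^ 'n \<Rightarrow> nat" where
  "weight x = card {i. x $ i \<noteq> 0}"

text \<open>
  Only meaningful for codes other than the zero code. A self-dual code of positive length is never
  zero, since the dual of the zero code is the whole space.
\<close>
definition min_weight :: "(gf4 ^ 'n) set \<Rightarrow> nat" where
  "min_weight C = (LEAST w. \<exists>c\<in>C. c \<noteq> 0 \<and> weight c = w)"

definition extremal :: "(gf4 ^ 'n) set \<Rightarrow> bool" where
  "extremal C \<longleftrightarrow> hermitian_self_dual C \<and> min_weight C = 2 * (CARD('n) div 6) + 2"

definition monomial_matrix :: "gf4 ^ 'n ^ 'n \<Rightarrow> bool" where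
  "monomial_matrix M \<longleftrightarrow>
     (\<forall>i. \<exists>!j. M $ i $ j \<noteq> 0) \<and> (\<forall>j. \<exists>!i. M $ i $ j \<noteq> 0)"

lemma monomial_matrix_iff_perm:
  "monomial_matrix (M :: gf4 ^ 'n ^ 'n) \<longleftrightarrow>
     (\<exists>p. bij p \<and> (\<forall>i j. M $ i $ j \<noteq> 0 \<longleftrightarrow> j = p i))"
proof
  assume m: "monomial_matrix M"
  define p where "p i = (THE j. M $ i $ j \<noteq> 0)" for i
  have p: "M $ i $ j \<noteq> 0 \<longleftrightarrow> j = p i" for i j
    using m theI'[of "\<lambda>j. M $ i $ j \<noteq> 0"] unfolding monomial_matrix_def p_def by metis
  moreover have "inj p"
    using m p unfolding monomial_matrix_def inj_def by metis
  then have "bij p"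
    by (simp add: bij_def finite_UNIV_inj_surj)
  ultimately show "\<exists>p. bij p \<and> (\<forall>i j. M $ i $ j \<noteq> 0 \<longleftrightarrow> j = p i)" by blast
next
  assume "\<exists>p. bij p \<and> (\<forall>i j. M $ i $ j \<noteq> 0 \<longleftrightarrow> j = p i)"
  then obtain p where "bij p" "\<And>i j. M $ i $ j \<noteq> 0 \<longleftrightarrow> j = p i" by blast
  then show "monomial_matrix M"
    unfolding monomial_matrix_def by (metis bij_pointE)
qed

lemma monomial_matrix_mat_1: "monomial_matrix (mat 1 :: gf4 ^ 'n ^ 'n)"
  by (auto simp: monomial_matrix_def mat_def)

lemma monomial_matrix_mult:
  assumes "monomial_matrix M" "monomial_matrix N"
  shows "monomial_matrix (M ** N)"
proof -
  obtain p where p: "bij p" "\<And>i j. M $ i $ j \<noteq> 0 \<longleftrightarrow> j = p i"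
    using assms(1) monomial_matrix_iff_perm by blast
  obtain q where q: "bij q" "\<And>i j. N $ i $ j \<noteq> 0 \<longleftrightarrow> j = q i"
    using assms(2) monomial_matrix_iff_perm by blast
  have "(M ** N) $ i $ j = M $ i $ p i * N $ p i $ j" for i j
  proof -
    have "(M ** N) $ i $ j = (\<Sum>k\<in>UNIV. M $ i $ k * N $ k $ j)"
      by (simp add: matrix_matrix_mult_def)
    also have "\<dots> = (\<Sum>k\<in>{p i}. M $ i $ k * N $ k $ j)"
      using p(2) by (intro sum.mono_neutral_right) auto
    finally show ?thesis by simp
  qed
  then have "(M ** N) $ i $ j \<noteq> 0 \<longleftrightarrow> j = (q \<circ> p) i" for i j
    using p(2) q(2) by auto
  then show ?thesis
    using bij_comp[OF p(1) q(1)] monomial_matrix_iff_perm by blast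
qed

lemma monomial_matrix_inverse:
  assumes "monomial_matrix M"
  obtains N where "monomial_matrix N" "M ** N = mat 1"
proof -
  obtain p where p: "bij p" "\<And>i j. M $ i $ j \<noteq> 0 \<longleftrightarrow> j = p i"
    using assms monomial_matrix_iff_perm by blast
  define N where "N = (\<chi> j i. inverse (M $ i $ j))"
  have "monomial_matrix N"
    using assms by (auto simp: monomial_matrix_def N_def)
  moreover have "(M ** N) $ i $ j = (mat 1 :: gf4 ^ 'a ^ 'a) $ i $ j" for i j
  proof -
    have "(M ** N) $ i $ j = (\<Sum>k\<in>UNIV. M $ i $ k * inverse (M $ j $ k))"
      by (simp add: matrix_matrix_mult_def N_def)
    also have "\<dots> = (\<Sum>k\<in>{p i}. M $ i $ k * inverse (M $ j $ k))"
      using p(2) by (intro sum.mono_neutral_right) auto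
    also have "\<dots> = (if i = j then 1 else 0)"
      using p(2)[of i "p i"] p(2)[of j "p i"] bij_is_inj[OF p(1)] by (auto simp: inj_eq)
    finally show ?thesis by (simp add: mat_def)
  qed
  ultimately show ?thesis
    using that by (simp add: vec_eq_iff)
qed

definition code_equiv :: "((gf4 ^ 'n) set \<times> (gf4 ^ 'n) set) set" where
  "code_equiv = {(C, C'). vec.subspace C \<and> vec.subspace C' \<and>
     (\<exists>M. monomial_matrix M \<and> C' = (\<lambda>c. c v* M) ` C)}"

lemma equiv_code_equiv: "equiv {C. vec.subspace C} (code_equiv :: ((gf4 ^ 'n) set \<times> _) set)"
proof (rule equivI)
  show "(code_equiv :: ((gf4 ^ 'n) set \<times> _) set) \<subseteq> {C. vec.subspace C} \<times> {C. vec.subspace C}"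
    by (auto simp: code_equiv_def)
  show "refl_on {C. vec.subspace C} (code_equiv :: ((gf4 ^ 'n) set \<times> _) set)"
    using monomial_matrix_mat_1
    by (auto simp: refl_on_def code_equiv_def intro!: exI[of _ "mat 1"])
  show "sym (code_equiv :: ((gf4 ^ 'n) set \<times> _) set)"
  proof (rule symI)
    fix C D :: "(gf4 ^ 'n) set"
    assume "(C, D) \<in> code_equiv"
    then obtain M where M: "vec.subspace C" "vec.subspace D" "monomial_matrix M"
      "D = (\<lambda>c. c v* M) ` C" by (auto simp: code_equiv_def)
    obtain N where N: "monomial_matrix N" "M ** N = mat 1"
      using M(3) monomial_matrix_inverse by blast
    have "C = (\<lambda>c. c v* N) ` D"
      by (simp add: M(4) image_image vector_matrix_mul_assoc N(2))
    then show "(D, C) \<in> code_equiv"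
      using M N by (auto simp: code_equiv_def)
  qed
  show "trans (code_equiv :: ((gf4 ^ 'n) set \<times> _) set)"
  proof (rule transI)
    fix C D E :: "(gf4 ^ 'n) set"
    assume "(C, D) \<in> code_equiv" "(D, E) \<in> code_equiv"
    then obtain M N where "vec.subspace C" "vec.subspace E" "monomial_matrix M" "monomial_matrix N"
      "E = (\<lambda>c. c v* N) ` (\<lambda>c. c v* M) ` C" by (auto simp: code_equiv_def)
    then show "(C, E) \<in> code_equiv"
      by (auto simp: code_equiv_def image_image vector_matrix_mul_assoc
          intro!: exI[of _ "M ** N"] monomial_matrix_mult)
  qed
qed

definition num_inequivalent :: "(gf4 ^ 'n) set set \<Rightarrow> nat" where
  "num_inequivalent S = card (S // code_equiv)"

end

theory Submission
  imports Defs "HOL-Combinatorics.Permutations" "HOL-Library.Multiset"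
begin

text \<open>
The classification rests on a mass formula argument. Let \<open>G\<close> be the group of all monomial
transformations of length 18, of order \<open>18! * 3^18\<close>. The equivalence class of a self-dual code
\<open>C\<close> is its orbit under \<open>G\<close>, of size \<open>\<bar>G\<bar> / \<bar>Aut C\<bar>\<close>. If explicit pairwise inequivalent self-dual
codes are given whose orbit sizes add up to the number of all self-dual codes, then they represent
every class. Only inequalities are needed: an upper bound for the number of self-dual codes and
lower bounds for the orbits, that is, upper bounds for the automorphism groups. Everything
must then be an equality.

\<^item> The number of self-dual codes of length \<open>2 m\<close> is at most \<open>(2 + 1) (2^3 + 1) \<dots> (2^(2 m - 1) + 1)\<close>
  (\<open>self_dual_codes_bound\<close>). This follows by counting sequences of independent, mutually orthogonal
  isotropic vectors. The number of isotropic vectors in the dual of a self-orthogonal code comes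
  from a character sum, because a vector is isotropic if and only if its weight is even.

\<^item> A self-dual code with a systematic generator matrix \<open>(I | A)\<close> is given by a unitary 9 by 9 matrix
  \<open>A\<close> over GF(4) (\<open>self_dual_vcode\<close>), written as a base 4 numeral.

\<^item> A monomial transformation that maps one code to another maps light codewords to light codewords,
  up to scalars. A backtracking search assigns images to the coordinates one by one. It keeps the
  light words partitioned by the values seen so far, and rejects an image when the two
  partitions have different statistics in the next column. It never
  rejects the image under an actual transformation (\<open>ext_sound\<close>), so that a failed search proves
  inequivalence (\<open>inequivalentI\<close>). Along the
  chain of stabilisers of the first coordinates it bounds the orbit of each coordinate, and
  the stabiliser of all nine information coordinates is trivial, so that the product of the
  bounds bounds the automorphism group (\<open>automorphism_bound\<close>).

\<^item> The codes are grouped into families by the numbers of words of weight 2, 4 and 6, which are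
  invariants (\<open>weight_key_invariant\<close>). Inequivalence across families is then clear, and the search is
  run for each pair inside a family. As all weights are even, these numbers also show the minimum
  weight if it is at most 6; in the one remaining family the words of weight 8 are counted, too.

All searches are carried out by rewriting, so every function involved comes with a set of
unconditional equations between constructor patterns, collected in \<open>exec\<close>. The theorem
\<open>classification\<close> turns a list of certified families of the right total mass into the number of
classes of each minimum weight.
\<close>

section \<open>The Hermitian form and a bound for the number of self-dual codes\<close>

lemma sum_gf4: "(\<Sum>a\<in>UNIV. f a) = f Zero4 + f One4 + f Omega + f Omega_bar"
  for f :: "gf4 \<Rightarrow> 'b::comm_monoid_add"
  by (simp add: UNIV_gf4 add_ac)

lemma gf4_add_self [simp]: "(x :: gf4) + x = 0"
  by (cases x) (auto simp: zero_gf4_def)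

lemma gf4_sq_add: "((x :: gf4) + y) ^ 2 = x ^ 2 + y ^ 2"
  by (cases x; cases y) (auto simp: power2_eq_square)

lemma gf4_cube: "(x :: gf4) * x ^ 2 = (if x = 0 then 0 else 1)"
  by (cases x) (auto simp: power2_eq_square zero_gf4_def one_gf4_def)

lemma gf4_sq_sq: "((x :: gf4) ^ 2) ^ 2 = x"
  by (cases x) (auto simp: power2_eq_square)

lemma gf4_sq_sum: "(\<Sum>i\<in>I. f i :: gf4) ^ 2 = (\<Sum>i\<in>I. f i ^ 2)"
  by (induction I rule: infinite_finite_induct) (auto simp: gf4_sq_add)

lemma gf4_of_nat: "(of_nat n :: gf4) = (if even n then 0 else 1)"
  by (induction n) auto

lemma inner_add_left: "hermitian_inner (x + y) z = hermitian_inner x z + hermitian_inner y z"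
  by (simp add: hermitian_inner_def algebra_simps sum.distrib)

lemma inner_add_right: "hermitian_inner z (x + y) = hermitian_inner z x + hermitian_inner z y"
  by (simp add: hermitian_inner_def algebra_simps sum.distrib gf4_sq_add)

lemma inner_scale_left: "hermitian_inner (c *s x) y = c * hermitian_inner x y"
  by (simp add: hermitian_inner_def sum_distrib_left mult.assoc)

lemma inner_scale_right: "hermitian_inner x (c *s y) = c ^ 2 * hermitian_inner x y"
  by (simp add: hermitian_inner_def sum_distrib_left power_mult_distrib algebra_simps)

lemma inner_zero [simp]: "hermitian_inner 0 y = 0" "hermitian_inner x 0 = 0"
  by (simp_all add: hermitian_inner_def)

lemma inner_commute: "hermitian_inner y x = (hermitian_inner x y) ^ 2"
  unfolding hermitian_inner_def gf4_sq_sum power_mult_distrib gf4_sq_sq by (simp add: mult.commute)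

lemma inner_self: "hermitian_inner x x = (if even (weight x) then 0 else 1)"
proof -
  have "hermitian_inner x x = (\<Sum>i\<in>UNIV. if x $ i \<noteq> 0 then 1 else 0)"
    unfolding hermitian_inner_def by (intro sum.cong) (auto simp: gf4_cube)
  also have "\<dots> = of_nat (weight x)"
    by (simp add: weight_def sum.If_cases Int_def)
  finally show ?thesis by (simp add: gf4_of_nat)
qed

text \<open>The nontrivial additive character of GF(4) that is trivial on the prime field, the sign of the trace.\<close>
definition chi :: "gf4 \<Rightarrow> int" where
  "chi x = (if x = 0 \<or> x = 1 then 1 else -1)"

lemma chi_0 [simp]: "chi 0 = 1" by (simp add: chi_def)

lemma chi_add: "chi (x + y) = chi x * chi y"
  by (cases x; cases y) (auto simp: chi_def zero_gf4_def one_gf4_def)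

lemma chi_sum: "finite I \<Longrightarrow> chi (\<Sum>i\<in>I. f i) = (\<Prod>i\<in>I. chi (f i))"
  by (induction I rule: finite_induct) (auto simp: chi_add)

text \<open>Orthogonality of characters: if \<open>x\<close> is not orthogonal to \<open>U\<close>, translation by an element of \<open>U\<close> whose
character value is \<open>-1\<close> negates the sum.\<close>
lemma sum_chi_subspace:
  assumes U: "vec.subspace (U :: (gf4 ^ 'n) set)"
  shows "(\<Sum>u\<in>U. chi (hermitian_inner x u)) = (if x \<in> hermitian_dual U then int (card U) else 0)"
proof (cases "x \<in> hermitian_dual U")
  case True
  then show ?thesis by (auto simp: hermitian_dual_def)
next
  case False
  then obtain u where u: "u \<in> U" "hermitian_inner x u \<noteq> 0"
    by (auto simp: hermitian_dual_def)
  define h where "h = hermitian_inner x u"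
  have "\<exists>c. chi (c ^ 2 * h) = -1"
    using u(2) unfolding h_def[symmetric]
    by (cases h) (auto simp: chi_def zero_gf4_def one_gf4_def power2_eq_square
        intro: exI[of _ One4] exI[of _ Omega] exI[of _ Omega_bar])
  then obtain c where c: "chi (c ^ 2 * h) = -1" by blast
  define v where "v = c *s u"
  have v: "v \<in> U" "chi (hermitian_inner x v) = -1"
    using u c vec.subspace_scale[OF U] by (auto simp: v_def inner_scale_right h_def)
  let ?S = "\<Sum>u\<in>U. chi (hermitian_inner x u)"
  have "?S = (\<Sum>u\<in>U. chi (hermitian_inner x (u + v)))"
    by (rule sum.reindex_bij_witness[of _ "\<lambda>u. u + v" "\<lambda>u. u - v"])
       (use v vec.subspace_add[OF U] vec.subspace_diff[OF U] in auto)
  also have "\<dots> = - ?S"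
    by (simp add: inner_add_right chi_add v sum_negf)
  finally show ?thesis using False by simp
qed

text \<open>The distributive law. It lets character sums over all vectors factor over the coordinates.\<close>
lemma sum_prod_vec:
  fixes h :: "'n::finite \<Rightarrow> 'a::finite \<Rightarrow> 'b::comm_semiring_1"
  shows "(\<Sum>x\<in>UNIV. \<Prod>i\<in>UNIV. h i (x $ i)) = (\<Prod>i\<in>UNIV. \<Sum>a\<in>UNIV. h i a)"
proof -
  have "(\<Prod>i\<in>UNIV. \<Sum>a\<in>UNIV. h i a) = (\<Sum>g\<in>Pi\<^sub>E UNIV (\<lambda>_. UNIV). \<Prod>i\<in>UNIV. h i (g i))"
    by (rule prod_sum_PiE) auto
  also have "\<dots> = (\<Sum>x\<in>UNIV. \<Prod>i\<in>UNIV. h i (x $ i))"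
    by (rule sum.reindex_bij_witness[of _ "\<lambda>x. vec_nth x" "\<lambda>g. vec_lambda g"]) auto
  finally show ?thesis by simp
qed

text \<open>The sum factors over the coordinates. A coordinate with \<open>u $ i = 0\<close> contributes \<open>1 - 3 = -2\<close>, any other one
\<open>1 - 1 + 1 + 1 = 2\<close>, and the number of zero coordinates is even.\<close>
lemma sum_parity_chi:
  fixes u :: "gf4 ^ 'n"
  assumes "even CARD('n)" "even (weight u)"
  shows "(\<Sum>x\<in>UNIV. (-1) ^ weight x * chi (hermitian_inner x u)) = 2 ^ CARD('n)"
proof -
  define e :: "gf4 \<Rightarrow> int" where "e a = (if a = 0 then 1 else -1)" for a
  have e: "(-1) ^ weight x = (\<Prod>i\<in>UNIV. e (x $ i))" for x :: "gf4 ^ 'n"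
    unfolding e_def weight_def by (simp add: prod.If_cases Int_def Compl_eq)
  have "(\<Sum>x\<in>UNIV. (-1) ^ weight x * chi (hermitian_inner x u))
      = (\<Sum>x\<in>UNIV. \<Prod>i\<in>UNIV. e (x $ i) * chi (x $ i * (u $ i) ^ 2))"
    by (simp add: e hermitian_inner_def chi_sum prod.distrib)
  also have "\<dots> = (\<Prod>i\<in>UNIV. \<Sum>a\<in>UNIV. e a * chi (a * (u $ i) ^ 2))"
    by (rule sum_prod_vec)
  also have "\<dots> = (\<Prod>i\<in>UNIV. 2 * (if u $ i = 0 then -1 else 1))"
  proof (rule prod.cong)
    fix i
    show "(\<Sum>a\<in>UNIV. e a * chi (a * (u $ i) ^ 2)) = 2 * (if u $ i = 0 then -1 else 1)"
      unfolding sum_gf4 by (cases "u $ i")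
        (auto simp: e_def chi_def zero_gf4_def one_gf4_def power2_eq_square)
  qed auto
  also have "\<dots> = 2 ^ CARD('n) * (-1) ^ card {i. u $ i = 0}"
    unfolding prod.distrib by (simp add: prod.If_cases Int_def)
  also have "card {i. u $ i = 0} = CARD('n) - weight u"
  proof -
    have "{i. u $ i = 0} = UNIV - {i. u $ i \<noteq> 0}" by auto
    then show ?thesis by (simp add: weight_def card_Diff_subset)
  qed
  also have "(-1 :: int) ^ (CARD('n) - weight u) = 1"
    using assms by simp
  finally show ?thesis by simp
qed

text \<open>Double counting of the character sum over all pairs in \<open>UNIV \<times> U\<close>.\<close>
lemma card_dual:
  assumes U: "vec.subspace (U :: (gf4 ^ 'n) set)"
  shows "card (hermitian_dual U) * card U = 4 ^ CARD('n)"
proof -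
  have "(\<Sum>x\<in>UNIV. \<Sum>u\<in>U. chi (hermitian_inner x u)) = int (card (hermitian_dual U) * card U)"
    by (simp add: sum_chi_subspace[OF U] sum.If_cases)
  moreover have "(\<Sum>x\<in>UNIV. \<Sum>u\<in>U. chi (hermitian_inner x u))
      = (\<Sum>u\<in>U. \<Sum>x\<in>UNIV. chi (hermitian_inner x u))" by (rule sum.swap)
  moreover have "(\<Sum>x\<in>UNIV. chi (hermitian_inner x u)) = (if u = 0 then 4 ^ CARD('n) else 0)" for u :: "gf4 ^ 'n"
  proof -
    have "(\<Sum>x\<in>UNIV. chi (hermitian_inner x u)) = (\<Sum>x\<in>UNIV. \<Prod>i\<in>UNIV. chi (x $ i * (u $ i) ^ 2))"
      by (simp add: hermitian_inner_def chi_sum)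
    also have "\<dots> = (\<Prod>i\<in>UNIV. \<Sum>a\<in>UNIV. chi (a * (u $ i) ^ 2))" by (rule sum_prod_vec)
    also have "\<dots> = (\<Prod>i\<in>UNIV. if u $ i = 0 then 4 else 0)"
    proof (rule prod.cong)
      fix i
      show "(\<Sum>a\<in>UNIV. chi (a * (u $ i) ^ 2)) = (if u $ i = 0 then 4 else 0)"
        unfolding sum_gf4 by (cases "u $ i") (auto simp: chi_def zero_gf4_def one_gf4_def power2_eq_square)
    qed auto
    also have "\<dots> = (if u = 0 then 4 ^ CARD('n) else 0)"
      by (auto simp: vec_eq_iff)
    finally show ?thesis .
  qed
  ultimately have "int (card (hermitian_dual U) * card U) = 4 ^ CARD('n)"
    using vec.subspace_0[OF U] by simp
  then show ?thesis by (metis of_nat_eq_iff of_nat_numeral of_nat_power)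
qed

lemma even_weight_of_self_orthogonal:
  assumes "U \<subseteq> hermitian_dual U" "u \<in> U"
  shows "even (weight u)"
  using assms inner_self[of u] by (auto simp: hermitian_dual_def split: if_splits)

text \<open>The vectors of even and of odd weight in the dual differ in number by \<open>2 ^ n\<close>: this difference is a character
sum over the dual, and exchanging summations reduces it to \<open>sum_parity_chi\<close>.\<close>
lemma card_isotropic:
  assumes U: "vec.subspace (U :: (gf4 ^ 'n) set)" "U \<subseteq> hermitian_dual U" and n: "even CARD('n)"
  shows "2 * card {x \<in> hermitian_dual U. hermitian_inner x x = 0} = card (hermitian_dual U) + 2 ^ CARD('n)"
proof -
  let ?D = "hermitian_dual U"
  let ?E = "{x \<in> ?D. even (weight x)}" and ?O = "{x \<in> ?D. odd (weight x)}"
  have "(\<Sum>x\<in>UNIV. (-1) ^ weight x * (\<Sum>u\<in>U. chi (hermitian_inner x u))) = (\<Sum>u\<in>U. 2 ^ CARD('n))"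
    unfolding sum_distrib_left
    by (subst sum.swap, intro sum.cong refl sum_parity_chi n even_weight_of_self_orthogonal[OF U(2)])
  also have "(\<Sum>x\<in>UNIV. (-1) ^ weight x * (\<Sum>u\<in>U. chi (hermitian_inner x u)))
      = (\<Sum>x\<in>?D. (-1) ^ weight x) * int (card U)"
    by (simp add: sum_chi_subspace[OF U(1)] if_distrib sum.If_cases sum_distrib_right cong: if_cong)
  finally have "(\<Sum>x\<in>?D. (-1) ^ weight x) = (2 :: int) ^ CARD('n)"
    using vec.subspace_0[OF U(1)] by (auto simp: card_eq_0_iff)
  moreover have "(\<Sum>x\<in>?D. (-1) ^ weight x :: int) = (\<Sum>x\<in>?D. if even (weight x) then 1 else -1)"
    by (intro sum.cong) auto
  moreover have "\<dots> = int (card ?E) - int (card ?O)"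
    by (simp add: sum.If_cases Int_def)
  moreover have "card ?D = card ?E + card ?O"
    by (subst card_Un_disjoint[symmetric]) (auto intro: arg_cong[where f = card])
  ultimately have "int (2 * card ?E) = int (card ?D + 2 ^ CARD('n))" by simp
  then have "2 * card ?E = card ?D + 2 ^ CARD('n)" by (simp only: of_nat_eq_iff)
  moreover have "{x \<in> ?D. hermitian_inner x x = 0} = ?E" by (auto simp: inner_self)
  ultimately show ?thesis by simp
qed

fun list_span :: "(gf4 ^ 'n) list \<Rightarrow> (gf4 ^ 'n) set" where
  "list_span [] = {0}"
| "list_span (v # q) = {u + c *s v |u c. u \<in> list_span q}"

text \<open>Reversed ordered bases of self-orthogonal codes.\<close>
fun isotropic_seqs :: "nat \<Rightarrow> (gf4 ^ 'n) list set" where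
  "isotropic_seqs 0 = {[]}"
| "isotropic_seqs (Suc k) = {v # q |v q. q \<in> isotropic_seqs k \<and> v \<in> hermitian_dual (list_span q)
     \<and> hermitian_inner v v = 0 \<and> v \<notin> list_span q}"

lemma subspace_list_span: "vec.subspace (list_span q)"
proof (induction q)
  case (Cons v q)
  show ?case unfolding vec.subspace_def
  proof (intro conjI ballI allI)
    show "0 \<in> list_span (v # q)"
      using vec.subspace_0[OF Cons] by (auto intro!: exI[of _ 0])
  next
    fix x y assume "x \<in> list_span (v # q)" "y \<in> list_span (v # q)"
    then obtain a b c d where "x = a + c *s v" "y = b + d *s v" "a \<in> list_span q" "b \<in> list_span q" by auto
    then show "x + y \<in> list_span (v # q)"
      using vec.subspace_add[OF Cons, of a b]
      by (auto intro!: exI[of _ "a + b"] exI[of _ "c + d"] simp: algebra_simps)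
  next
    fix x k assume "x \<in> list_span (v # q)"
    then obtain a c where "x = a + c *s v" "a \<in> list_span q" by auto
    then show "k *s x \<in> list_span (v # q)"
      using vec.subspace_scale[OF Cons, of a k]
      by (auto intro!: exI[of _ "k *s a"] exI[of _ "k * c"] simp: vector_add_ldistrib)
  qed
qed simp

lemma list_span_subset:
  "vec.subspace C \<Longrightarrow> set q \<subseteq> C \<Longrightarrow> list_span q \<subseteq> C"
proof (induction q)
  case Nil
  then show ?case using vec.subspace_0 by auto
next
  case (Cons v q)
  then show ?case by (auto intro!: vec.subspace_add vec.subspace_scale)
qed

lemma card_list_span_Cons:
  assumes v: "v \<notin> list_span q"
  shows "card (list_span (v # q)) = 4 * card (list_span q)"
proof -
  have "list_span (v # q) = (\<lambda>(u, c). u + c *s v) ` (list_span q \<times> UNIV)"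
    by auto
  moreover have "inj_on (\<lambda>(u, c). u + c *s v) (list_span q \<times> UNIV)"
  proof (rule inj_onI, clarsimp)
    fix a c b d assume h: "a \<in> list_span q" "b \<in> list_span q" "a + c *s v = b + d *s v"
    have "c = d"
    proof (rule ccontr)
      assume "c \<noteq> d"
      have "(c - d) *s v = b - a" using h(3) by (simp add: vec.scale_left_diff_distrib algebra_simps)
      then have "v = inverse (c - d) *s (b - a)"
        using \<open>c \<noteq> d\<close> by (metis vec.scale_scale left_inverse right_minus_eq vec.scale_one)
      then show False using v h vec.subspace_scale vec.subspace_diff subspace_list_span by metis
    qed
    with h show "a = b \<and> c = d" by simp
  qed
  ultimately show ?thesis
    by (simp add: card_image card_cartesian_product card_gf4)
qed

lemma isotropic_seqs_props:
  "q \<in> isotropic_seqs k \<Longrightarrow> card (list_span q) = 4 ^ k \<and> list_span q \<subseteq> hermitian_dual (list_span q)"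
proof (induction k arbitrary: q)
  case 0
  then show ?case by (auto simp: hermitian_dual_def)
next
  case (Suc k)
  then obtain v q' where q: "q = v # q'" "q' \<in> isotropic_seqs k" "v \<in> hermitian_dual (list_span q')"
    "hermitian_inner v v = 0" "v \<notin> list_span q'" by auto
  note IH = Suc.IH[OF q(2)]
  have iv: "hermitian_inner v u = 0" "hermitian_inner u v = 0" if "u \<in> list_span q'" for u
    using q(3) that inner_commute[of u v] by (auto simp: hermitian_dual_def)
  have "hermitian_inner x y = 0" if xy: "x \<in> list_span q" "y \<in> list_span q" for x y
  proof -
    obtain a c b d where "x = a + c *s v" "y = b + d *s v" "a \<in> list_span q'" "b \<in> list_span q'"
      using xy q(1) by auto
    moreover have "hermitian_inner a b = 0" using IH calculation by (auto simp: hermitian_dual_def)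
    ultimately show ?thesis
      using q(4) iv by (simp add: inner_add_left inner_add_right inner_scale_left inner_scale_right)
  qed
  then show ?case using card_list_span_Cons[OF q(5)] IH q(1) by (auto simp: hermitian_dual_def)
qed

lemma finite_isotropic_seqs: "finite (isotropic_seqs k :: (gf4 ^ 'n) list set)"
proof (induction k)
  case (Suc k)
  have "isotropic_seqs (Suc k) \<subseteq> (\<lambda>(v, q). v # q) ` (UNIV \<times> (isotropic_seqs k :: (gf4 ^ 'n) list set))" by auto
  moreover have "finite ((\<lambda>(v, q). v # q) ` (UNIV \<times> (isotropic_seqs k :: (gf4 ^ 'n) list set)))" using Suc by simp
  ultimately show ?case by (rule finite_subset)
qed simp

lemma card_Cons_extensions:
  assumes "finite Q" "\<And>q. q \<in> Q \<Longrightarrow> finite (F q)" "\<And>q. q \<in> Q \<Longrightarrow> card (F q) = m"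
  shows "card {v # q |v q. q \<in> Q \<and> v \<in> F q} = card Q * m"
proof -
  have "{v # q |v q. q \<in> Q \<and> v \<in> F q} = (\<lambda>(q, v). v # q) ` Sigma Q F" by auto
  moreover have "inj_on (\<lambda>(q, v). v # q) (Sigma Q F)" by (auto simp: inj_on_def)
  ultimately show ?thesis using assms by (simp add: card_image card_SigmaI)
qed

text \<open>A sequence spanning \<open>U\<close> with \<open>4 ^ k\<close> elements extends by any isotropic vector of the dual of \<open>U\<close> outside
\<open>U\<close>, and their number depends on \<open>k\<close> only.\<close>
lemma card_isotropic_seqs:
  assumes n: "even CARD('n)" and "2 * k \<le> CARD('n)"
  shows "card (isotropic_seqs k :: (gf4 ^ 'n) list set)
       = (\<Prod>i<k. (4 ^ (CARD('n) - i) + 2 ^ CARD('n)) div 2 - 4 ^ i)"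
  using assms(2)
proof (induction k)
  case (Suc k)
  let ?F = "\<lambda>q :: (gf4 ^ 'n) list. {v \<in> hermitian_dual (list_span q). hermitian_inner v v = 0} - list_span q"
  have card: "card (?F q) = (4 ^ (CARD('n) - k) + 2 ^ CARD('n)) div 2 - 4 ^ k" if q: "q \<in> isotropic_seqs k" for q
  proof -
    note p = isotropic_seqs_props[OF q]
    have "card (hermitian_dual (list_span q)) * 4 ^ k = 4 ^ (CARD('n) - k) * 4 ^ k"
      using card_dual[OF subspace_list_span, of q] p Suc.prems by (simp flip: power_add)
    then have "card (hermitian_dual (list_span q)) = 4 ^ (CARD('n) - k)" by simp
    then have "2 * card {v \<in> hermitian_dual (list_span q). hermitian_inner v v = 0} = 4 ^ (CARD('n) - k) + 2 ^ CARD('n)"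
      using card_isotropic[OF subspace_list_span conjunct2[OF p] n] by (simp only:)
    then have "card {v \<in> hermitian_dual (list_span q). hermitian_inner v v = 0}
        = (4 ^ (CARD('n) - k) + 2 ^ CARD('n)) div 2" by linarith
    moreover have "list_span q \<subseteq> {v \<in> hermitian_dual (list_span q). hermitian_inner v v = 0}"
      using p by (auto simp: hermitian_dual_def)
    ultimately show ?thesis using p by (simp only: card_Diff_subset finite)
  qed
  have "isotropic_seqs (Suc k) = {v # q |v q. q \<in> isotropic_seqs k \<and> v \<in> ?F q}" by auto
  then have "card (isotropic_seqs (Suc k) :: (gf4 ^ 'n) list set)
      = card (isotropic_seqs k :: (gf4 ^ 'n) list set) * ((4 ^ (CARD('n) - k) + 2 ^ CARD('n)) div 2 - 4 ^ k)"
    using card_Cons_extensions[OF finite_isotropic_seqs, of k ?F] card by (simp only: finite)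
  with Suc show ?case by (simp only: prod.lessThan_Suc) simp
qed simp

fun code_seqs :: "(gf4 ^ 'n) set \<Rightarrow> nat \<Rightarrow> (gf4 ^ 'n) list set" where
  "code_seqs C 0 = {[]}"
| "code_seqs C (Suc k) = {v # q |v q. q \<in> code_seqs C k \<and> v \<in> C - list_span q}"

lemma code_seqs_in_code: "q \<in> code_seqs C k \<Longrightarrow> set q \<subseteq> C \<and> card (list_span q) = 4 ^ k"
  by (induction k arbitrary: q) (force simp: card_list_span_Cons simp del: list_span.simps(2))+

lemma code_seqs_isotropic:
  assumes C: "hermitian_self_dual C"
  shows "code_seqs C k \<subseteq> isotropic_seqs k"
proof (induction k)
  case (Suc k)
  have "v # q \<in> isotropic_seqs (Suc k)" if q: "q \<in> code_seqs C k" "v \<in> C - list_span q" for v q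
  proof -
    have "list_span q \<subseteq> C"
      using list_span_subset code_seqs_in_code[OF q(1)] C by (auto simp: hermitian_self_dual_def)
    moreover have "hermitian_inner v u = 0" if "u \<in> C" for u
      using q that C by (auto simp: hermitian_self_dual_def hermitian_dual_def)
    ultimately show ?thesis using q Suc by (auto simp: hermitian_dual_def)
  qed
  then show ?case by auto
qed simp

lemma card_self_dual:
  assumes "hermitian_self_dual (C :: (gf4 ^ 'n) set)"
  shows "card C = 2 ^ CARD('n)"
proof -
  have "card C * card C = 2 ^ CARD('n) * 2 ^ CARD('n)"
    using card_dual[of C] assms by (simp add: hermitian_self_dual_def power_mult_distrib[symmetric])
  then show ?thesis by (metis power2_eq_square power2_eq_iff_nonneg zero_le)
qed

lemma card_code_seqs:
  assumes C: "vec.subspace C"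
  shows "card (code_seqs C k) = (\<Prod>i<k. card C - 4 ^ i)"
proof (induction k)
  case (Suc k)
  have "finite (code_seqs C k)"
  proof (induction k)
    case (Suc k)
    have "code_seqs C (Suc k) \<subseteq> (\<lambda>(v, q). v # q) ` (UNIV \<times> code_seqs C k)" by auto
    moreover have "finite ((\<lambda>(v, q). v # q) ` (UNIV \<times> code_seqs C k))" using Suc by simp
    ultimately show ?case by (rule finite_subset)
  qed simp
  moreover have "card (C - list_span q) = card C - 4 ^ k" if "q \<in> code_seqs C k" for q
    using code_seqs_in_code[OF that] list_span_subset[OF C, of q] by (subst card_Diff_subset) auto
  ultimately have "card (code_seqs C (Suc k)) = card (code_seqs C k) * (card C - 4 ^ k)"
    using card_Cons_extensions[of "code_seqs C k" "\<lambda>q. C - list_span q"] by auto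
  with Suc show ?case by simp
qed simp

text \<open>Each self-dual code of dimension \<open>m\<close> has \<open>(4^m - 1) (4^m - 4) \<dots>\<close> ordered bases, these are isotropic sequences, and
different codes have different bases. So the number of codes times the number of bases is at most the number of
isotropic sequences.\<close>
theorem self_dual_codes_bound:
  assumes n: "CARD('n) = 2 * m"
  shows "card {C :: (gf4 ^ 'n) set. hermitian_self_dual C} * (\<Prod>i<m. 4 ^ m - 4 ^ i)
       \<le> (\<Prod>i<m. (4 ^ (2 * m - i) + 4 ^ m) div 2 - 4 ^ i)"
proof -
  let ?S = "{C :: (gf4 ^ 'n) set. hermitian_self_dual C}"
  have p: "(2::nat) ^ (2 * m) = 4 ^ m" by (simp add: power_mult)
  have sub: "vec.subspace C" if "C \<in> ?S" for C using that by (auto simp: hermitian_self_dual_def)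
  have "code_seqs C m \<inter> code_seqs D m = {}" if CD: "C \<in> ?S" "D \<in> ?S" "C \<noteq> D" for C D
  proof (rule ccontr)
    assume "code_seqs C m \<inter> code_seqs D m \<noteq> {}"
    then obtain q where q: "q \<in> code_seqs C m" "q \<in> code_seqs D m" by auto
    have "list_span q = E" if "E \<in> ?S" "q \<in> code_seqs E m" for E
    proof (rule card_subset_eq)
      show "list_span q \<subseteq> E" "card (list_span q) = card E"
        using code_seqs_in_code[OF that(2)] list_span_subset[OF sub[OF that(1)], of q] card_self_dual[of E] that(1) n p by auto
    qed simp
    with q CD show False by metis
  qed
  moreover have "finite (code_seqs C m)" if "C \<in> ?S" for C
    using finite_subset[OF code_seqs_isotropic finite_isotropic_seqs] that by blast
  ultimately have "card (\<Union>C\<in>?S. code_seqs C m) = (\<Sum>C\<in>?S. card (code_seqs C m))"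
    by (intro card_UN_disjoint) auto
  also have "\<dots> = (\<Sum>C\<in>?S. \<Prod>i<m. 4 ^ m - 4 ^ i)"
    by (intro sum.cong refl) (simp add: card_code_seqs sub card_self_dual n p)
  also have "\<dots> = card ?S * (\<Prod>i<m. 4 ^ m - 4 ^ i)" by simp
  finally have "card (\<Union>C\<in>?S. code_seqs C m) = card ?S * (\<Prod>i<m. 4 ^ m - 4 ^ i)" .
  moreover have "card (\<Union>C\<in>?S. code_seqs C m) \<le> card (isotropic_seqs m :: (gf4 ^ 'n) list set)"
    by (rule card_mono[OF finite_isotropic_seqs]) (use code_seqs_isotropic in blast)
  ultimately show ?thesis using card_isotropic_seqs[of m, where 'n = 'n] n p by simp
qed

lemma self_dual_codes_bound_18:
  "card {C :: (gf4 ^ 18) set. hermitian_self_dual C}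
    \<le> 3 * 9 * 33 * 129 * 513 * 2049 * 8193 * 32769 * 131073"
proof -
  have *: "{..<9::nat} = {0, 1, 2, 3, 4, 5, 6, 7, 8}" by auto
  have "CARD(18) = 2 * (9::nat)" by simp
  from self_dual_codes_bound[OF this] show ?thesis by (simp add: *)
qed

section \<open>Words, light codewords and backtracking as rewrite systems\<close>

text \<open>Words are lists over GF(4). The equations in \<open>exec\<close> determine every function below by the constructors of
its arguments. Case distinctions are made by auxiliary functions with a Boolean argument, so that only the
branch taken is ever evaluated; most of these auxiliary functions carry the suffix \<open>2\<close> or \<open>3\<close>.\<close>
type_synonym word = "gf4 list"

named_theorems exec

lemma gf4_zero_one [exec]: "(0::gf4) = Zero4" "(1::gf4) = One4"
  by (simp_all add: zero_gf4_def one_gf4_def)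
lemmas [exec] = plus_gf4.simps times_gf4.simps gf4.distinct list.inject list.distinct prod.inject
  simp_thms nat.inject nat.distinct

definition scl :: "gf4 \<Rightarrow> word \<Rightarrow> word" where "scl c w = map ((*) c) w"

lemma scl_exec [exec]:
  "scl One4 w = w" "scl Omega [] = []" "scl Omega_bar [] = []"
  "scl Omega (x # w) = Omega * x # scl Omega w" "scl Omega_bar (x # w) = Omega_bar * x # scl Omega_bar w"
  by (simp_all add: scl_def one_gf4_def[symmetric] map_idI)
lemma scl_exec0 [exec]: "scl Zero4 [] = []" "scl Zero4 (x # w) = Zero4 # scl Zero4 w"
  by (simp_all add: scl_def)

fun add_words :: "word \<Rightarrow> word \<Rightarrow> word" where
  "add_words [] ys = []" | "add_words (x # xs) [] = []" | "add_words (x # xs) (y # ys) = (x + y) # add_words xs ys"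
declare add_words.simps [exec]

text \<open>\<open>y + c M\<close> for a coefficient word \<open>c\<close> and a matrix \<open>M\<close> given by its rows.\<close>
fun add_product :: "word \<Rightarrow> word \<Rightarrow> word list \<Rightarrow> word" where
  "add_product y (c # cs) (r # rs) = add_product (add_words y (scl c r)) cs rs" | "add_product y [] rs = y" | "add_product y (c # cs) [] = y"
declare add_product.simps [exec]

definition wt :: "word \<Rightarrow> nat" where "wt w = length (filter (\<lambda>x. x \<noteq> 0) w)"
lemma wt_exec [exec]: "wt [] = 0" "wt (Zero4 # w) = wt w" "wt (One4 # w) = Suc (wt w)"
  "wt (Omega # w) = Suc (wt w)" "wt (Omega_bar # w) = Suc (wt w)"
  by (simp_all add: wt_def zero_gf4_def)

definition weight_le :: "nat \<Rightarrow> word \<Rightarrow> bool" where "weight_le b w \<longleftrightarrow> wt w \<le> b"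
lemma weight_le_exec [exec]:
  "weight_le b [] = True" "weight_le b (Zero4 # xs) = weight_le b xs"
  "weight_le (Suc b) (One4 # xs) = weight_le b xs" "weight_le 0 (One4 # xs) = False"
  "weight_le (Suc b) (Omega # xs) = weight_le b xs" "weight_le 0 (Omega # xs) = False"
  "weight_le (Suc b) (Omega_bar # xs) = weight_le b xs" "weight_le 0 (Omega_bar # xs) = False"
  by (simp_all add: weight_le_def wt_exec)

fun app :: "'a list \<Rightarrow> 'a list \<Rightarrow> 'a list" where "app [] ys = ys" | "app (x # xs) ys = x # app xs ys"
fun rapp :: "'a list \<Rightarrow> 'a list \<Rightarrow> 'a list" where "rapp [] ys = ys" | "rapp (x # xs) ys = rapp xs (x # ys)"
declare app.simps [exec] rapp.simps [exec]

fun heads :: "'a list list \<Rightarrow> 'a list" where "heads [] = []" | "heads ((x # xs) # ys) = x # heads ys" | "heads ([] # ys) = heads ys"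
fun tls :: "'a list list \<Rightarrow> 'a list list" where "tls [] = []" | "tls (w # ws) = tl w # tls ws"
declare heads.simps [exec] tls.simps [exec] list.sel(2,3) [exec]

definition conj_word :: "word \<Rightarrow> word" where "conj_word w = map (\<lambda>x. x ^ 2) w"
lemma conj_word_exec [exec]: "conj_word [] = []" "conj_word (Zero4 # w) = Zero4 # conj_word w" "conj_word (One4 # w) = One4 # conj_word w"
  "conj_word (Omega # w) = Omega_bar # conj_word w" "conj_word (Omega_bar # w) = Omega # conj_word w"
  by (simp_all add: conj_word_def power2_eq_square)

fun conj_transpose :: "nat \<Rightarrow> word list \<Rightarrow> word list" where
  "conj_transpose 0 m = []" | "conj_transpose (Suc n) m = conj_word (heads m) # conj_transpose n (tls m)"
declare conj_transpose.simps [exec]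

fun multiples :: "word list \<Rightarrow> (word \<times> word \<times> word) list" where
  "multiples [] = []" | "multiples (r # rs) = (r, scl Omega r, scl Omega_bar r) # multiples rs"
declare multiples.simps [exec]

fun finish :: "bool \<Rightarrow> word \<Rightarrow> word \<Rightarrow> (word \<times> word \<times> word) list \<Rightarrow> word list" where
  "finish False xa y rs = []" | "finish True xa y [] = [rapp xa y]" | "finish True xa y (r # rs) = finish True (Zero4 # xa) y rs"
declare finish.simps [exec]

text \<open>Enumerates the words \<open>(x, y + x M)\<close> where \<open>x\<close> has weight at most \<open>k\<close> and the whole word weight at
most \<open>b\<close>, with the rows of \<open>M\<close> given together with their two other scalar multiples. The first
entries of \<open>x\<close> have been chosen already and are kept in reverse in \<open>xa\<close>.\<close>
fun light_words :: "nat \<Rightarrow> nat \<Rightarrow> word \<Rightarrow> word \<Rightarrow> (word \<times> word \<times> word) list \<Rightarrow> word list" where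
  "light_words 0 b xa y rs = finish (weight_le b y) xa y rs"
| "light_words (Suc k) 0 xa y rs = finish (weight_le 0 y) xa y rs"
| "light_words (Suc k) (Suc b) xa y [] = finish (weight_le (Suc b) y) xa y []"
| "light_words (Suc k) (Suc b) xa y ((r1, r2, r3) # rs) =
    app (light_words (Suc k) (Suc b) (Zero4 # xa) y rs)
     (app (light_words k b (One4 # xa) (add_words y r1) rs)
      (app (light_words k b (Omega # xa) (add_words y r2) rs) (light_words k b (Omega_bar # xa) (add_words y r3) rs)))"
declare light_words.simps [exec]
text \<open>As before, but \<open>x\<close> is restricted to words with leading entry 1, one from each line.\<close>
fun light_words_lead :: "nat \<Rightarrow> nat \<Rightarrow> word \<Rightarrow> (word \<times> word \<times> word) list \<Rightarrow> word list" where
  "light_words_lead k b xa [] = []"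
| "light_words_lead k b xa ((r1, r2, r3) # rs) = app (light_words_lead k b (Zero4 # xa) rs) (light_words k b (One4 # xa) r1 rs)"
declare light_words_lead.simps [exec]

fun lead :: "word \<Rightarrow> gf4" where "lead [] = 0" | "lead (x # xs) = (if x = 0 then lead xs else x)"
lemma lead_exec [exec]: "lead [] = Zero4" "lead (Zero4 # xs) = lead xs" "lead (One4 # xs) = One4"
  "lead (Omega # xs) = Omega" "lead (Omega_bar # xs) = Omega_bar"
  by (simp_all add: zero_gf4_def)
declare inverse_gf4.simps [exec]

fun split_rev :: "nat \<Rightarrow> 'a list \<Rightarrow> 'a list \<Rightarrow> 'a list \<times> 'a list" where
  "split_rev 0 ys xs = (ys, xs)" | "split_rev (Suc n) ys [] = (ys, [])" | "split_rev (Suc n) ys (x # xs) = split_rev n (x # ys) xs"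
declare split_rev.simps [exec]
fun swap_if :: "bool \<Rightarrow> word \<Rightarrow> word \<Rightarrow> word list \<Rightarrow> word list" where
  "swap_if True ry x ws = ws" | "swap_if False ry x ws = scl (inverse (lead x)) (app x (rapp ry [])) # ws"
fun swap_one :: "nat \<Rightarrow> word \<times> word \<Rightarrow> word list \<Rightarrow> word list" where "swap_one h (ry, x) ws = swap_if (weight_le h x) ry x ws"
fun swap_halves :: "nat \<Rightarrow> word list \<Rightarrow> word list" where
  "swap_halves h [] = []" | "swap_halves h (w # ws) = swap_one h (split_rev 9 [] w) (swap_halves h ws)"
declare swap_if.simps [exec] swap_one.simps [exec] swap_halves.simps [exec]

text \<open>The light words of the code generated by \<open>(I | A)\<close>, one from each line, for \<open>B\<close> the inverse of \<open>A\<close>: a word of weight at most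
\<open>2 h + 2\<close> has weight at most \<open>h + 1\<close> on the left half or weight at most \<open>h\<close> on the right half. The words of the
second kind are found from the generator matrix \<open>(B | I)\<close> and are kept only if they are not of the first kind.\<close>
fun words :: "nat \<Rightarrow> word list \<Rightarrow> word list \<Rightarrow> word list" where
  "words h A B = app (light_words_lead h (h + h + 1) [] (multiples A)) (swap_halves (Suc h) (light_words_lead (h - 1) (h + h + 1) [] (multiples B)))"
declare words.simps [exec]

definition of_weight :: "nat \<Rightarrow> word list \<Rightarrow> word list" where "of_weight n ws = filter (\<lambda>w. wt w = n) ws"
definition consif :: "bool \<Rightarrow> 'a \<Rightarrow> 'a list \<Rightarrow> 'a list" where "consif b x xs = (if b then x # xs else xs)"
lemma of_weight_exec [exec]: "of_weight n [] = []" "of_weight n (w # ws) = consif (wt w = n) w (of_weight n ws)"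
  "consif True x xs = x # xs" "consif False x xs = xs"
  by (simp_all add: of_weight_def consif_def)

text \<open>The statistics of a column of a group of words: the number of words that are nonzero there, or the
number of occurrences of each nonzero value. Columns are consumed from the left, so that the current column is
formed by the heads.\<close>
definition head_support :: "word list \<Rightarrow> nat" where "head_support ws = length (filter (\<lambda>w. hd w \<noteq> 0) ws)"
lemma head_support_exec [exec]: "head_support [] = 0" "head_support ((Zero4 # w) # ws) = head_support ws" "head_support ((One4 # w) # ws) = Suc (head_support ws)"
  "head_support ((Omega # w) # ws) = Suc (head_support ws)" "head_support ((Omega_bar # w) # ws) = Suc (head_support ws)"
  by (simp_all add: head_support_def zero_gf4_def)
definition head_count :: "gf4 \<Rightarrow> word list \<Rightarrow> nat" where "head_count v ws = length (filter (\<lambda>w. hd w = v) ws)"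
definition head_counts :: "nat \<Rightarrow> nat \<Rightarrow> nat \<Rightarrow> word list \<Rightarrow> nat \<times> nat \<times> nat" where
  "head_counts a b c ws = (a + head_count One4 ws, b + head_count Omega ws, c + head_count Omega_bar ws)"
lemma head_counts_exec [exec]:
 "head_counts a b c [] = (a, b, c)"
 "head_counts a b c ((Zero4 # w) # ws) = head_counts a b c ws"
 "head_counts a b c ((One4 # w) # ws) = head_counts (Suc a) b c ws"
 "head_counts a b c ((Omega # w) # ws) = head_counts a (Suc b) c ws"
 "head_counts a b c ((Omega_bar # w) # ws) = head_counts a b (Suc c) ws"
  by (simp_all add: head_counts_def head_count_def)
definition head_support_is :: "nat \<Rightarrow> word list \<Rightarrow> bool" where "head_support_is n ws \<longleftrightarrow> head_support ws = n"
lemma head_support_is_exec [exec]: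
  "head_support_is 0 [] = True" "head_support_is (Suc n) [] = False"
  "head_support_is n ((Zero4 # w) # ws) = head_support_is n ws"
  "head_support_is (Suc n) ((One4 # w) # ws) = head_support_is n ws" "head_support_is 0 ((One4 # w) # ws) = False"
  "head_support_is (Suc n) ((Omega # w) # ws) = head_support_is n ws" "head_support_is 0 ((Omega # w) # ws) = False"
  "head_support_is (Suc n) ((Omega_bar # w) # ws) = head_support_is n ws" "head_support_is 0 ((Omega_bar # w) # ws) = False"
  by (simp_all add: head_support_is_def head_support_exec)
definition head_counts_are :: "nat \<Rightarrow> nat \<Rightarrow> nat \<Rightarrow> word list \<Rightarrow> bool" where "head_counts_are a b c ws \<longleftrightarrow> (a, b, c) = head_counts 0 0 0 ws"
lemma head_counts_are_exec [exec]:
  "head_counts_are 0 0 0 [] = True" "head_counts_are (Suc a) b c [] = False" "head_counts_are a (Suc b) c [] = False" "head_counts_are a b (Suc c) [] = False"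
  "head_counts_are a b c ((Zero4 # w) # ws) = head_counts_are a b c ws"
  "head_counts_are (Suc a) b c ((One4 # w) # ws) = head_counts_are a b c ws" "head_counts_are 0 b c ((One4 # w) # ws) = False"
  "head_counts_are a (Suc b) c ((Omega # w) # ws) = head_counts_are a b c ws" "head_counts_are a 0 c ((Omega # w) # ws) = False"
  "head_counts_are a b (Suc c) ((Omega_bar # w) # ws) = head_counts_are a b c ws" "head_counts_are a b 0 ((Omega_bar # w) # ws) = False"
  by (simp_all add: head_counts_are_def head_counts_def head_count_def)

fun head_supports_are :: "nat list \<Rightarrow> word list list \<Rightarrow> bool" where
  "head_supports_are [] zs = True" | "head_supports_are (n # hs) [] = True" | "head_supports_are (n # hs) (g # gs) = (head_support_is n g \<and> head_supports_are hs gs)"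
definition head_supports_are2 :: "bool \<Rightarrow> nat list \<Rightarrow> word list list \<Rightarrow> bool" where "head_supports_are2 b hs gs = (b \<and> head_supports_are hs gs)"
lemma head_supports_are_exec [exec]: "head_supports_are [] zs = True" "head_supports_are (n # hs) [] = True" "head_supports_are (n # hs) (g # gs) = head_supports_are2 (head_support_is n g) hs gs"
  "head_supports_are2 False hs gs = False" "head_supports_are2 True hs gs = head_supports_are hs gs"
  by (simp_all add: head_supports_are2_def)
fun head_counts_list_are :: "(nat \<times> nat \<times> nat) list \<Rightarrow> word list list \<Rightarrow> bool" where
  "head_counts_list_are [] zs = True" | "head_counts_list_are (n # hs) [] = True" | "head_counts_list_are ((a, b, c) # hs) (g # gs) = (head_counts_are a b c g \<and> head_counts_list_are hs gs)"
definition head_counts_list_are2 :: "bool \<Rightarrow> (nat \<times> nat \<times> nat) list \<Rightarrow> word list list \<Rightarrow> bool" where "head_counts_list_are2 b hs gs = (b \<and> head_counts_list_are hs gs)"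
lemma head_counts_list_are_exec [exec]: "head_counts_list_are [] zs = True" "head_counts_list_are (n # hs) [] = True" "head_counts_list_are ((a, b, c) # hs) (g # gs) = head_counts_list_are2 (head_counts_are a b c g) hs gs"
  "head_counts_list_are2 False hs gs = False" "head_counts_list_are2 True hs gs = head_counts_list_are hs gs"
  by (simp_all add: head_counts_list_are2_def)
fun head_supports :: "word list list \<Rightarrow> nat list" where "head_supports [] = []" | "head_supports (g # gs) = head_support g # head_supports gs"
fun head_counts_list :: "word list list \<Rightarrow> (nat \<times> nat \<times> nat) list" where "head_counts_list [] = []" | "head_counts_list (g # gs) = head_counts 0 0 0 g # head_counts_list gs"
fun rotate_counts :: "(nat \<times> nat \<times> nat) list \<Rightarrow> (nat \<times> nat \<times> nat) list" where "rotate_counts [] = []" | "rotate_counts ((a, b, c) # hs) = (c, a, b) # rotate_counts hs"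
fun tls_all :: "'a list list list \<Rightarrow> 'a list list list" where "tls_all [] = []" | "tls_all (g # gs) = tls g # tls_all gs"
declare head_supports.simps [exec] head_counts_list.simps [exec] rotate_counts.simps [exec] tls_all.simps [exec]

type_synonym table = "(gf4 \<times> (nat \<times> nat \<times> nat) list) list"
fun column_candidates :: "nat \<Rightarrow> table \<Rightarrow> word list list \<Rightarrow> (nat \<times> gf4) list \<Rightarrow> (nat \<times> gf4) list" where
  "column_candidates d [] ns cs = cs" | "column_candidates d ((b, h) # rb) ns cs = (if head_counts_list_are h ns then [(d, b)] else []) @ column_candidates d rb ns cs"
definition column_candidates2 :: "bool \<Rightarrow> nat \<Rightarrow> gf4 \<Rightarrow> (nat \<times> gf4) list \<Rightarrow> (nat \<times> gf4) list" where
  "column_candidates2 x d b cs = (if x then (d, b) # cs else cs)"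
lemma column_candidates_exec [exec]: "column_candidates d [] ns cs = cs" "column_candidates d ((b, h) # rb) ns cs = column_candidates2 (head_counts_list_are h ns) d b (column_candidates d rb ns cs)"
  "column_candidates2 False d b cs = cs" "column_candidates2 True d b cs = (d, b) # cs"
  by (simp_all add: column_candidates2_def)
text \<open>All columns \<open>d\<close> and scalars \<open>b\<close> such that the groups of words have the same statistics in column \<open>d\<close> as prescribed;
the table lists the prescribed counts for each scalar that the column may be multiplied with.\<close>
fun cands :: "nat \<Rightarrow> nat \<Rightarrow> table \<Rightarrow> nat list \<Rightarrow> word list list \<Rightarrow> word list list \<Rightarrow> (nat \<times> gf4) list" where
  "cands d 0 rb h zs ns = []"
| "cands d (Suc n) rb h zs ns = column_candidates d (if head_supports_are h zs then rb else []) ns (cands (Suc d) n rb h (tls_all zs) (tls_all ns))"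
definition candz :: "bool \<Rightarrow> nat \<Rightarrow> nat \<Rightarrow> table \<Rightarrow> nat list \<Rightarrow> word list list \<Rightarrow> word list list \<Rightarrow> (nat \<times> gf4) list" where
  "candz x d n rb h zs ns = column_candidates d (if x then rb else []) ns (cands (Suc d) n rb h (tls_all zs) (tls_all ns))"
lemma cands_exec [exec]:
  "cands d 0 rb h zs ns = []"
  "cands d (Suc n) rb h zs ns = candz (head_supports_are h zs) d n rb h zs ns"
  "candz False d n rb h zs ns = cands (Suc d) n rb h (tls_all zs) (tls_all ns)"
  "candz True d n rb h zs ns = column_candidates d rb ns (cands (Suc d) n rb h (tls_all zs) (tls_all ns))"
  by (simp_all add: candz_def)

definition pick :: "nat \<Rightarrow> word \<Rightarrow> gf4 \<times> word" where "pick d w = (w ! d, take d w @ drop (Suc d) w)"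
definition pick_cons :: "gf4 \<Rightarrow> gf4 \<times> word \<Rightarrow> gf4 \<times> word" where "pick_cons x p = (fst p, x # snd p)"
lemma pick_exec [exec]: "pick 0 (x # w) = (x, w)" "pick (Suc d) (x # w) = pick_cons x (pick d w)" "pick_cons x (v, w) = (v, x # w)"
  by (simp_all add: pick_def pick_cons_def)
fun picks :: "nat \<Rightarrow> word list \<Rightarrow> (gf4 \<times> word) list" where "picks d [] = []" | "picks d (w # ws) = pick d w # picks d ws"
fun picks_all :: "nat \<Rightarrow> word list list \<Rightarrow> (gf4 \<times> word) list list" where "picks_all d [] = []" | "picks_all d (g # gs) = picks d g # picks_all d gs"
declare picks.simps [exec] picks_all.simps [exec]
definition with_value :: "gf4 \<Rightarrow> (gf4 \<times> word) list \<Rightarrow> word list" where "with_value v ps = map snd (filter (\<lambda>p. fst p = v) ps)"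
lemma with_value_exec [exec]:
  "with_value v [] = []"
  "with_value Zero4 ((Zero4, w) # ps) = w # with_value Zero4 ps" "with_value Zero4 ((One4, w) # ps) = with_value Zero4 ps" "with_value Zero4 ((Omega, w) # ps) = with_value Zero4 ps" "with_value Zero4 ((Omega_bar, w) # ps) = with_value Zero4 ps"
  "with_value One4 ((Zero4, w) # ps) = with_value One4 ps" "with_value One4 ((One4, w) # ps) = w # with_value One4 ps" "with_value One4 ((Omega, w) # ps) = with_value One4 ps" "with_value One4 ((Omega_bar, w) # ps) = with_value One4 ps"
  "with_value Omega ((Zero4, w) # ps) = with_value Omega ps" "with_value Omega ((One4, w) # ps) = with_value Omega ps" "with_value Omega ((Omega, w) # ps) = w # with_value Omega ps" "with_value Omega ((Omega_bar, w) # ps) = with_value Omega ps"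
  "with_value Omega_bar ((Zero4, w) # ps) = with_value Omega_bar ps" "with_value Omega_bar ((One4, w) # ps) = with_value Omega_bar ps" "with_value Omega_bar ((Omega, w) # ps) = with_value Omega_bar ps" "with_value Omega_bar ((Omega_bar, w) # ps) = w # with_value Omega_bar ps"
  by (simp_all add: with_value_def)
definition scaled_to :: "gf4 \<Rightarrow> (gf4 \<times> word) list \<Rightarrow> word list" where
  "scaled_to b ps = map (\<lambda>p. scl (b * inverse (fst p)) (snd p)) (filter (\<lambda>p. fst p \<noteq> 0) ps)"
lemma scaled_to_exec [exec]: "scaled_to b [] = []" "scaled_to b ((Zero4, w) # ps) = scaled_to b ps" "scaled_to b ((One4, w) # ps) = scl b w # scaled_to b ps"
  "scaled_to b ((Omega, w) # ps) = scl (b * Omega_bar) w # scaled_to b ps" "scaled_to b ((Omega_bar, w) # ps) = scl (b * Omega) w # scaled_to b ps"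
  by (cases b; simp add: scaled_to_def zero_gf4_def)+
definition cons_nonempty :: "'a list \<Rightarrow> 'a list list \<Rightarrow> 'a list list" where "cons_nonempty g gs = (if g = [] then gs else g # gs)"
lemma cons_nonempty_exec [exec]: "cons_nonempty [] gs = gs" "cons_nonempty (w # ws) gs = (w # ws) # gs" by (simp_all add: cons_nonempty_def)
fun zero_parts :: "(gf4 \<times> word) list list \<Rightarrow> word list list" where "zero_parts [] = []" | "zero_parts (ps # gs) = cons_nonempty (with_value Zero4 ps) (zero_parts gs)"
fun scaled_parts :: "gf4 \<Rightarrow> (gf4 \<times> word) list list \<Rightarrow> word list list \<Rightarrow> word list list" where "scaled_parts b [] ns = ns" | "scaled_parts b (ps # gs) ns = cons_nonempty (scaled_to b ps) (scaled_parts b gs ns)"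
fun value_parts :: "gf4 \<Rightarrow> (gf4 \<times> word) list list \<Rightarrow> word list list" where "value_parts b [] = []" | "value_parts b (ps # gs) = cons_nonempty (with_value Zero4 ps) (cons_nonempty (with_value b ps) (cons_nonempty (with_value (b * Omega) ps) (cons_nonempty (with_value (b * Omega_bar) ps) (value_parts b gs))))"
declare zero_parts.simps [exec] scaled_parts.simps [exec] value_parts.simps [exec]
text \<open>A state consists of groups of light words, restricted to the coordinates not yet treated. The words in the
groups of the first component vanish on all treated coordinates and are known up to scalars only; those in
the second component are nonzero at some treated coordinate. They have been scaled at the first such coordinate,
to the value 1 in the source of a transformation and to the chosen scalar in its target.\<close>
type_synonym state = "word list list \<times> word list list"
definition split2 :: "gf4 \<Rightarrow> (gf4 \<times> word) list list \<Rightarrow> (gf4 \<times> word) list list \<Rightarrow> state" where "split2 b zp np = (zero_parts zp, scaled_parts b zp (value_parts b np))"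
text \<open>Treats column \<open>d\<close>. Each group is partitioned by the value in that column; words that are nonzero there for the first
time are scaled to have value \<open>b\<close>. Empty groups are dropped, which happens simultaneously on both sides of a
comparison.\<close>
definition split :: "nat \<Rightarrow> gf4 \<Rightarrow> state \<Rightarrow> state" where "split d b s = split2 b (picks_all d (fst s)) (picks_all d (snd s))"
lemma split_exec [exec]: "split d b (zs, ns) = split2 b (picks_all d zs) (picks_all d ns)" "split2 b zp np = (zero_parts zp, scaled_parts b zp (value_parts b np))"
  by (simp_all add: split_def split2_def)
definition scalar_table :: "(nat \<times> nat \<times> nat) list \<Rightarrow> table" where "scalar_table h = [(One4, h), (Omega, rotate_counts h), (Omega_bar, rotate_counts (rotate_counts h))]"
declare scalar_table_def [exec]
fun insert_at :: "nat \<Rightarrow> 'a \<Rightarrow> 'a list \<Rightarrow> 'a list" where "insert_at 0 x ys = x # ys" | "insert_at (Suc d) x (y # ys) = y # insert_at d x ys" | "insert_at (Suc d) x [] = [x]"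
text \<open>Undoes the removal of columns, to recover the image of a word from the path of the choices made. The path
begins with the most recent choice, so the word is given in reverse.\<close>
fun rebuild :: "word \<Rightarrow> (nat \<times> gf4) list \<Rightarrow> word \<Rightarrow> word" where "rebuild acc [] xs = acc" | "rebuild acc (p # ps) [] = acc" | "rebuild acc ((d, b) # ps) (x # xs) = rebuild (insert_at d (b * x) acc) ps xs"
declare insert_at.simps [exec] rebuild.simps [exec]
fun zero_word :: "nat \<Rightarrow> word" where "zero_word 0 = []" | "zero_word (Suc n) = Zero4 # zero_word n"
definition in_code2 :: "word list \<Rightarrow> word \<times> word \<Rightarrow> bool" where "in_code2 A p = (add_product (zero_word 9) (rapp (fst p) []) A = snd p)"
definition in_code :: "word list \<Rightarrow> word \<Rightarrow> bool" where "in_code A w = in_code2 A (split_rev 9 [] w)"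
lemma in_code_exec [exec]: "in_code2 A (r, y) = (add_product (zero_word 9) (rapp r []) A = y)" by (simp add: in_code2_def)
declare zero_word.simps [exec] in_code_def [exec]
text \<open>At the bottom of the search all images are known, and the transformation is tested on the generators.\<close>
fun rows_in_code :: "word list \<Rightarrow> word list \<Rightarrow> (nat \<times> gf4) list \<Rightarrow> bool" where
  "rows_in_code [] A p = True" | "rows_in_code (r # rs) A p = (in_code A (rebuild [] p r) \<and> rows_in_code rs A p)"
definition rows_in_code2 :: "bool \<Rightarrow> word list \<Rightarrow> word list \<Rightarrow> (nat \<times> gf4) list \<Rightarrow> bool" where "rows_in_code2 x rs A p = (x \<and> rows_in_code rs A p)"
lemma rows_in_code_exec [exec]: "rows_in_code [] A p = True" "rows_in_code (r # rs) A p = rows_in_code2 (in_code A (rebuild [] p r)) rs A p"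
   "rows_in_code2 False rs A p = False" "rows_in_code2 True rs A p = rows_in_code rs A p" by (simp_all add: rows_in_code2_def)
definition support_profile :: "state \<Rightarrow> nat list" where "support_profile s = head_supports (fst s)"
definition count_table :: "state \<Rightarrow> table" where "count_table s = scalar_table (head_counts_list (snd s))"
definition candidates :: "nat \<Rightarrow> table \<Rightarrow> nat list \<Rightarrow> state \<Rightarrow> (nat \<times> gf4) list" where "candidates n rb h s = cands 0 n rb h (fst s) (snd s)"
lemma st_exec [exec]: "support_profile (zs, ns) = head_supports zs" "count_table (zs, ns) = scalar_table (head_counts_list ns)" "candidates n rb h (zs, ns) = cands 0 n rb h zs ns"
  by (simp_all add: support_profile_def count_table_def candidates_def)
text \<open>The search proper. Treating one coordinate of the source \<open>u\<close> at a time, it tries all images in \<open>v\<close> with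
matching statistics.\<close>
fun ext :: "nat \<Rightarrow> (nat \<times> gf4) list \<Rightarrow> word list \<Rightarrow> word list \<Rightarrow> state \<Rightarrow> state \<Rightarrow> bool" where
  "ext 0 p R A u v = rows_in_code R A p"
| "ext (Suc n) p R A u v = (\<exists>c \<in> set (candidates (Suc n) (count_table u) (support_profile u) v). ext n (c # p) R A (split 0 One4 u) (split (fst c) (snd c) v))"
definition extendable_by where
  "extendable_by n p cs R A u v = (\<exists>c \<in> set cs. ext n (c # p) R A u (split (fst c) (snd c) v))"
definition extendable_by2 where "extendable_by2 x n p cs R A u v = (x \<or> extendable_by n p cs R A u v)"
lemma ext_exec [exec]:
  "ext 0 p R A u v = rows_in_code R A p"
  "ext (Suc n) p R A u v = extendable_by n p (candidates (Suc n) (count_table u) (support_profile u) v) R A (split 0 One4 u) v"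
  "extendable_by n p [] R A u v = False"
  "extendable_by n p ((d, b) # cs) R A u v = extendable_by2 (ext n ((d, b) # p) R A u (split d b v)) n p cs R A u v"
  "extendable_by2 True n p cs R A u v = True"
  "extendable_by2 False n p cs R A u v = extendable_by n p cs R A u v"
  by (simp_all add: extendable_by_def extendable_by2_def)
fun mem :: "nat \<times> gf4 \<Rightarrow> (nat \<times> gf4) list \<Rightarrow> bool" where "mem x [] = False" | "mem x (y # ys) = (x = y \<or> mem x ys)"
declare mem.simps [exec]
text \<open>The number of candidates for the image of the next coordinate after a search has excluded some of
those in \<open>bs\<close>. Naming the candidates to be tested avoids successful, fruitless searches.\<close>
fun survivors :: "(nat \<times> gf4) list \<Rightarrow> nat \<Rightarrow> (nat \<times> gf4) list \<Rightarrow> (nat \<times> gf4) list \<Rightarrow> word list \<Rightarrow> word list \<Rightarrow> state \<Rightarrow> state \<Rightarrow> nat" where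
  "survivors [] n p bs R A u v = 0"
| "survivors (c # cs) n p bs R A u v =
    (if mem c bs \<and> \<not> ext n (c # p) R A u (split (fst c) (snd c) v) then 0 else 1) + survivors cs n p bs R A u v"
definition survivors3 :: "bool \<Rightarrow> nat \<Rightarrow> nat" where "survivors3 x m = (if x then Suc m else m)"
definition survivors2 where
 "survivors2 x c cs n p bs R A u v = survivors3 (\<not> (x \<and> \<not> ext n (c # p) R A u (split (fst c) (snd c) v))) (survivors cs n p bs R A u v)"
lemma survivors_exec [exec]:
  "survivors [] n p bs R A u v = 0"
  "survivors (c # cs) n p bs R A u v = survivors2 (mem c bs) c cs n p bs R A u v"
  "survivors2 False c cs n p bs R A u v = Suc (survivors cs n p bs R A u v)"
  "survivors2 True (d, b) cs n p bs R A u v = survivors3 (ext n ((d, b) # p) R A u (split d b v)) (survivors cs n p bs R A u v)"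
  "survivors3 True m = Suc m" "survivors3 False m = m"
  by (simp_all add: survivors2_def survivors3_def)
text \<open>The bounds for the successive orbits in the chain of stabilisers: coordinates treated so far are fixed
with scalar 1.\<close>
fun stabiliser_chain_from :: "(nat \<times> gf4) list list \<Rightarrow> nat \<Rightarrow> (nat \<times> gf4) list \<Rightarrow> word list \<Rightarrow> word list \<Rightarrow> state \<Rightarrow> nat list" where
  "stabiliser_chain_from [] n p R A u = []"
| "stabiliser_chain_from (bs # bads) 0 p R A u = []"
| "stabiliser_chain_from (bs # bads) (Suc n) p R A u = survivors (candidates (Suc n) (count_table u) (support_profile u) u) n p bs R A (split 0 One4 u) u # stabiliser_chain_from bads n ((0, One4) # p) R A (split 0 One4 u)"
text \<open>Automorphisms may be multiplied by scalars, so the scalar at the first coordinate is normalised to 1 and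
only the column is left open.\<close>
fun stabiliser_chain :: "(nat \<times> gf4) list list \<Rightarrow> word list \<Rightarrow> word list \<Rightarrow> state \<Rightarrow> nat list" where
  "stabiliser_chain [] R A u = []"
| "stabiliser_chain (bs # bads) R A u = survivors (candidates 18 [(One4, [])] (support_profile u) u) 17 [] bs R A (split 0 One4 u) u # stabiliser_chain_from bads 17 [(0, One4)] R A (split 0 One4 u)"
declare stabiliser_chain_from.simps [exec] stabiliser_chain.simps [exec]
fun unitrow :: "nat \<Rightarrow> nat \<Rightarrow> word" where
  "unitrow 0 i = []" | "unitrow (Suc n) 0 = One4 # unitrow n n" | "unitrow (Suc n) (Suc i) = Zero4 # unitrow n i"
fun reversed_rows :: "nat \<Rightarrow> word list \<Rightarrow> word list" where
  "reversed_rows i [] = []" | "reversed_rows i (r # rs) = rapp r (rapp (unitrow 9 i) []) # reversed_rows (Suc i) rs"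
text \<open>Initially the groups consist of the words of each possible weight.\<close>
definition initial_state :: "word list \<Rightarrow> state" where "initial_state ws = ([of_weight 2 ws, of_weight 4 ws, of_weight 6 ws, of_weight 8 ws], [])"
fun lengths :: "'a list list \<Rightarrow> nat list" where "lengths [] = []" | "lengths (x # xs) = length x # lengths xs"
declare unitrow.simps [exec] reversed_rows.simps [exec] initial_state_def [exec] lengths.simps [exec] list.size(3) [exec]
lemma length_exec [exec]: "length (x # xs) = Suc (length xs)" by simp
text \<open>A word as the base 4 digits of a numeral, least significant first, below a leading digit 1.\<close>
fun digits :: "num \<Rightarrow> word" where
  "digits num.One = []" | "digits (num.Bit0 num.One) = []" | "digits (num.Bit1 num.One) = []"
| "digits (num.Bit0 (num.Bit0 n)) = Zero4 # digits n" | "digits (num.Bit1 (num.Bit0 n)) = One4 # digits n"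
| "digits (num.Bit0 (num.Bit1 n)) = Omega # digits n" | "digits (num.Bit1 (num.Bit1 n)) = Omega_bar # digits n"
definition decode :: "int \<Rightarrow> word" where "decode n = digits (num_of_nat (nat n))"
lemma num_dec_numeral [exec]: "decode (numeral n) = digits n" by (simp add: decode_def num_of_nat_numeral_eq)
fun chop :: "nat \<Rightarrow> word \<Rightarrow> word list" and chop2 :: "nat \<Rightarrow> word \<times> word \<Rightarrow> word list" where
  "chop 0 xs = []" | "chop (Suc n) xs = chop2 n (split_rev 9 [] xs)" | "chop2 n (r, xs) = rapp r [] # chop n xs"
declare digits.simps [exec] chop.simps [exec] chop2.simps [exec]
lemmas [exec] = numeral_eq_Suc pred_numeral_simps BitM.simps add_0 add_0_right add_Suc diff_Suc_Suc diff_0_eq_0 diff_zero add_Suc_right One_nat_def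

section \<open>Monomial maps and the soundness of the search\<close>

text \<open>The entry at position \<open>i\<close> is multiplied by \<open>s i\<close> and moved to position \<open>p i\<close>.\<close>
definition mono :: "(nat \<Rightarrow> nat) \<Rightarrow> (nat \<Rightarrow> gf4) \<Rightarrow> word \<Rightarrow> word" where
  "mono p s w = map (\<lambda>j. s (inv p j) * w ! inv p j) [0..<18]"

definition proj :: "nat list \<Rightarrow> word \<Rightarrow> word" where "proj ts w = map ((!) w) ts"
definition del :: "nat \<Rightarrow> 'a list \<Rightarrow> 'a list" where "del d w = take d w @ drop (Suc d) w"

lemma length_scl [simp]: "length (scl c w) = length w" by (simp add: scl_def)
lemma nth_scl: "i < length w \<Longrightarrow> scl c w ! i = c * w ! i" by (simp add: scl_def)
lemma scl_scl: "scl a (scl b w) = scl (a * b) w" by (simp add: scl_def mult.assoc)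
lemma scl_1 [simp]: "scl 1 w = w" by (simp add: scl_def map_idI)

lemma proj_scl: "(\<forall>t\<in>set ts. t < length w) \<Longrightarrow> proj ts (scl c w) = scl c (proj ts w)"
  by (auto simp: proj_def scl_def)

lemma del_proj: "del d (proj ts w) = proj (del d ts) w"
  by (simp add: del_def proj_def take_map drop_map)

lemma tls_map: "tls ws = map tl ws" by (induction ws) auto
lemma tls_all_map: "tls_all gs = map (map tl) gs" by (induction gs) (auto simp: tls_map)
lemma picks_map: "picks d ws = map (pick d) ws" by (induction ws) auto
lemma picks_all_map: "picks_all d ws = map (picks d) ws" by (induction ws) auto

lemma column_candidates_eq: "column_candidates d rb ns cs = map (\<lambda>(b, h). (d, b)) (filter (\<lambda>(b, h). head_counts_list_are h ns) rb) @ cs"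
  by (induction rb) auto

lemma cands_contains:
  assumes "i < n" "head_supports_are h (map (map (drop i)) zs)" "(b, h') \<in> set rb" "head_counts_list_are h' (map (map (drop i)) ns)"
  shows "(d + i, b) \<in> set (cands d n rb h zs ns)"
  using assms
proof (induction n arbitrary: d i zs ns)
  case (Suc n)
  note P = Suc.prems and IH = Suc.IH
  show ?case
  proof (cases i)
    case 0
    then have "head_counts_list_are h' ns" "head_supports_are h zs" using P by simp_all
    then show ?thesis using P(3) 0 by (auto simp: column_candidates_eq intro!: image_eqI[of _ _ "(b, h')"])
  next
    case (Suc j)
    have t: "map (map (drop j)) (tls_all gs) = map (map (drop i)) gs" for gs :: "word list list"
      using Suc by (simp add: tls_all_map drop_Suc)
    have "(Suc d + j, b) \<in> set (cands (Suc d) n rb h (tls_all zs) (tls_all ns))"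
      by (rule IH) (use P Suc t in simp_all)
    then show ?thesis using Suc by (simp add: column_candidates_eq)
  qed
qed simp

lemma ins_del: "d < length w \<Longrightarrow> insert_at d (w ! d) (del d w) = w"
proof (induction w arbitrary: d)
  case (Cons x w)
  then show ?case by (cases d) (auto simp: del_def)
qed simp

locale monomial =
  fixes p :: "nat \<Rightarrow> nat" and s :: "nat \<Rightarrow> gf4"
  assumes perm: "p permutes {..<18}" and nz: "\<And>i. i < 18 \<Longrightarrow> s i \<noteq> 0"
begin

abbreviation T :: "word \<Rightarrow> word" where "T \<equiv> mono p s"

lemma length_T [simp]: "length (T w) = 18" by (simp add: mono_def)

lemma p_less [simp]: "p i < 18 \<longleftrightarrow> i < 18"
  using permutes_in_image[OF perm, of i] by simp

lemma nth_T: "i < 18 \<Longrightarrow> T w ! p i = s i * w ! i"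
  by (simp add: mono_def permutes_inverses(2)[OF perm])

text \<open>The correspondence maintained by the search, before coordinate \<open>k\<close> is treated: some words \<open>cs\<close> of the source
give the group \<open>us\<close> by dropping the treated coordinates, and their images, scaled by \<open>f\<close>, give the group \<open>vs\<close>
by restriction to the remaining target coordinates \<open>ts\<close>. The order of \<open>vs\<close> is arbitrary.\<close>
definition rel :: "(word \<Rightarrow> gf4) \<Rightarrow> nat \<Rightarrow> nat list \<Rightarrow> word list \<Rightarrow> word list \<Rightarrow> bool" where
  "rel f k ts us vs \<longleftrightarrow> (\<exists>cs. us = map (drop k) cs \<and> (\<forall>c\<in>set cs. length c = 18 \<and> f c \<noteq> 0)
     \<and> mset vs = image_mset (\<lambda>c. proj ts (scl (f c) (T c))) (mset cs))"

definition relZ where "relZ k ts us vs \<longleftrightarrow> (\<exists>f. rel f k ts us vs)"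
definition relN where "relN k ts us vs \<longleftrightarrow> rel (\<lambda>_. 1) k ts us vs"

definition rels :: "nat \<Rightarrow> nat list \<Rightarrow> state \<Rightarrow> state \<Rightarrow> bool" where
  "rels k ts u v \<longleftrightarrow> list_all2 (relZ k ts) (fst u) (fst v) \<and> list_all2 (relN k ts) (snd u) (snd v)"

definition remaining :: "nat \<Rightarrow> nat list \<Rightarrow> bool" where
  "remaining k ts \<longleftrightarrow> distinct ts \<and> set ts = p ` {k..<18}"

lemma remaining_nth:
  assumes "remaining k ts" "k < 18"
  obtains d where "d < length ts" "ts ! d = p k" "remaining (Suc k) (del d ts)" "length ts = 18 - k"
proof -
  have dist: "distinct ts" and set: "set ts = p ` {k..<18}" using assms(1) unfolding remaining_def by blast+
  have inj: "inj p" using perm by (rule permutes_inj)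
  have "p k \<in> set ts" unfolding set using assms(2) by (intro imageI) simp
  then obtain d where d: "d < length ts" "ts ! d = p k" unfolding in_set_conv_nth by blast
  have ts: "take d ts @ p k # drop (Suc d) ts = ts" using id_take_nth_drop[OF d(1)] d(2) by simp
  have "distinct (take d ts @ p k # drop (Suc d) ts)" unfolding ts by (rule dist)
  then have dist': "distinct (del d ts)" "p k \<notin> set (del d ts)" by (auto simp: del_def)
  have "set (take d ts @ p k # drop (Suc d) ts) = insert (p k) (set (del d ts))" by (simp add: del_def)
  then have "insert (p k) (set (del d ts)) = p ` {k..<18}" unfolding ts set by (rule sym)
  moreover have "{k..<18} = insert k {Suc k..<18}" using assms(2) by auto
  moreover have "p k \<notin> p ` {Suc k..<18}" by (simp add: inj_image_mem_iff[OF inj])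
  ultimately have "set (del d ts) = p ` {Suc k..<18}" using dist'(2)
    by (metis image_insert insert_ident)
  moreover have "length ts = 18 - k"
    using distinct_card[OF dist] card_image[OF inj_on_subset[OF inj subset_UNIV], of "{k..<18}"] by (simp add: set)
  ultimately show ?thesis using that[OF d] dist'(1) unfolding remaining_def by blast
qed

lemma remaining_less: "remaining k ts \<Longrightarrow> t \<in> set ts \<Longrightarrow> t < 18"
  by (auto simp: remaining_def)

lemma proj_nth: "d < length ts \<Longrightarrow> ts ! d = p k \<Longrightarrow> k < 18 \<Longrightarrow>
   proj ts (scl a (T c)) ! d = a * (s k * c ! k)"
  by (simp add: proj_def nth_scl nth_T)

lemma size_eq_of_mset: "mset vs = image_mset g (mset cs) \<Longrightarrow> length (filter P vs) = length (filter (\<lambda>c. P (g c)) cs)"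
proof -
  assume m: "mset vs = image_mset g (mset cs)"
  have "length (filter P vs) = size (filter_mset P (mset vs))" by (simp flip: mset_filter)
  also have "\<dots> = size (filter_mset (\<lambda>c. P (g c)) (mset cs))" by (simp add: m filter_mset_image_mset)
  also have "\<dots> = length (filter (\<lambda>c. P (g c)) cs)" by (simp flip: mset_filter)
  finally show ?thesis .
qed

lemma head_support_rel:
  assumes r: "rel f k ts us vs" and d: "d < length ts" "ts ! d = p k" "k < 18"
  shows "head_support (map (drop d) vs) = head_support us"
proof -
  obtain cs where cs: "us = map (drop k) cs" "\<forall>c\<in>set cs. length c = 18 \<and> f c \<noteq> 0"
    "mset vs = image_mset (\<lambda>c. proj ts (scl (f c) (T c))) (mset cs)" using r by (auto simp: rel_def)
  have len: "\<forall>v\<in>set vs. d < length v"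
    using arg_cong[OF cs(3), of set_mset] d by (auto simp: proj_def)
  have "head_support (map (drop d) vs) = length (filter (\<lambda>v. v ! d \<noteq> 0) vs)"
    using len by (simp add: head_support_def filter_map o_def hd_drop_conv_nth cong: filter_cong)
  also have "\<dots> = length (filter (\<lambda>c. c ! k \<noteq> 0) cs)"
    unfolding size_eq_of_mset[OF cs(3)] proj_nth[OF d]
    using cs(2) nz[OF d(3)] by (simp cong: filter_cong)
  also have "\<dots> = head_support us"
    unfolding cs(1) using cs(2) d(3) by (simp add: head_support_def filter_map o_def hd_drop_conv_nth cong: filter_cong)
  finally show ?thesis .
qed

lemma head_count_rel:
  assumes r: "rel (\<lambda>_. 1) k ts us vs" and d: "d < length ts" "ts ! d = p k" "k < 18"
  shows "head_count (s k * x) (map (drop d) vs) = head_count x us"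
proof -
  obtain cs where cs: "us = map (drop k) cs" "\<forall>c\<in>set cs. length c = 18"
    "mset vs = image_mset (\<lambda>c. proj ts (scl 1 (T c))) (mset cs)" using r by (auto simp: rel_def)
  have len: "\<forall>v\<in>set vs. d < length v"
    using arg_cong[OF cs(3), of set_mset] d by (auto simp: proj_def)
  have "head_count (s k * x) (map (drop d) vs) = length (filter (\<lambda>v. v ! d = s k * x) vs)"
    using len by (simp add: head_count_def filter_map o_def hd_drop_conv_nth cong: filter_cong)
  also have "\<dots> = length (filter (\<lambda>c. c ! k = x) cs)"
    unfolding size_eq_of_mset[OF cs(3)] proj_nth[OF d]
    using nz[OF d(3)] by (simp cong: filter_cong)
  also have "\<dots> = head_count x us"
    unfolding cs(1) using cs(2) d(3) by (simp add: head_count_def filter_map o_def hd_drop_conv_nth cong: filter_cong)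
  finally show ?thesis .
qed

lemma head_supports_are_rel:
  assumes "list_all2 (relZ k ts) zs zs'" "d < length ts" "ts ! d = p k" "k < 18"
  shows "head_supports_are (head_supports zs) (map (map (drop d)) zs')"
  using assms(1)
proof (induction rule: list_all2_induct)
  case (Cons u us v vs)
  then obtain f where "rel f k ts u v" by (auto simp: relZ_def)
  with Cons show ?case using head_support_rel[OF _ assms(2-4)] by (simp add: head_support_is_def)
qed simp

definition rotc :: "gf4 \<Rightarrow> nat \<times> nat \<times> nat \<Rightarrow> nat \<times> nat \<times> nat" where
  "rotc b h = (case h of (x, y, z) \<Rightarrow> if b = One4 then (x, y, z) else if b = Omega then (z, x, y) else (y, z, x))"

lemma rots_rotc: "b \<noteq> 0 \<Longrightarrow> (b, map (rotc b) h) \<in> set (scalar_table h)"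
proof -
  have 1: "rotate_counts h = map (rotc Omega) h" by (induction h rule: rotate_counts.induct) (auto simp: rotc_def)
  have 2: "rotate_counts (rotate_counts h) = map (rotc Omega_bar) h" by (induction h rule: rotate_counts.induct) (auto simp: rotc_def)
  have 3: "h = map (rotc One4) h" by (induction h) (auto simp: rotc_def)
  assume "b \<noteq> 0"
  then show ?thesis using 1 2 3 unfolding scalar_table_def by (cases b) (auto simp: zero_gf4_def)
qed

lemma head_counts_list_map: "head_counts_list gs = map (head_counts 0 0 0) gs" by (induction gs) auto

lemma head_counts_list_are_rel:
  assumes "list_all2 (relN k ts) ns ns'" "d < length ts" "ts ! d = p k" "k < 18"
  shows "head_counts_list_are (map (rotc (s k)) (head_counts_list ns)) (map (map (drop d)) ns')"
  using assms(1)
proof (induction rule: list_all2_induct)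
  case (Cons u us v vs)
  have h: "head_count (s k * x) (map (drop d) v) = head_count x u" for x
    using head_count_rel[OF _ assms(2-4)] Cons(1) by (simp add: relN_def)
  have "rotc (s k) (head_counts 0 0 0 u) = head_counts 0 0 0 (map (drop d) v)"
    using h[of One4] h[of Omega] h[of Omega_bar] nz[OF assms(4)]
    by (cases "s k") (auto simp: head_counts_def rotc_def zero_gf4_def)
  moreover obtain a b c where "head_counts 0 0 0 (map (drop d) v) = (a, b, c)" by (metis prod_cases3)
  ultimately show ?case using Cons by (simp add: head_counts_are_def)
qed simp

lemma candidates_contains:
  assumes "rels k ts u v" "d < length ts" "ts ! d = p k" "k < 18" "n = length ts"
  shows "(d, s k) \<in> set (candidates n (count_table u) (support_profile u) v)"
proof -
  have r: "list_all2 (relZ k ts) (fst u) (fst v)" "list_all2 (relN k ts) (snd u) (snd v)"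
    using assms(1) by (simp_all add: rels_def)
  have "(0 + d, s k) \<in> set (cands 0 n (scalar_table (head_counts_list (snd u))) (head_supports (fst u)) (fst v) (snd v))"
    by (rule cands_contains[OF _ head_supports_are_rel[OF r(1) assms(2-4)] rots_rotc[OF nz[OF assms(4)]] head_counts_list_are_rel[OF r(2) assms(2-4)]])
       (use assms in simp)
  then show ?thesis by (simp add: candidates_def count_table_def support_profile_def)
qed

lemma mset_with_value: "mset (with_value x (picks d ws)) = image_mset (del d) (filter_mset (\<lambda>w. w ! d = x) (mset ws))"
  by (simp add: with_value_def picks_map pick_def del_def[abs_def] filter_map o_def mset_filter)

lemma with_value_drop:
  assumes "\<forall>c\<in>set cs. length c = 18" "k < 18"
  shows "with_value x (picks 0 (map (drop k) cs)) = map (drop (Suc k)) (filter (\<lambda>c. c ! k = x) cs)"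
  using assms by (induction cs) (auto simp: with_value_def pick_def)

lemma rel_with_value:
  assumes r: "rel f k ts us vs" and d: "d < length ts" "ts ! d = p k" "k < 18"
    and xy: "\<And>c. f c \<noteq> 0 \<Longrightarrow> f c * (s k * c ! k) = y \<longleftrightarrow> c ! k = x"
  shows "rel f (Suc k) (del d ts) (with_value x (picks 0 us)) (with_value y (picks d vs))"
proof -
  obtain cs where cs: "us = map (drop k) cs" "\<forall>c\<in>set cs. length c = 18 \<and> f c \<noteq> 0"
    "mset vs = image_mset (\<lambda>c. proj ts (scl (f c) (T c))) (mset cs)" using r by (auto simp: rel_def)
  let ?cs = "filter (\<lambda>c. c ! k = x) cs"
  have "mset (with_value y (picks d vs)) = image_mset (\<lambda>c. proj (del d ts) (scl (f c) (T c))) (mset ?cs)"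
    unfolding mset_with_value cs(3) filter_mset_image_mset mset_filter image_mset.compositionality o_def
      del_proj proj_nth[OF d]
    using cs(2) xy by (intro arg_cong2[where f = image_mset] refl filter_mset_cong) auto
  then show ?thesis unfolding rel_def cs(1)
    using cs(2) d(3) by (intro exI[of _ ?cs]) (auto simp: with_value_drop)
qed

lemma T_scl: "length c = 18 \<Longrightarrow> T (scl a c) = scl a (T c)"
  using permutes_in_image[OF permutes_inv[OF perm]]
  by (auto simp: mono_def scl_def algebra_simps)

text \<open>Words that become nonzero at coordinate \<open>k\<close> lose their scalar ambiguity: the source words are scaled to 1 there, so
that their images must be scaled to \<open>s k\<close>.\<close>
lemma rel_scaled_to:
  assumes r: "rel f k ts us vs" and d: "d < length ts" "ts ! d = p k" "k < 18"
     and ts: "\<forall>t\<in>set ts. t < 18"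
  shows "rel (\<lambda>_. 1) (Suc k) (del d ts) (scaled_to 1 (picks 0 us)) (scaled_to (s k) (picks d vs))"
proof -
  obtain cs where cs: "us = map (drop k) cs" "\<forall>c\<in>set cs. length c = 18 \<and> f c \<noteq> 0"
    "mset vs = image_mset (\<lambda>c. proj ts (scl (f c) (T c))) (mset cs)" using r by (auto simp: rel_def)
  let ?n = "\<lambda>c. scl (inverse (c ! k)) c"
  let ?cs = "filter (\<lambda>c. c ! k \<noteq> 0) cs"
  have ts': "\<forall>t\<in>set (del d ts). t < 18" using ts by (auto simp: del_def dest: in_set_takeD in_set_dropD)
  have 1: "scaled_to 1 (picks 0 us) = map (drop (Suc k)) (map ?n ?cs)"
    unfolding cs(1) using cs(2) d(3) by (induction cs) (auto simp: scaled_to_def pick_def scl_def drop_map)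
  have "mset (scaled_to (s k) (picks d vs)) = image_mset (\<lambda>w. scl (s k * inverse (w ! d)) (del d w)) (filter_mset (\<lambda>w. w ! d \<noteq> 0) (mset vs))"
    by (simp add: scaled_to_def picks_map pick_def del_def filter_map o_def mset_filter)
  also have "\<dots> = image_mset (\<lambda>c. scl (s k * inverse (f c * (s k * c ! k))) (proj (del d ts) (scl (f c) (T c))))
      (filter_mset (\<lambda>c. f c * (s k * c ! k) \<noteq> 0) (mset cs))"
    unfolding cs(3) filter_mset_image_mset image_mset.compositionality o_def del_proj proj_nth[OF d] ..
  also have "\<dots> = image_mset (\<lambda>c. proj (del d ts) (scl 1 (T (?n c)))) (filter_mset (\<lambda>c. f c * (s k * c ! k) \<noteq> 0) (mset cs))"
  proof (rule image_mset_cong)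
    fix c assume "c \<in># filter_mset (\<lambda>c. f c * (s k * c ! k) \<noteq> 0) (mset cs)"
    then have c: "c \<in> set cs" "length c = 18" "f c \<noteq> 0" "c ! k \<noteq> 0" using cs(2) by auto
    have "s k * inverse (f c * (s k * c ! k)) * f c = inverse (c ! k)"
      using c nz[OF d(3)] by (simp add: field_simps)
    then have "scl (s k * inverse (f c * (s k * c ! k))) (proj (del d ts) (scl (f c) (T c)))
        = scl (inverse (c ! k)) (proj (del d ts) (T c))"
      using ts' by (simp only: proj_scl scl_scl length_T)
    also have "\<dots> = proj (del d ts) (scl 1 (T (?n c)))" using c ts' by (simp add: proj_scl T_scl)
    finally show "scl (s k * inverse (f c * (s k * c ! k))) (proj (del d ts) (scl (f c) (T c)))
        = proj (del d ts) (scl 1 (T (?n c)))" .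
  qed
  also have "filter_mset (\<lambda>c. f c * (s k * c ! k) \<noteq> 0) (mset cs) = mset ?cs"
    unfolding mset_filter using cs(2) nz[OF d(3)] by (intro filter_mset_cong) auto
  finally have 2: "mset (scaled_to (s k) (picks d vs)) = image_mset (\<lambda>c. proj (del d ts) (scl 1 (T c))) (mset (map ?n ?cs))"
    by (simp add: image_mset.compositionality o_def)
  show ?thesis unfolding rel_def 1
    by (intro exI[of _ "map ?n ?cs"]) (use 2 cs(2) in auto)
qed

lemma list_all2_cons_nonempty:
  assumes "R g g'" "list_all2 R gs gs'" "g = [] \<longleftrightarrow> g' = []"
  shows "list_all2 R (cons_nonempty g gs) (cons_nonempty g' gs')"
  using assms by (auto simp: cons_nonempty_def)

lemma rel_empty: "rel f k ts us vs \<Longrightarrow> us = [] \<longleftrightarrow> vs = []"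
  by (auto simp: rel_def)

text \<open>The invariant of the search is preserved if the true image of coordinate \<open>k\<close>, with its true scalar, is chosen.\<close>
lemma rels_split:
  assumes r: "rels k ts u v" and d: "d < length ts" "ts ! d = p k" "k < 18" and ts: "remaining k ts"
  shows "rels (Suc k) (del d ts) (split 0 1 u) (split d (s k) v)"
proof -
  obtain zs ns where u: "u = (zs, ns)" by (cases u)
  obtain zs' ns' where v: "v = (zs', ns')" by (cases v)
  have Z: "list_all2 (relZ k ts) zs zs'" and N: "list_all2 (relN k ts) ns ns'" using r u v by (auto simp: rels_def)
  note sk = nz[OF d(3)]
  have 0: "list_all2 (relZ (Suc k) (del d ts)) (zero_parts (picks_all 0 zs)) (zero_parts (picks_all d zs'))"
    using Z
  proof (induction rule: list_all2_induct)
    case (Cons g gs g' gs')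
    then obtain f where f: "rel f k ts g g'" by (auto simp: relZ_def)
    have h: "rel f (Suc k) (del d ts) (with_value Zero4 (picks 0 g)) (with_value Zero4 (picks d g'))"
      by (rule rel_with_value[OF f d]) (use sk in \<open>auto simp flip: zero_gf4_def\<close>)
    then show ?case using Cons rel_empty[OF h] by (auto simp: relZ_def intro!: list_all2_cons_nonempty)
  qed simp
  have 1: "list_all2 (relN (Suc k) (del d ts)) (value_parts 1 (picks_all 0 ns)) (value_parts (s k) (picks_all d ns'))"
    using N
  proof (induction rule: list_all2_induct)
    case (Cons g gs g' gs')
    then have f: "rel (\<lambda>_. 1) k ts g g'" by (auto simp: relN_def)
    have *: "list_all2 (relN (Suc k) (del d ts)) (cons_nonempty (with_value x (picks 0 g)) hs) (cons_nonempty (with_value y (picks d g')) hs')"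
      if "list_all2 (relN (Suc k) (del d ts)) hs hs'" "y = s k * x" for x y hs hs'
    proof -
      have h: "rel (\<lambda>_. 1) (Suc k) (del d ts) (with_value x (picks 0 g)) (with_value y (picks d g'))"
        by (rule rel_with_value[OF f d]) (use sk that in auto)
      show ?thesis using list_all2_cons_nonempty[OF _ that(1)] h rel_empty[OF h] by (simp add: relN_def)
    qed
    show ?case unfolding picks_all.simps value_parts.simps
      by (intro * Cons.IH) (simp_all flip: zero_gf4_def)
  qed simp
  have "list_all2 (relN (Suc k) (del d ts)) (scaled_parts 1 (picks_all 0 zs) (value_parts 1 (picks_all 0 ns))) (scaled_parts (s k) (picks_all d zs') (value_parts (s k) (picks_all d ns')))"
    using Z
  proof (induction rule: list_all2_induct)
    case (Cons g gs g' gs')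
    then obtain f where f: "rel f k ts g g'" by (auto simp: relZ_def)
    have h: "rel (\<lambda>_. 1) (Suc k) (del d ts) (scaled_to 1 (picks 0 g)) (scaled_to (s k) (picks d g'))"
      by (rule rel_scaled_to[OF f d]) (use remaining_less[OF ts] in auto)
    then show ?case using Cons rel_empty[OF h] by (auto simp: relN_def intro!: list_all2_cons_nonempty)
  qed (use 1 in simp)
  with 0 show ?thesis by (simp add: u v rels_def split_exec)
qed

text \<open>The path of choices allows to rebuild the image of each word.\<close>
definition path_ok :: "nat \<Rightarrow> nat list \<Rightarrow> (nat \<times> gf4) list \<Rightarrow> bool" where
  "path_ok k ts path \<longleftrightarrow> (\<forall>c. length c = 18 \<longrightarrow> rebuild (proj ts (T c)) path (rev (take k c)) = T c)"

lemma path_ok_step: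
  assumes "path_ok k ts path" "d < length ts" "ts ! d = p k" "k < 18"
  shows "path_ok (Suc k) (del d ts) ((d, s k) # path)"
proof -
  have "rebuild (proj (del d ts) (T c)) ((d, s k) # path) (rev (take (Suc k) c)) = T c" if c: "length c = 18" for c
  proof -
    have "insert_at d (s k * c ! k) (proj (del d ts) (T c)) = proj ts (T c)"
      using ins_del[of d "proj ts (T c)", unfolded del_proj] assms by (simp add: proj_def nth_T)
    then show ?thesis using assms c by (simp add: take_Suc_conv_app_nth path_ok_def)
  qed
  then show ?thesis by (simp add: path_ok_def)
qed

lemma rows_in_code_all: "rows_in_code R A path \<longleftrightarrow> (\<forall>r\<in>set R. in_code A (rebuild [] path r))"
  by (induction R) auto

text \<open>By induction, the search cannot fail as long as it has followed an actual transformation: the true image of each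
coordinate is among the candidates.\<close>
lemma ext_sound:
  assumes "rels k ts u v" "remaining k ts" "path_ok k ts path" "k \<le> 18" "n = 18 - k"
    and R: "\<forall>r\<in>set R. length r = 18 \<and> in_code A (T (rev r))"
  shows "ext n path R A u v"
  using assms(1-5)
proof (induction n arbitrary: k ts u v path)
  case 0
  then have "k = 18" "ts = []" by (auto simp: remaining_def)
  have "rebuild [] path r = T (rev r)" if "r \<in> set R" for r
    using 0(3) R that \<open>k = 18\<close> \<open>ts = []\<close> by (auto simp: path_ok_def proj_def dest: spec[of _ "rev r"])
  with R show ?case by (simp add: rows_in_code_all)
next
  case (Suc n)
  then have k: "k < 18" by simp
  obtain d where d: "d < length ts" "ts ! d = p k" "remaining (Suc k) (del d ts)" "length ts = 18 - k"
    using remaining_nth[OF Suc.prems(2) k] by metis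
  have "ext n ((d, s k) # path) R A (split 0 1 u) (split d (s k) v)"
    using Suc.prems k d by (intro Suc.IH[of "Suc k" "del d ts"] rels_split path_ok_step) auto
  moreover have "(d, s k) \<in> set (candidates (Suc n) (count_table u) (support_profile u) v)"
    using Suc.prems k d by (intro candidates_contains) auto
  ultimately show ?case unfolding ext.simps one_gf4_def[symmetric] by (intro bexI[of _ "(d, s k)"]) simp_all
qed

end

section \<open>The code of a matrix and its light words\<close>

lemma length_addl [simp]: "length (add_words xs ys) = min (length xs) (length ys)"
  by (induction xs ys rule: add_words.induct) auto
lemma nth_addl: "i < length xs \<Longrightarrow> i < length ys \<Longrightarrow> add_words xs ys ! i = xs ! i + ys ! i"
  by (induction xs ys arbitrary: i rule: add_words.induct) (auto simp: nth_Cons')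
declare nth_scl [simp]
lemma scl_append: "scl c (v @ w) = scl c v @ scl c w" by (simp add: scl_def)
lemma app_eq [simp]: "app xs ys = xs @ ys" by (induction xs) auto
lemma rapp_eq [simp]: "rapp xs ys = rev xs @ ys" by (induction xs arbitrary: ys) auto
lemma split_rev_eq: "split_rev n ys xs = (rev (take n xs) @ ys, drop n xs)"
  by (induction n ys xs rule: split_rev.induct) auto
lemma zero_word_eq: "zero_word n = replicate n 0" by (induction n) (auto simp: zero_gf4_def)

lemma add_product_nth:
  assumes "length cs = length rs" "\<forall>r\<in>set rs. length r = m" "length y = m"
  shows "length (add_product y cs rs) = m \<and>
    (\<forall>j<m. add_product y cs rs ! j = y ! j + (\<Sum>i<length rs. cs ! i * rs ! i ! j))"
  using assms
proof (induction y cs rs rule: add_product.induct)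
  case (1 y c cs r rs)
  then have "length (add_words y (scl c r)) = m" by simp
  with 1 show ?case
    by (auto simp: nth_addl sum.lessThan_Suc_shift simp del: sum.lessThan_Suc simp flip: add.assoc)
qed auto

lemma wt_append [simp]: "wt (v @ w) = wt v + wt w" by (simp add: wt_def)
lemma wt_Cons: "wt (x # w) = (if x = 0 then 0 else 1) + wt w" by (simp add: wt_def)
lemma wt_Nil [simp]: "wt [] = 0" by (simp add: wt_def)
lemma wt_eq_0: "wt w = 0 \<longleftrightarrow> (\<forall>x\<in>set w. x = 0)" by (auto simp: wt_def filter_empty_conv)
lemma wt_eq_0_replicate: "wt w = 0 \<longleftrightarrow> w = replicate (length w) 0"
  by (metis wt_eq_0 replicate_eqI in_set_replicate)
lemma wt_scl: "c \<noteq> 0 \<Longrightarrow> wt (scl c w) = wt w"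
  by (simp add: wt_def scl_def filter_map o_def)

lemma addl_zero: "length r = length y \<Longrightarrow> add_words y (scl 0 r) = y"
  by (rule nth_equalityI) (auto simp: nth_addl)
lemma add_product_zero:
  "\<forall>r\<in>set R. length r = length y \<Longrightarrow> add_product y (replicate (length R) 0) R = y"
  by (induction R) (auto simp: addl_zero)

lemma finish_eq: "finish b xa y (multiples R) = (if b then [rev xa @ replicate (length R) 0 @ y] else [])"
  by (cases b) (induction R arbitrary: xa; auto simp flip: zero_gf4_def replicate_append_same)+

text \<open>A nonzero choice for the next entry of \<open>x\<close> uses up one unit of both bounds, a zero uses none.\<close>
lemma light_words_spec:
  assumes "k \<le> b" "\<forall>r\<in>set R. length r = length y"
  shows "set (light_words k b xa y (multiples R)) = {rev xa @ x @ add_product y x R |x. length x = length R \<and> wt x \<le> k \<and> wt x + wt (add_product y x R) \<le> b}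
    \<and> distinct (light_words k b xa y (multiples R))"
  using assms
proof (induction k b xa y "multiples R" arbitrary: R rule: light_words.induct)
  case (1 b xa y)
  have "x = replicate (length R) 0" if "length x = length R" "wt x = 0" for x
    using that wt_eq_0_replicate[of x] by simp
  moreover have "wt (replicate (length R) 0) = 0" by (simp add: wt_eq_0)
  ultimately have "{rev xa @ x @ add_product y x R |x. length x = length R \<and> wt x \<le> 0 \<and> wt x + wt (add_product y x R) \<le> b}
      = (if wt y \<le> b then {rev xa @ replicate (length R) 0 @ y} else {})"
    using add_product_zero[OF 1(2)] by (fastforce split: if_splits)
  then show ?case by (simp add: finish_eq weight_le_def)
next
  case (3 k b xa y)
  then have "R = []" by (cases R) auto
  then show ?case by (cases "wt y \<le> Suc b") (auto simp: weight_le_def)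
next
  case (4 k b xa y r1 r2 r3 rs)
  then obtain r R' where R: "R = r # R'" "r1 = r" "r2 = scl Omega r" "r3 = scl Omega_bar r" "rs = multiples R'"
    by (cases R) auto
  have len: "\<forall>q\<in>set R'. length q = length y" "length r = length y" using 4 R by auto
  let ?S = "\<lambda>k b xa y. {rev xa @ x @ add_product y x R' |x. length x = length R' \<and> wt x \<le> k \<and> wt x + wt (add_product y x R') \<le> b}"
  have IH: "set (light_words (Suc k) (Suc b) (Zero4 # xa) y rs) = ?S (Suc k) (Suc b) (Zero4 # xa) y"
    "distinct (light_words (Suc k) (Suc b) (Zero4 # xa) y rs)"
    "set (light_words k b (One4 # xa) (add_words y r1) rs) = ?S k b (One4 # xa) (add_words y r1)"
    "distinct (light_words k b (One4 # xa) (add_words y r1) rs)"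
    "set (light_words k b (Omega # xa) (add_words y r2) rs) = ?S k b (Omega # xa) (add_words y r2)"
    "distinct (light_words k b (Omega # xa) (add_words y r2) rs)"
    "set (light_words k b (Omega_bar # xa) (add_words y r3) rs) = ?S k b (Omega_bar # xa) (add_words y r3)"
    "distinct (light_words k b (Omega_bar # xa) (add_words y r3) rs)"
    using 4(1)[of R'] 4(2)[of R'] 4(3)[of R'] 4(4)[of R'] R(2-) 4(6) len by simp_all
  have split: "(\<exists>x. P x \<and> length x = Suc n) \<longleftrightarrow> (\<exists>c x. P (c # x) \<and> length x = n)" for P :: "word \<Rightarrow> bool" and n
    by (metis length_Suc_conv)
  have c4: "(\<exists>c. Q c) \<longleftrightarrow> Q Zero4 \<or> Q One4 \<or> Q Omega \<or> Q Omega_bar" for Q :: "gf4 \<Rightarrow> bool"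
    by (metis gf4.exhaust)
  have v: "add_words y (scl Zero4 r) = y" "scl One4 r = r"
    using addl_zero[OF len(2)] by (simp_all flip: zero_gf4_def one_gf4_def)
  have "{rev xa @ x @ add_product y x R |x. length x = length R \<and> wt x \<le> Suc k \<and> wt x + wt (add_product y x R) \<le> Suc b}
     = {w. \<exists>x. (w = rev xa @ x @ add_product y x R \<and> wt x \<le> Suc k \<and> wt x + wt (add_product y x R) \<le> Suc b) \<and> length x = Suc (length R')}"
    by (auto simp: R)
  also have "\<dots> = ?S (Suc k) (Suc b) (Zero4 # xa) y \<union> ?S k b (One4 # xa) (add_words y r1)
     \<union> ?S k b (Omega # xa) (add_words y r2) \<union> ?S k b (Omega_bar # xa) (add_words y r3)"
    unfolding split c4 R(1) add_product.simps v R(2-4) wt_exec by (auto)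
  finally have S: "{rev xa @ x @ add_product y x R |x. length x = length R \<and> wt x \<le> Suc k \<and> wt x + wt (add_product y x R) \<le> Suc b} = \<dots>" .
  have "distinct (light_words (Suc k) (Suc b) xa y ((r1, r2, r3) # rs))"
    unfolding light_words.simps app_eq distinct_append set_append IH using IH(2,4,6,8) by auto
  moreover have "set (light_words (Suc k) (Suc b) xa y ((r1, r2, r3) # rs))
     = ?S (Suc k) (Suc b) (Zero4 # xa) y \<union> ?S k b (One4 # xa) (add_words y r1)
     \<union> ?S k b (Omega # xa) (add_words y r2) \<union> ?S k b (Omega_bar # xa) (add_words y r3)"
    unfolding light_words.simps app_eq set_append IH by blast
  moreover have "multiples R = (r1, r2, r3) # rs" using R by simp
  ultimately show ?case unfolding S by simp
qed auto

lemma addl_zero_left: "add_words (replicate (length r) 0) r = r"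
  by (rule nth_equalityI) (auto simp: nth_addl)

lemma light_words_lead_spec:
  assumes "k \<le> b" "\<forall>r\<in>set R. length r = m"
  shows "set (light_words_lead k b xa (multiples R)) = {rev xa @ x @ add_product (replicate m 0) x R |x. length x = length R \<and> lead x = 1
      \<and> wt x \<le> Suc k \<and> wt x + wt (add_product (replicate m 0) x R) \<le> Suc b}
    \<and> distinct (light_words_lead k b xa (multiples R))"
  using assms(2)
proof (induction R arbitrary: xa)
  case (Cons r R)
  let ?z = "replicate m 0 :: word"
  have len: "\<forall>q\<in>set R. length q = length r" "length r = m" using Cons by auto
  note IH = Cons.IH[of "Zero4 # xa"] and G = light_words_spec[OF assms(1) len(1), of "One4 # xa"]
  have v: "add_words ?z (scl 0 r) = ?z" "add_words ?z (scl 1 r) = r"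
    using addl_zero[of r ?z] addl_zero_left[of r] len(2) by simp_all
  let ?A = "{rev (Zero4 # xa) @ x @ add_product ?z x R |x. length x = length R \<and> lead x = 1
      \<and> wt x \<le> Suc k \<and> wt x + wt (add_product ?z x R) \<le> Suc b}"
  let ?B = "{rev (One4 # xa) @ x @ add_product r x R |x. length x = length R \<and> wt x \<le> k \<and> wt x + wt (add_product r x R) \<le> b}"
  have sA: "set (light_words_lead k b (Zero4 # xa) (multiples R)) = ?A" "distinct (light_words_lead k b (Zero4 # xa) (multiples R))" using IH Cons.prems by auto
  have sB: "set (light_words k b (One4 # xa) r (multiples R)) = ?B" "distinct (light_words k b (One4 # xa) r (multiples R))" using G by auto
  have "{rev xa @ x @ add_product ?z x (r # R) |x. length x = length (r # R) \<and> lead x = 1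
      \<and> wt x \<le> Suc k \<and> wt x + wt (add_product ?z x (r # R)) \<le> Suc b} = ?A \<union> ?B" (is "?L = _")
  proof (intro set_eqI iffI)
    fix w assume "w \<in> ?L"
    then obtain c x where x: "w = rev xa @ (c # x) @ add_product ?z (c # x) (r # R)" "length x = length R" "lead (c # x) = 1"
      "wt (c # x) \<le> Suc k" "wt (c # x) + wt (add_product ?z (c # x) (r # R)) \<le> Suc b"
      by (auto simp: length_Suc_conv)
    show "w \<in> ?A \<union> ?B"
    proof (cases "c = 0")
      case True
      then have "w \<in> ?A" using x v by (auto simp: wt_Cons zero_gf4_def[symmetric])
      then show ?thesis ..
    next
      case False
      then have "c = 1" using x(3) by simp
      then have "w \<in> ?B" using x v by (auto simp: wt_Cons one_gf4_def[symmetric])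
      then show ?thesis ..
    qed
  next
    fix w assume "w \<in> ?A \<union> ?B"
    then show "w \<in> ?L"
    proof
      assume "w \<in> ?A"
      then obtain x where "w = rev (Zero4 # xa) @ x @ add_product ?z x R" "length x = length R" "lead x = 1"
        "wt x \<le> Suc k" "wt x + wt (add_product ?z x R) \<le> Suc b" by blast
      then show ?thesis using v by (intro CollectI exI[of _ "0 # x"]) (auto simp: wt_Cons zero_gf4_def[symmetric])
    next
      assume "w \<in> ?B"
      then obtain x where "w = rev (One4 # xa) @ x @ add_product r x R" "length x = length R" "wt x \<le> k" "wt x + wt (add_product r x R) \<le> b" by blast
      then show ?thesis using v by (intro CollectI exI[of _ "1 # x"]) (auto simp: wt_Cons one_gf4_def[symmetric])
    qed
  qed
  moreover have "?A \<inter> ?B = {}" by auto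
  ultimately show ?case using sA sB by simp
qed simp

definition zero9 :: word where "zero9 = replicate 9 0"
definition enc :: "word list \<Rightarrow> word \<Rightarrow> word" where "enc A x = add_product zero9 x A"
text \<open>The code with generator matrix \<open>(I | A)\<close>.\<close>
definition code :: "word list \<Rightarrow> word set" where "code A = {x @ enc A x |x. length x = 9}"
definition is_mat :: "word list \<Rightarrow> bool" where "is_mat A \<longleftrightarrow> length A = 9 \<and> (\<forall>r\<in>set A. length r = 9)"

lemma enc:
  assumes "is_mat A" "length x = 9"
  shows "length (enc A x) = 9" "j < 9 \<Longrightarrow> enc A x ! j = (\<Sum>i<9. x ! i * A ! i ! j)"
  using add_product_nth[of x A 9 zero9] assms by (auto simp: enc_def is_mat_def zero9_def)

lemma enc_scl: "is_mat A \<Longrightarrow> length x = 9 \<Longrightarrow> enc A (scl c x) = scl c (enc A x)"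
  by (rule nth_equalityI) (auto simp: enc sum_distrib_left mult.assoc)

lemma in_code_iff:
  assumes "is_mat A" "length w = 18"
  shows "in_code A w \<longleftrightarrow> w \<in> code A"
proof -
  have "in_code A w \<longleftrightarrow> enc A (take 9 w) = drop 9 w"
    using assms by (simp add: in_code_def in_code2_def split_rev_eq enc_def zero_word_eq zero9_def)
  also have "\<dots> \<longleftrightarrow> w \<in> code A"
    using assms by (auto simp: code_def intro!: exI[of _ "take 9 w"])
  finally show ?thesis .
qed

lemma lead_scl: "lead (scl c w) = c * lead w"
  by (induction w) (auto simp: scl_def)
lemma lead_append: "lead (v @ w) = (if lead v = 0 then lead w else lead v)"
  by (induction v) auto
lemma lead_eq_0: "lead w = 0 \<longleftrightarrow> wt w = 0"
  by (induction w) (auto simp: wt_Cons)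

definition inv_mats :: "word list \<Rightarrow> word list \<Rightarrow> bool" where
  "inv_mats A B \<longleftrightarrow> is_mat A \<and> is_mat B \<and> (\<forall>x. length x = 9 \<longrightarrow> enc B (enc A x) = x \<and> enc A (enc B x) = x)"

lemma swap_halves_eq: "swap_halves h ws = map (\<lambda>w. scl (inverse (lead (drop 9 w))) (drop 9 w @ take 9 w)) (filter (\<lambda>w. wt (drop 9 w) > h) ws)"
proof (induction ws)
  case (Cons w ws)
  then show ?case by (cases "weight_le h (drop 9 w)") (auto simp: split_rev_eq weight_le_def)
qed simp

lemma enc_zero: assumes "is_mat A" shows "enc A zero9 = zero9"
  using add_product_zero[of A zero9] assms by (auto simp: enc_def zero9_def is_mat_def)

text \<open>The two enumerations are disjoint, since the second one is filtered by the weight of the left half. Its words have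
leading entry 1 in the right half and are rescaled when the halves are swapped, which is injective on lines.\<close>
lemma words_spec:
  assumes AB: "inv_mats A B" and h: "h \<ge> 1"
  shows "set (words h A B) = {w \<in> code A. lead w = 1 \<and> wt w \<le> 2 * h + 2}" and "distinct (words h A B)"
proof -
  have A: "is_mat A" and B: "is_mat B" and inv: "\<And>x. length x = 9 \<Longrightarrow> enc B (enc A x) = x" "\<And>x. length x = 9 \<Longrightarrow> enc A (enc B x) = x"
    using AB by (auto simp: inv_mats_def)
  let ?l = "light_words_lead h (h + h + 1) [] (multiples A)" and ?r = "light_words_lead (h - 1) (h + h + 1) [] (multiples B)"
  let ?L = "{x @ enc A x |x. length x = 9 \<and> lead x = 1 \<and> wt x \<le> h + 1 \<and> wt x + wt (enc A x) \<le> 2 * h + 2}"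
  let ?R = "{y @ enc B y |y. length y = 9 \<and> lead y = 1 \<and> wt y \<le> h \<and> wt y + wt (enc B y) \<le> 2 * h + 2}"
  let ?f = "\<lambda>w. scl (inverse (lead (drop 9 w))) (drop 9 w @ take 9 w)"
  have l: "set ?l = ?L" "distinct ?l"
    using light_words_lead_spec[of h "h + h + 1" A 9 "[]"] A by (auto simp: is_mat_def enc_def zero9_def)
  have r: "set ?r = ?R" "distinct ?r"
    using light_words_lead_spec[of "h - 1" "h + h + 1" B 9 "[]"] B h by (auto simp: is_mat_def enc_def zero9_def)
  have right: "?f (y @ enc B y) = scl (inverse (lead (enc B y))) (enc B y @ y)" if "length y = 9" for y
    using that B enc by simp
  have w: "words h A B = ?l @ map ?f (filter (\<lambda>w. wt (drop 9 w) > Suc h) ?r)"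
    by (simp add: swap_halves_eq)
  have F: "set (filter (\<lambda>w. wt (drop 9 w) > Suc h) ?r) = {y @ enc B y |y. length y = 9 \<and> lead y = 1 \<and> wt y \<le> h
     \<and> wt y + wt (enc B y) \<le> 2 * h + 2 \<and> wt (enc B y) > Suc h}" (is "_ = ?R'")
    unfolding set_filter r by auto
  have img: "?f ` ?R' = {w \<in> code A. lead w = 1 \<and> wt w \<le> 2 * h + 2 \<and> wt (take 9 w) > Suc h}"
  proof (intro set_eqI iffI)
    fix w assume "w \<in> ?f ` ?R'"
    then obtain y where y: "w = ?f (y @ enc B y)" "length y = 9" "lead y = 1" "wt y \<le> h"
      "wt y + wt (enc B y) \<le> 2 * h + 2" "wt (enc B y) > Suc h" by blast
    let ?c = "inverse (lead (enc B y))"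
    have c: "?c \<noteq> 0" "lead (enc B y) \<noteq> 0" using y(6) lead_eq_0[of "enc B y"] by auto
    have w: "w = scl ?c (enc B y) @ scl ?c y" using y(1,2) right by (simp add: scl_append)
    moreover have "scl ?c y = enc A (scl ?c (enc B y))" using enc_scl[OF A] enc[OF B y(2)] inv(2)[OF y(2)] by simp
    ultimately have "w \<in> code A" using enc[OF B y(2)] by (auto simp: code_def)
    moreover have "lead w = 1" using c w by (simp add: lead_append lead_scl)
    ultimately show "w \<in> {w \<in> code A. lead w = 1 \<and> wt w \<le> 2 * h + 2 \<and> wt (take 9 w) > Suc h}"
      using w y enc[OF B y(2)] c by (simp add: wt_scl)
  next
    fix w assume "w \<in> {w \<in> code A. lead w = 1 \<and> wt w \<le> 2 * h + 2 \<and> wt (take 9 w) > Suc h}"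
    then obtain x where x: "w = x @ enc A x" "length x = 9" "lead w = 1" "wt w \<le> 2 * h + 2" "wt x > Suc h"
      by (auto simp: code_def)
    have lx: "lead x = 1" using x lead_eq_0[of x] by (simp add: lead_append split: if_splits)
    let ?y = "enc A x"
    have ly: "lead ?y \<noteq> 0"
    proof
      assume "lead ?y = 0"
      then have "?y = zero9" using lead_eq_0 wt_eq_0_replicate[of ?y] enc(1)[OF A x(2)] by (simp add: zero9_def)
      then have "x = zero9" using inv(1)[OF x(2)] enc_zero[OF B] by simp
      then show False using x(5) by (simp add: zero9_def wt_def)
    qed
    let ?y' = "scl (inverse (lead ?y)) ?y"
    have e: "enc B ?y' = scl (inverse (lead ?y)) x" using enc_scl[OF B] enc[OF A x(2)] inv(1)[OF x(2)] by simp
    have "?f (?y' @ enc B ?y') = w"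
      using x ly lx enc[OF A x(2)] e by (simp add: right lead_scl scl_append scl_scl)
    moreover have "?y' @ enc B ?y' \<in> ?R'"
      using x ly enc[OF A x(2)] e by (intro CollectI exI[of _ ?y']) (auto simp: lead_scl wt_scl)
    ultimately show "w \<in> ?f ` ?R'" by (metis (no_types, lifting) image_eqI)
  qed
  have left: "?L = {w \<in> code A. lead w = 1 \<and> wt w \<le> 2 * h + 2 \<and> wt (take 9 w) \<le> Suc h}"
  proof (intro set_eqI iffI)
    fix w assume "w \<in> {w \<in> code A. lead w = 1 \<and> wt w \<le> 2 * h + 2 \<and> wt (take 9 w) \<le> Suc h}"
    then obtain x where x: "w = x @ enc A x" "length x = 9" "lead w = 1" "wt w \<le> 2 * h + 2" "wt x \<le> Suc h"
      by (auto simp: code_def)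
    have "lead x = 1"
    proof (cases "lead x = 0")
      case True
      then have "x = zero9" using lead_eq_0 wt_eq_0_replicate x(2) by (metis zero9_def)
      then show ?thesis using x(1,3) enc_zero[OF A] lead_eq_0[of "zero9 @ zero9"] by (simp add: zero9_def wt_def)
    qed (use x in \<open>simp add: lead_append\<close>)
    then show "w \<in> ?L" using x by auto
  qed (use lead_append in \<open>auto simp: code_def\<close>)
  show "set (words h A B) = {w \<in> code A. lead w = 1 \<and> wt w \<le> 2 * h + 2}"
    unfolding w set_append set_map F img l left by auto
  have "inj_on ?f ?R'"
  proof (rule inj_onI)
    fix v v' assume "v \<in> ?R'" "v' \<in> ?R'" and eq: "?f v = ?f v'"
    then obtain y y' where y: "v = y @ enc B y" "length y = 9" "lead y = 1" "v' = y' @ enc B y'" "length y' = 9" "lead y' = 1"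
      "wt (enc B y) > Suc h" by blast
    let ?c = "inverse (lead (enc B y))" and ?d = "inverse (lead (enc B y'))"
    have "drop 9 (?f v) = scl ?c y" "drop 9 (?f v') = scl ?d y'"
      using y enc[OF B] by (simp_all add: right scl_append)
    then have *: "scl ?c y = scl ?d y'" using eq by simp
    have "lead (scl ?c y) = lead (scl ?d y')" unfolding * ..
    then have "?c = ?d" using y(3,6) unfolding lead_scl by simp
    moreover have "?c \<noteq> 0" using y(7) lead_eq_0[of "enc B y"] by auto
    ultimately have "y = y'" using arg_cong[OF *, of "scl (inverse ?c)"] by (simp add: scl_scl)
    then show "v = v'" using y by simp
  qed
  then show "distinct (words h A B)"
    unfolding w distinct_append distinct_map set_map F img l left using l(2) r(2) by auto
qed

section \<open>The monomial group and its stabilisers\<close>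

text \<open>A monomial transformation is a permutation of the coordinates with a nonzero scalar for each source coordinate.
Both components are made canonical outside the coordinates, so that the group has the correct cardinality.\<close>
definition G :: "((nat \<Rightarrow> nat) \<times> (nat \<Rightarrow> gf4)) set" where
  "G = {p. p permutes {..<18}} \<times> PiE {..<18} (\<lambda>_. - {0})"
definition act where "act g = mono (fst g) (snd g)"
definition comp where "comp g h = (fst g \<circ> fst h, restrict (\<lambda>i. snd g (fst h i) * snd h i) {..<18::nat})"
definition ginv where "ginv g = (inv (fst g), restrict (\<lambda>i. inverse (snd g (inv (fst g) i))) {..<18::nat})"

lemma card_nonzero: "card (- {0 :: gf4}) = 3"
proof -
  have "- {0 :: gf4} = {One4, Omega, Omega_bar}" using gf4.exhaust by (auto simp: zero_gf4_def)
  then show ?thesis by simp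
qed

lemma card_G: "card G = fact 18 * 3 ^ 18"
proof -
  have "card {p. p permutes {..<18::nat}} = fact 18" by (rule card_permutations) simp_all
  moreover have "card (PiE {..<18::nat} (\<lambda>_. - {0 :: gf4})) = 3 ^ 18"
    by (simp only: card_PiE[OF finite_lessThan] card_nonzero prod_constant card_lessThan)
  ultimately show ?thesis unfolding G_def card_cartesian_product by simp
qed

lemma finite_G: "finite G"
  unfolding G_def by (intro finite_cartesian_product finite_PiE finite_permutations) simp_all

lemma G_iff: "g \<in> G \<longleftrightarrow> fst g permutes {..<18} \<and> (\<forall>i<18. snd g i \<noteq> 0) \<and> snd g \<in> extensional {..<18}"
  unfolding G_def mem_Times_iff PiE_iff by (simp add: Ball_def)

lemma G_monomial: "g \<in> G \<Longrightarrow> monomial (fst g) (snd g)"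
  unfolding G_iff monomial_def by blast

lemma act_nth: "g \<in> G \<Longrightarrow> i < 18 \<Longrightarrow> act g w ! fst g i = snd g i * w ! i"
  unfolding act_def by (rule monomial.nth_T[OF G_monomial])
lemma length_act [simp]: "length (act g w) = 18" by (simp add: act_def mono_def)

lemma act_eqI:
  assumes "g \<in> G" "length v = 18" "\<And>i. i < 18 \<Longrightarrow> v ! fst g i = snd g i * w ! i"
  shows "act g w = v"
proof (rule nth_equalityI)
  fix j assume "j < length (act g w)"
  then have j: "j < 18" by simp
  have p: "fst g permutes {..<18}" using assms(1) by (simp add: G_iff)
  obtain i where i: "j = fst g i" "i < 18"
    using permutes_inverses(1)[OF p] permutes_in_image[OF permutes_inv[OF p], of j] j by (metis lessThan_iff)
  then show "act g w ! j = v ! j" using assms act_nth by simp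
qed (simp add: assms)

lemma comp_G: "g \<in> G \<Longrightarrow> h \<in> G \<Longrightarrow> comp g h \<in> G"
  using permutes_in_image[of "fst h" "{..<18}"] by (auto simp: G_iff comp_def permutes_compose)

lemma act_comp:
  assumes "g \<in> G" "h \<in> G" shows "act (comp g h) w = act g (act h w)"
proof (rule act_eqI[OF comp_G[OF assms]])
  fix i :: nat assume "i < 18"
  moreover from this have "fst h i < 18" using assms permutes_in_image[of "fst h" "{..<18}"] by (simp add: G_iff)
  ultimately show "act g (act h w) ! fst (comp g h) i = snd (comp g h) i * w ! i"
    using assms by (simp add: comp_def act_nth mult.assoc)
qed simp

lemma ginv_G: "g \<in> G \<Longrightarrow> ginv g \<in> G"
  using permutes_in_image[OF permutes_inv, of "fst g" "{..<18}"] by (auto simp: G_iff ginv_def permutes_inv)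

lemma act_ginv:
  assumes g: "g \<in> G" and w: "length w = 18" shows "act (ginv g) (act g w) = w"
proof (rule act_eqI[OF ginv_G[OF g] w])
  fix j :: nat assume j: "j < 18"
  have p: "fst g permutes {..<18}" using g by (simp add: G_iff)
  have i: "inv (fst g) j < 18" "fst g (inv (fst g) j) = j"
    using permutes_inverses(1)[OF p] permutes_in_image[OF permutes_inv[OF p], of j] j by auto
  have "act g w ! j = snd g (inv (fst g) j) * w ! inv (fst g) j"
    using act_nth[OF g i(1), of w] i(2) by simp
  then show "w ! fst (ginv g) j = snd (ginv g) j * act g w ! j"
    using j g i(1) by (simp add: ginv_def G_iff flip: mult.assoc)
qed

lemma comp_inj:
  assumes k: "k \<in> G" and g: "g \<in> G" and h: "h \<in> G" and eq: "comp k g = comp k h"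
  shows "g = h"
proof -
  have "inj (fst k)" using k permutes_inj unfolding G_iff by blast
  then have p: "fst g = fst h" using eq by (auto simp: comp_def fun_eq_iff dest: injD)
  have "snd g = snd h"
  proof (rule extensionalityI[of _ "{..<18}"])
    fix i :: nat assume i: "i \<in> {..<18}"
    then have "snd k (fst g i) * snd g i = snd k (fst g i) * snd h i"
      using arg_cong[OF eq, of "\<lambda>x. snd x i"] p by (simp add: comp_def)
    moreover have "snd k (fst g i) \<noteq> 0"
      using k g i permutes_in_image[of "fst g" "{..<18}"] by (auto simp: G_iff)
    ultimately show "snd g i = snd h i" by simp
  qed (use g h in \<open>auto simp: G_iff\<close>)
  with p show ?thesis by (simp add: prod_eq_iff)
qed

text \<open>Automorphisms of \<open>C\<close> that fix the first \<open>j\<close> coordinates with scalar 1.\<close>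
definition Stab :: "word set \<Rightarrow> nat \<Rightarrow> ((nat \<Rightarrow> nat) \<times> (nat \<Rightarrow> gf4)) set" where
  "Stab C j = {g \<in> G. act g ` C = C \<and> (\<forall>i<j. fst g i = i \<and> snd g i = 1)}"

lemma finite_Stab [simp]: "finite (Stab C j)"
  using finite_G by (simp add: Stab_def)

text \<open>Two elements with the same value at \<open>j\<close> differ by an element of the next stabiliser.\<close>
lemma card_Stab_fibre:
  assumes C: "\<forall>w\<in>C. length w = 18" and j: "j < 18"
  shows "card {g \<in> Stab C j. (fst g j, snd g j) = x} \<le> card (Stab C (Suc j))" (is "card ?F \<le> _")
proof (cases "?F = {}")
  case False
  then obtain g0 where g0: "g0 \<in> ?F" by blast
  have g0G: "g0 \<in> G" and g0C: "act g0 ` C = C" using g0 by (auto simp: Stab_def)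
  have p0: "fst g0 permutes {..<18}" using g0G by (simp add: G_iff)
  have "comp (ginv g0) g \<in> Stab C (Suc j)" if g: "g \<in> ?F" for g
  proof -
    have gG: "g \<in> G" and gC: "act g ` C = C" using g by (auto simp: Stab_def)
    have eq: "fst g i = fst g0 i \<and> snd g i = snd g0 i" if "i < Suc j" for i
      using that g g0 by (cases "i = j") (auto simp: Stab_def)
    have "act (comp (ginv g0) g) ` C = act (ginv g0) ` act g ` C"
      using act_comp[OF ginv_G[OF g0G] gG] by (simp add: image_image)
    also have "\<dots> = act (ginv g0) ` act g0 ` C" using gC g0C by simp
    also have "\<dots> = C" using act_ginv[OF g0G] C by (simp add: image_image)
    finally have 1: "act (comp (ginv g0) g) ` C = C" .
    have "fst (comp (ginv g0) g) i = i \<and> snd (comp (ginv g0) g) i = 1" if i: "i < Suc j" for i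
    proof -
      have "fst g0 i < 18" "i < 18" using i j permutes_in_image[OF p0, of i] by auto
      then show ?thesis using eq[OF i] g0G permutes_inverses(2)[OF p0]
        by (simp add: comp_def ginv_def G_iff)
    qed
    with 1 show ?thesis using comp_G[OF ginv_G[OF g0G] gG] by (simp add: Stab_def)
  qed
  moreover have "inj_on (comp (ginv g0)) ?F"
    using comp_inj[OF ginv_G[OF g0G]] by (auto simp: inj_on_def Stab_def)
  ultimately show ?thesis by (intro card_inj_on_le[of "comp (ginv g0)"]) auto
next
  case True
  show ?thesis unfolding True by simp
qed

lemma card_Stab_step:
  assumes C: "\<forall>w\<in>C. length w = 18" and j: "j < 18" and K: "finite K" "\<And>g. g \<in> Stab C j \<Longrightarrow> (fst g j, snd g j) \<in> K"
  shows "card (Stab C j) \<le> card K * card (Stab C (Suc j))"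
proof -
  have "Stab C j = (\<Union>x\<in>K. {g \<in> Stab C j. (fst g j, snd g j) = x})" using K(2) by auto
  then have "card (Stab C j) \<le> (\<Sum>x\<in>K. card {g \<in> Stab C j. (fst g j, snd g j) = x})"
    using card_UN_le[OF K(1), of "\<lambda>x. {g \<in> Stab C j. (fst g j, snd g j) = x}"] by simp
  also have "\<dots> \<le> (\<Sum>x\<in>K. card (Stab C (Suc j)))" by (intro sum_mono card_Stab_fibre[OF C j])
  finally show ?thesis by simp
qed

text \<open>The orbit and stabiliser theorem in the form of an inequality: each fibre of \<open>g \<mapsto> g C\<close> embeds into the stabiliser.\<close>
lemma card_orbit:
  assumes C: "\<forall>w\<in>C. length w = 18" and b: "card (Stab C 0) \<le> b"
  shows "fact 18 * 3 ^ 18 \<le> card ((\<lambda>g. act g ` C) ` G) * b"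
proof -
  let ?O = "(\<lambda>g. act g ` C) ` G"
  have "card {g \<in> G. act g ` C = D} \<le> card (Stab C 0)" for D
  proof (cases "{g \<in> G. act g ` C = D} = {}")
    case False
    then obtain g0 where g0: "g0 \<in> G" "act g0 ` C = D" by blast
    have "comp (ginv g0) g \<in> Stab C 0" if g: "g \<in> G" "act g ` C = D" for g
    proof -
      have "act (comp (ginv g0) g) ` C = act (ginv g0) ` act g ` C"
        using act_comp[OF ginv_G[OF g0(1)] g(1)] by (simp add: image_image)
      also have "\<dots> = act (ginv g0) ` act g0 ` C" using g g0 by simp
      also have "\<dots> = C" using act_ginv[OF g0(1)] C by (simp add: image_image)
      finally show ?thesis using comp_G[OF ginv_G[OF g0(1)] g(1)] by (simp add: Stab_def)
    qed
    moreover have "inj_on (comp (ginv g0)) {g \<in> G. act g ` C = D}"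
      using comp_inj[OF ginv_G[OF g0(1)]] by (auto simp: inj_on_def)
    ultimately show ?thesis by (intro card_inj_on_le[of "comp (ginv g0)"]) auto
  next
    case True
    show ?thesis unfolding True by simp
  qed
  then have fib: "card {g \<in> G. act g ` C = D} \<le> b" for D using b le_trans by blast
  have "G = (\<Union>D\<in>?O. {g \<in> G. act g ` C = D})" by auto
  then have "card G \<le> (\<Sum>D\<in>?O. card {g \<in> G. act g ` C = D})"
    using card_UN_le[of ?O "\<lambda>D. {g \<in> G. act g ` C = D}"] finite_G by simp
  also have "\<dots> \<le> (\<Sum>D\<in>?O. b)" by (intro sum_mono fib)
  finally show ?thesis by (simp add: card_G)
qed

lemma code_length: "is_mat A \<Longrightarrow> w \<in> code A \<Longrightarrow> length w = 18"
  by (auto simp: code_def enc)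

lemma scl_code: "is_mat A \<Longrightarrow> w \<in> code A \<Longrightarrow> scl c w \<in> code A"
proof -
  assume A: "is_mat A" and "w \<in> code A"
  then obtain x where "w = x @ enc A x" "length x = 9" by (auto simp: code_def)
  then have "scl c w = scl c x @ enc A (scl c x)" "length (scl c x) = 9" by (simp_all add: scl_append enc_scl[OF A])
  then show "scl c w \<in> code A" unfolding code_def by blast
qed

lemma inj_on_act: "g \<in> G \<Longrightarrow> inj_on (act g) {w. length w = 18}"
  by (rule inj_on_inverseI[of _ "act (ginv g)"]) (simp add: act_ginv)

lemma wt_alt: "wt w = card {i. i < length w \<and> w ! i \<noteq> 0}"
  by (simp add: wt_def length_filter_conv_card)

lemma wt_act: assumes g: "g \<in> G" and w: "length w = 18" shows "wt (act g w) = wt w"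
proof -
  have p: "fst g permutes {..<18}" using g by (simp add: G_iff)
  have "bij_betw (fst g) {i. i < 18 \<and> w ! i \<noteq> 0} {j. j < 18 \<and> act g w ! j \<noteq> 0}"
  proof (rule bij_betw_byWitness[of _ "inv (fst g)"])
    show "\<forall>a\<in>{i. i < 18 \<and> w ! i \<noteq> 0}. inv (fst g) (fst g a) = a" by (simp add: permutes_inverses(2)[OF p])
    show "\<forall>a\<in>{j. j < 18 \<and> act g w ! j \<noteq> 0}. fst g (inv (fst g) a) = a" by (simp add: permutes_inverses(1)[OF p])
    show "fst g ` {i. i < 18 \<and> w ! i \<noteq> 0} \<subseteq> {j. j < 18 \<and> act g w ! j \<noteq> 0}"
      using permutes_in_image[OF p] g by (auto simp: act_nth G_iff)
    show "inv (fst g) ` {j. j < 18 \<and> act g w ! j \<noteq> 0} \<subseteq> {i. i < 18 \<and> w ! i \<noteq> 0}"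
    proof safe
      fix j :: nat assume j: "j < 18" "act g w ! j \<noteq> 0"
      show i: "inv (fst g) j < 18" using permutes_in_image[OF permutes_inv[OF p], of j] j by simp
      assume "w ! inv (fst g) j = 0"
      then show False using act_nth[OF g i, of w] j by (simp add: permutes_inverses(1)[OF p])
    qed
  qed
  then show ?thesis using w by (simp add: wt_alt bij_betw_same_card)
qed

lemma act_scl: "g \<in> G \<Longrightarrow> length w = 18 \<Longrightarrow> act g (scl c w) = scl c (act g w)"
  using monomial.T_scl[OF G_monomial] by (simp add: act_def)

lemma proj_id: "length w = 18 \<Longrightarrow> proj [0..<18] w = w"
  using map_nth[of w] by (simp add: proj_def)

definition light_words_of :: "nat \<Rightarrow> word list \<Rightarrow> word list" where "light_words_of h A = words h A (conj_transpose 9 A)"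

text \<open>A transformation between two codes permutes the lines of codewords of each weight. The representatives with
leading entry 1 correspond up to the inverse of the leading entry of the image.\<close>
lemma initial_rels:
  assumes A: "inv_mats A1 (conj_transpose 9 A1)" "inv_mats A2 (conj_transpose 9 A2)" and h: "h \<ge> 1" and g: "g \<in> G"
    and im: "act g ` code A1 = code A2"
  shows "monomial.rels (fst g) (snd g) 0 [0..<18] (initial_state (light_words_of h A1)) (initial_state (light_words_of h A2))"
proof -
  interpret monomial "fst g" "snd g" by (rule G_monomial[OF g])
  have T: "T = act g" by (simp add: act_def fun_eq_iff)
  have m: "is_mat A1" "is_mat A2" using A by (auto simp: inv_mats_def)
  have "relZ 0 [0..<18] (of_weight n (light_words_of h A1)) (of_weight n (light_words_of h A2))" for n
  proof -
    let ?n = "\<lambda>c. scl (inverse (lead (act g c))) (act g c)"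
    let ?W = "\<lambda>A. {w \<in> code A. lead w = 1 \<and> wt w \<le> 2 * h + 2 \<and> wt w = n}"
    have W: "set (of_weight n (light_words_of h A1)) = ?W A1" "set (of_weight n (light_words_of h A2)) = ?W A2"
      "distinct (of_weight n (light_words_of h A1))" "distinct (of_weight n (light_words_of h A2))"
      using words_spec[OF A(1) h] words_spec[OF A(2) h] by (auto simp: of_weight_def light_words_of_def)
    have lead: "lead (act g c) \<noteq> 0" if "c \<in> code A1" "lead c = 1" for c
      using that wt_act[OF g code_length[OF m(1)]] lead_eq_0[of c] lead_eq_0[of "act g c"] by simp
    have inj: "inj_on ?n (?W A1)"
    proof (rule inj_onI)
      fix c d assume c: "c \<in> ?W A1" and d: "d \<in> ?W A1" and eq: "?n c = ?n d"
      let ?a = "inverse (lead (act g c))" and ?b = "inverse (lead (act g d))"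
      have len: "length c = 18" "length d = 18" using c d code_length[OF m(1)] by auto
      have "act g (scl ?a c) = act g (scl ?b d)" using eq len by (simp add: act_scl[OF g])
      then have e: "scl ?a c = scl ?b d" using inj_on_act[OF g] len by (simp add: inj_on_def)
      have "lead (scl ?a c) = lead (scl ?b d)" unfolding e ..
      then have ab: "?a = ?b" using c d unfolding lead_scl by simp
      have a0: "inverse ?a * ?a = 1" using c lead by simp
      have "scl (inverse ?a) (scl ?a c) = scl (inverse ?a) (scl ?a d)" using e unfolding ab by (rule arg_cong)
      then show "c = d" unfolding scl_scl a0 by simp
    qed
    have img: "?n ` ?W A1 = ?W A2"
    proof (intro set_eqI iffI)
      fix w assume "w \<in> ?n ` ?W A1"
      then obtain c where c: "w = ?n c" "c \<in> ?W A1" by (rule imageE)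
      then have c': "c \<in> code A1" "lead c = 1" "wt c \<le> 2 * h + 2" "wt c = n" by simp_all
      have "act g c \<in> act g ` code A1" using c'(1) by (rule imageI)
      then have "w \<in> code A2" unfolding c(1) im by (rule scl_code[OF m(2)])
      moreover have "lead w = 1" unfolding c(1) lead_scl using lead[OF c'(1,2)] by simp
      moreover have "wt w = wt c" unfolding c(1) using lead[OF c'(1,2)] wt_act[OF g code_length[OF m(1) c'(1)]] by (simp add: wt_scl)
      ultimately show "w \<in> ?W A2" using c' by simp
    next
      fix w assume w: "w \<in> ?W A2"
      then have "w \<in> act g ` code A1" using im by simp
      then obtain c where c: "c \<in> code A1" "act g c = w" by blast
      have len: "length c = 18" using c code_length[OF m(1)] by simp
      have lc: "lead c \<noteq> 0" 
      proof -
        have "wt w \<noteq> 0" using w lead_eq_0[of w] by simp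
        then show ?thesis using wt_act[OF g len] c(2) lead_eq_0[of c] by simp
      qed
      let ?c = "scl (inverse (lead c)) c"
      have "?c \<in> ?W A1" using c w lc scl_code[OF m(1)] wt_act[OF g len] by (simp add: lead_scl wt_scl)
      moreover have "?n ?c = w" using c w lc len by (simp add: act_scl[OF g] lead_scl scl_scl)
      ultimately show "w \<in> ?n ` ?W A1" by (metis (no_types, lifting) image_eqI)
    qed
    have "mset (of_weight n (light_words_of h A2)) = mset_set (?W A2)" using mset_set_set[OF W(4)] unfolding W(2) by (rule sym)
    also have "\<dots> = image_mset ?n (mset_set (?W A1))" using image_mset_mset_set[OF inj] unfolding img by (rule sym)
    also have "\<dots> = image_mset ?n (mset (of_weight n (light_words_of h A1)))" using mset_set_set[OF W(3)] unfolding W(1) by (rule arg_cong)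
    also have "\<dots> = image_mset (\<lambda>c. proj [0..<18] (scl (inverse (lead (T c))) (T c))) (mset (of_weight n (light_words_of h A1)))"
      by (simp add: proj_id T)
    finally have ms: "mset (of_weight n (light_words_of h A2)) = image_mset (\<lambda>c. proj [0..<18] (scl (inverse (lead (T c))) (T c))) (mset (of_weight n (light_words_of h A1)))" .
    have "length c = 18 \<and> inverse (lead (T c)) \<noteq> 0" if "c \<in> set (of_weight n (light_words_of h A1))" for c
      using that lead[of c] code_length[OF m(1), of c] unfolding W(1) T by simp
    then show ?thesis unfolding relZ_def rel_def
      by (intro exI[of _ "\<lambda>c. inverse (lead (T c))"] exI[of _ "of_weight n (light_words_of h A1)"] conjI ballI ms) simp_all
  qed
  then show ?thesis by (simp add: rels_def initial_state_def)
qed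

lemma length_unitrow [simp]: "length (unitrow n i) = n"
  by (induction n i rule: unitrow.induct) auto
lemma unitrow_beyond: "n \<le> i \<Longrightarrow> unitrow n i = replicate n 0"
  by (induction n i rule: unitrow.induct) (auto simp: zero_gf4_def)
lemma unitrow_nth: "j < n \<Longrightarrow> unitrow n i ! j = (if i = j then 1 else 0)"
  by (induction n i arbitrary: j rule: unitrow.induct)
    (auto simp: nth_Cons' zero_gf4_def one_gf4_def unitrow_beyond split: if_splits)

lemma enc_unitrow:
  assumes "is_mat A" "i < 9" shows "enc A (unitrow 9 i) = A ! i"
proof (rule nth_equalityI)
  have l: "length (A ! i) = 9" using assms by (simp add: is_mat_def)
  then show "length (enc A (unitrow 9 i)) = length (A ! i)" using enc[OF assms(1)] by simp
  fix j assume "j < length (enc A (unitrow 9 i))"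
  then have "j < 9" using enc[OF assms(1)] by simp
  then show "enc A (unitrow 9 i) ! j = A ! i ! j"
    using enc(2)[OF assms(1), of "unitrow 9 i" j] assms(2)
    by (simp add: unitrow_nth if_distrib[of "\<lambda>x. x * _"] sum.delta cong: if_cong)
qed

lemma reversed_rows_in: "r \<in> set (reversed_rows k B) \<Longrightarrow> \<exists>i<length B. r = rev (B ! i) @ rev (unitrow 9 (k + i))"
proof (induction B arbitrary: k)
  case (Cons b B)
  then consider "r = rev b @ rev (unitrow 9 k)" | "r \<in> set (reversed_rows (Suc k) B)" by auto
  then show ?case
  proof cases
    case 2
    then obtain i where "i < length B" "r = rev (B ! i) @ rev (unitrow 9 (Suc k + i))" using Cons.IH by blast
    then show ?thesis by (intro exI[of _ "Suc i"]) simp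
  qed (auto intro: exI[of _ 0])
qed simp

lemma reversed_rows_code: assumes "is_mat A" "r \<in> set (reversed_rows 0 A)" shows "rev r \<in> code A" "length r = 18"
proof -
  obtain i where i: "i < 9" "r = rev (A ! i) @ rev (unitrow 9 i)"
    using reversed_rows_in[OF assms(2)] assms(1) by (auto simp: is_mat_def)
  then show "rev r \<in> code A" using enc_unitrow[OF assms(1) i(1)] by (auto simp: code_def intro!: exI[of _ "unitrow 9 i"])
  then show "length r = 18" using code_length[OF assms(1)] by fastforce
qed

lemma rows_ok:
  assumes "is_mat A1" "is_mat A2" "g \<in> G" "act g ` code A1 = code A2"
  shows "\<forall>r\<in>set (reversed_rows 0 A1). length r = 18 \<and> in_code A2 (mono (fst g) (snd g) (rev r))"
  using reversed_rows_code[OF assms(1)] assms in_code_iff[OF assms(2) length_act, of g] by (auto simp: act_def)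

text \<open>Codes are closed under scalar multiplication.\<close>
lemma normalise_first:
  assumes g: "g \<in> G" and im: "act g ` code A1 = code A2" and m: "is_mat A1" "is_mat A2"
  obtains g' where "g' \<in> G" "act g' ` code A1 = code A2" "fst g' = fst g" "snd g' 0 = 1"
proof -
  let ?a = "inverse (snd g 0)"
  have a: "?a \<noteq> 0" using g by (simp add: G_iff)
  define g' where "g' = (fst g, restrict (\<lambda>i. ?a * snd g i) {..<18::nat})"
  have g': "g' \<in> G" using g a by (auto simp: G_iff g'_def)
  have act: "act g' w = scl ?a (act g w)" for w
  proof (rule act_eqI[OF g'])
    fix i :: nat assume i: "i < 18"
    then have "fst g i < 18" using g permutes_in_image[of "fst g" "{..<18}"] by (simp add: G_iff)
    then show "scl ?a (act g w) ! fst g' i = snd g' i * w ! i"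
      using g i by (simp add: g'_def act_nth mult.assoc)
  qed simp
  have "act g' ` code A1 = scl ?a ` code A2" using im by (auto simp: act image_image[symmetric])
  also have "\<dots> = code A2"
  proof
    show "code A2 \<subseteq> scl ?a ` code A2"
    proof
      fix w assume "w \<in> code A2"
      then have "scl (inverse ?a) w \<in> code A2" "w = scl ?a (scl (inverse ?a) w)"
        using scl_code[OF m(2)] a by (auto simp: scl_scl)
      then show "w \<in> scl ?a ` code A2" by blast
    qed
  qed (use scl_code[OF m(2)] in auto)
  finally show ?thesis using that[of g'] g' a by (simp add: g'_def)
qed

lemma (in monomial) remaining_0: "remaining 0 [0..<18]"
  using permutes_image[OF perm] by (simp add: remaining_def atLeast0LessThan)
lemma (in monomial) path_ok_0: "path_ok 0 [0..<18] []"
  by (simp add: path_ok_def proj_id)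

lemma root_candidate:
  assumes A: "inv_mats A1 (conj_transpose 9 A1)" "inv_mats A2 (conj_transpose 9 A2)" and h: "h \<ge> 1" and g: "g \<in> G"
    and im: "act g ` code A1 = code A2" and s0: "snd g 0 = 1"
  defines "u \<equiv> initial_state (light_words_of h A1)" and "v \<equiv> initial_state (light_words_of h A2)"
  shows "(fst g 0, One4) \<in> set (candidates 18 [(One4, [])] (support_profile u) v)"
    and "ext 17 [(fst g 0, One4)] (reversed_rows 0 A1) A2 (split 0 One4 u) (split (fst g 0) One4 v)"
proof -
  interpret monomial "fst g" "snd g" by (rule G_monomial[OF g])
  have m: "is_mat A1" "is_mat A2" using A by (auto simp: inv_mats_def)
  have r: "rels 0 [0..<18] u v" unfolding u_def v_def by (rule initial_rels[OF A h g im])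
  have p: "fst g 0 < 18" by simp
  have d: "fst g 0 < length [0..<18]" "[0..<18] ! fst g 0 = fst g 0" "0 < (18::nat)" using p by simp_all
  have "head_supports_are (head_supports (fst u)) (map (map (drop (fst g 0))) (fst v))"
    using r head_supports_are_rel[OF _ d] by (simp add: rels_def)
  then have "(0 + fst g 0, One4) \<in> set (cands 0 18 [(One4, [])] (head_supports (fst u)) (fst v) (snd v))"
    by (intro cands_contains[where h' = "[]"]) (use p in simp_all)
  then show "(fst g 0, One4) \<in> set (candidates 18 [(One4, [])] (support_profile u) v)"
    by (simp add: candidates_def support_profile_def)
  have "ext 17 ((fst g 0, snd g 0) # []) (reversed_rows 0 A1) A2 (split 0 1 u) (split (fst g 0) (snd g 0) v)"
  proof (rule ext_sound[OF rels_split[OF r d remaining_0] _ path_ok_step[OF path_ok_0 d]])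
    obtain d' where "d' < length [0..<18]" "[0..<18] ! d' = fst g 0" "remaining (Suc 0) (del d' [0..<18])"
      by (rule remaining_nth[OF remaining_0]) simp_all
    then show "remaining (Suc 0) (del (fst g 0) [0..<18])" by simp
  qed (use rows_ok[OF m g im] in simp_all)
  then show "ext 17 [(fst g 0, One4)] (reversed_rows 0 A1) A2 (split 0 One4 u) (split (fst g 0) One4 v)"
    using s0 by (simp add: one_gf4_def)
qed

text \<open>The outcome of the search for a transformation with scalar 1 at the first coordinate.\<close>
definition may_be_equivalent :: "word list \<Rightarrow> word list \<Rightarrow> word list \<Rightarrow> word list \<Rightarrow> bool" where
  "may_be_equivalent A1 A2 W1 W2 = extendable_by 17 [] (candidates 18 [(One4, [])] (support_profile (initial_state W1)) (initial_state W2)) (reversed_rows 0 A1) A2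
     (split 0 One4 (initial_state W1)) (initial_state W2)"

text \<open>An equivalence, normalised to have scalar 1 at the first coordinate, would make the search succeed.\<close>
theorem inequivalentI:
  assumes "inv_mats A1 (conj_transpose 9 A1)" "inv_mats A2 (conj_transpose 9 A2)" "h \<ge> 1"
    and ref: "\<not> may_be_equivalent A1 A2 (light_words_of h A1) (light_words_of h A2)" and g: "g \<in> G"
  shows "act g ` code A1 \<noteq> code A2"
proof
  assume im: "act g ` code A1 = code A2"
  have m: "is_mat A1" "is_mat A2" using assms by (auto simp: inv_mats_def)
  obtain g' where g': "g' \<in> G" "act g' ` code A1 = code A2" "snd g' 0 = 1"
    using normalise_first[OF g im m] by metis
  show False using root_candidate[OF assms(1-3) g'] ref
    by (auto simp: may_be_equivalent_def extendable_by_def)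
qed

lemma survivors_eq: "survivors cs n p bs R A u v
   = length (filter (\<lambda>c. \<not> (mem c bs \<and> \<not> ext n (c # p) R A u (split (fst c) (snd c) v))) cs)"
  by (induction cs) auto

fun base_state :: "nat \<Rightarrow> state \<Rightarrow> state" where
  "base_state 0 u = u" | "base_state (Suc j) u = split 0 One4 (base_state j u)"

lemma base_remaining:
  assumes "g \<in> Stab C j"
  shows "monomial.remaining (fst g) j [j..<18]"
proof -
  have gG: "g \<in> G" using assms by (simp add: Stab_def)
  interpret monomial "fst g" "snd g" by (rule G_monomial[OF gG])
  have inj: "inj (fst g)" using perm by (rule permutes_inj)
  have 1: "fst g ` {..<j} = {..<j}" using assms by (auto simp: Stab_def)
  have 2: "fst g ` {..<18} = {..<18}" using perm by (rule permutes_image)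
  have "fst g ` ({..<18} - {..<j}) = {..<18} - {..<j}" unfolding image_set_diff[OF inj] 1 2 ..
  moreover have "{..<18} - {..<j} = {j..<18}" by auto
  ultimately show ?thesis by (simp add: remaining_def)
qed

lemma base_rels:
  assumes A: "inv_mats A (conj_transpose 9 A)" and h: "h \<ge> 1" and g: "g \<in> Stab (code A) j" and j: "j \<le> 9"
  defines "u \<equiv> initial_state (light_words_of h A)"
  shows "monomial.rels (fst g) (snd g) j [j..<18] (base_state j u) (base_state j u)
    \<and> monomial.path_ok (fst g) (snd g) j [j..<18] (replicate j (0, One4))"
  using j g
proof (induction j)
  case 0
  then have gG: "g \<in> G" and "act g ` code A = code A" by (auto simp: Stab_def)
  then show ?case using initial_rels[OF A A h gG] monomial.path_ok_0[OF G_monomial[OF gG]] by (simp add: u_def)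
next
  case (Suc j)
  have gG: "g \<in> G" using Suc.prems by (simp add: Stab_def)
  interpret monomial "fst g" "snd g" by (rule G_monomial[OF gG])
  have fix_j: "fst g j = j" "snd g j = 1" and fix_i: "\<And>i. i < j \<Longrightarrow> fst g i = i" using Suc.prems by (auto simp: Stab_def)
  have IH: "rels j [j..<18] (base_state j u) (base_state j u)" "path_ok j [j..<18] (replicate j (0, One4))"
    using Suc by (auto simp: Stab_def)
  have d: "0 < length [j..<18]" "[j..<18] ! 0 = fst g j" "j < 18" using Suc.prems fix_j by auto
  have del: "del 0 [j..<18] = [Suc j..<18]" using d(3) by (simp add: del_def upt_rec[of j])
  have "g \<in> Stab (code A) j" using Suc.prems by (simp add: Stab_def)
  then have rem: "remaining j [j..<18]" by (rule base_remaining)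
  show ?case using rels_split[OF IH(1) d rem] path_ok_step[OF IH(2) d] fix_j del by (simp add: one_gf4_def)
qed

text \<open>The images of coordinate \<open>j\<close> under the stabiliser of the earlier ones are among the surviving candidates.\<close>
lemma chain_level:
  assumes A: "inv_mats A (conj_transpose 9 A)" and h: "h \<ge> 1" and j: "j < 9"
  defines "u \<equiv> base_state j (initial_state (light_words_of h A))"
  shows "card (Stab (code A) j)
    \<le> survivors (candidates (18 - j) (count_table u) (support_profile u) u) (17 - j) (replicate j (0, One4)) bs (reversed_rows 0 A) A (split 0 One4 u) u
      * card (Stab (code A) (Suc j))"
proof -
  have m: "is_mat A" using A by (simp add: inv_mats_def)
  let ?P = "\<lambda>c. \<not> (mem c bs \<and> \<not> ext (17 - j) (c # replicate j (0, One4)) (reversed_rows 0 A) A (split 0 One4 u) (split (fst c) (snd c) u))"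
  let ?L = "filter ?P (candidates (18 - j) (count_table u) (support_profile u) u)"
  let ?K = "(\<lambda>c. (fst c + j, snd c)) ` set ?L"
  have "(fst g j, snd g j) \<in> ?K" if g: "g \<in> Stab (code A) j" for g
  proof -
    have gG: "g \<in> G" and im: "act g ` code A = code A" using g by (auto simp: Stab_def)
    interpret monomial "fst g" "snd g" by (rule G_monomial[OF gG])
    have r: "rels j [j..<18] u u" and po: "path_ok j [j..<18] (replicate j (0, One4))"
      using base_rels[OF A h g] j by (auto simp: u_def)
    have rem: "remaining j [j..<18]" by (rule base_remaining[OF g])
    have j18: "j < 18" using j by simp
    obtain d where d: "d < length [j..<18]" "[j..<18] ! d = fst g j" and rem': "remaining (Suc j) (del d [j..<18])"
      by (rule remaining_nth[OF rem j18])
    have "(d, snd g j) \<in> set (candidates (18 - j) (count_table u) (support_profile u) u)"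
      by (rule candidates_contains[OF r d j18]) simp
    moreover have "ext (17 - j) ((d, snd g j) # replicate j (0, One4)) (reversed_rows 0 A) A (split 0 1 u) (split d (snd g j) u)"
      by (rule ext_sound[OF rels_split[OF r d j18 rem] rem' path_ok_step[OF po d j18]])
        (use rows_ok[OF m m gG im] j in auto)
    ultimately have "(d, snd g j) \<in> set ?L" by (simp add: one_gf4_def)
    moreover have "fst g j = d + j" using d by simp
    ultimately show ?thesis by force
  qed
  then have "card (Stab (code A) j) \<le> card ?K * card (Stab (code A) (Suc j))"
    by (rule card_Stab_step[rotated 3]) (use j in \<open>simp_all add: code_length[OF m]\<close>)
  also have "card ?K \<le> length ?L" using card_image_le[of "set ?L"] card_length[of ?L] le_trans by blast
  finally show ?thesis unfolding survivors_eq by simp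
qed

lemma chain_root:
  assumes A: "inv_mats A (conj_transpose 9 A)" and h: "h \<ge> 1"
  defines "u \<equiv> initial_state (light_words_of h A)"
  shows "card (Stab (code A) 0)
    \<le> 3 * survivors (candidates 18 [(One4, [])] (support_profile u) u) 17 [] bs (reversed_rows 0 A) A (split 0 One4 u) u
      * card (Stab (code A) 1)"
proof -
  have m: "is_mat A" using A by (simp add: inv_mats_def)
  let ?P = "\<lambda>c. \<not> (mem c bs \<and> \<not> ext 17 (c # []) (reversed_rows 0 A) A (split 0 One4 u) (split (fst c) (snd c) u))"
  let ?L = "filter ?P (candidates 18 [(One4, [])] (support_profile u) u)"
  let ?K = "fst ` set ?L \<times> (- {0 :: gf4})"
  have "(fst g 0, snd g 0) \<in> ?K" if g: "g \<in> Stab (code A) 0" for g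
  proof -
    have gG: "g \<in> G" and im: "act g ` code A = code A" using g by (auto simp: Stab_def)
    obtain g' where g': "g' \<in> G" "act g' ` code A = code A" "fst g' = fst g" "snd g' 0 = 1"
      using normalise_first[OF gG im m m] by metis
    have "(fst g 0, One4) \<in> set ?L"
      using root_candidate[OF A A h g'(1,2,4)] g'(3) by (simp add: u_def)
    then show ?thesis using gG by (force simp: G_iff)
  qed
  then have "card (Stab (code A) 0) \<le> card ?K * card (Stab (code A) (Suc 0))"
    by (intro card_Stab_step[where j = 0 and K = ?K]) (simp_all add: code_length[OF m])
  moreover have "card ?K \<le> 3 * length ?L"
  proof -
    have "card (fst ` set ?L) \<le> length ?L" using card_image_le[of "set ?L"] card_length[of ?L] le_trans by blast
    then show ?thesis by (simp add: card_cartesian_product card_nonzero)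
  qed
  ultimately show ?thesis unfolding survivors_eq One_nat_def by (rule order.trans[OF _ mult_le_mono1])
qed

text \<open>An automorphism fixing the information coordinates fixes every codeword. If it maps column \<open>k\<close> of \<open>A\<close> to column
\<open>l\<close>, then column \<open>l\<close> is a multiple of column \<open>k\<close>, which is impossible for distinct orthonormal columns and forces
the scalar 1 otherwise.\<close>
lemma Stab_trivial:
  assumes A: "is_mat A" and cols: "\<And>i j. i < 9 \<Longrightarrow> j < 9 \<Longrightarrow> (\<Sum>r<9. A ! r ! i * (A ! r ! j) ^ 2) = (if i = j then 1 else 0)"
  shows "card (Stab (code A) 9) \<le> 1"
proof -
  have "g = (id, restrict (\<lambda>_. 1) {..<18})" if g: "g \<in> Stab (code A) 9" for g
  proof -
    have gG: "g \<in> G" and im: "act g ` code A = code A" and fixed: "\<And>i. i < 9 \<Longrightarrow> fst g i = i \<and> snd g i = 1"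
      using g by (auto simp: Stab_def)
    have p: "fst g permutes {..<18}" using gG by (simp add: G_iff)
    have act_id: "act g w = w" if w: "w \<in> code A" for w
    proof -
      have len: "length w = 18" using w code_length[OF A] by simp
      have "act g w \<in> act g ` code A" using w by (rule imageI)
      then have w': "act g w \<in> code A" unfolding im .
      obtain x where x0: "w = x @ enc A x" "length x = 9" using w by (auto simp: code_def)
      obtain y where y0: "act g w = y @ enc A y" "length y = 9" using w' by (auto simp: code_def)
      note x = x0 y0
      have "y = x"
      proof (rule nth_equalityI)
        fix i assume "i < length y"
        then have i: "i < 9" using x by simp
        then have "act g w ! i = w ! i" using act_nth[OF gG, of i w] fixed[OF i] by simp
        then show "y ! i = x ! i" using x i by (simp add: nth_append)
      qed (use x in simp)
      then show ?thesis using x by simp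
    qed
    have inj: "inj (fst g)" using p by (rule permutes_inj)
    have all: "fst g i = i \<and> snd g i = 1" if i: "i < 18" for i
    proof (cases "i < 9")
      case False
      define k where "k = i - 9"
      have k: "i = k + 9" "k < 9" using i False by (auto simp: k_def)
      have "fst g i < 18" using permutes_in_image[OF p, of i] i by simp
      moreover have "\<not> fst g i < 9"
      proof
        assume a: "fst g i < 9"
        then have "fst g (fst g i) = fst g i" using fixed by blast
        then show False using injD[OF inj, of "fst g i" i] a False by simp
      qed
      ultimately obtain l where l: "fst g i = l + 9" "l < 9"
        by (intro that[of "fst g i - 9"]) auto
      have col: "A ! r ! l = snd g i * A ! r ! k" if r: "r < 9" for r
      proof -
        let ?w = "unitrow 9 r @ A ! r"
        have w: "?w \<in> code A" using enc_unitrow[OF A r] by (auto simp: code_def intro!: exI[of _ "unitrow 9 r"])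
        show ?thesis using act_nth[OF gG i, of ?w] act_id[OF w] l k by (simp add: nth_append)
      qed
      have "(\<Sum>r<9. A ! r ! l * (A ! r ! k) ^ 2) = snd g i * (\<Sum>r<9. A ! r ! k * (A ! r ! k) ^ 2)"
        by (simp add: col sum_distrib_left mult.assoc)
      then have e: "(if l = k then 1 else 0) = snd g i" using cols l(2) k(2) by simp
      then show ?thesis using gG i l k by (auto simp: G_iff split: if_splits)
    qed (use fixed in auto)
    have "fst g i = i" for i using all[of i] permutes_not_in[OF p, of i] by (cases "i < 18") simp_all
    then have "fst g = id" by (simp add: fun_eq_iff)
    moreover have "snd g = restrict (\<lambda>_. 1) {..<18}"
      by (rule extensionalityI[of _ "{..<18}"]) (use all gG in \<open>simp_all add: G_iff\<close>)
    ultimately show ?thesis by (simp add: prod_eq_iff)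
  qed
  then have "Stab (code A) 9 \<subseteq> {(id, restrict (\<lambda>_. 1) {..<18})}" by blast
  from card_mono[OF _ this] show ?thesis by simp
qed

lemma chain_bound:
  assumes A: "inv_mats A (conj_transpose 9 A)" and h: "h \<ge> 1" and t: "card (Stab (code A) 9) \<le> 1"
  shows "length bads = 9 - j \<Longrightarrow> j \<le> 9 \<Longrightarrow> card (Stab (code A) j)
    \<le> prod_list (stabiliser_chain_from bads (18 - j) (replicate j (0, One4)) (reversed_rows 0 A) A (base_state j (initial_state (light_words_of h A))))"
proof (induction bads arbitrary: j)
  case Nil
  then show ?case using t by simp
next
  case (Cons bs bads)
  then have j: "j < 9" by simp
  then obtain n where n: "18 - j = Suc n" "17 - j = n" "18 - Suc j = n" by (intro that[of "17 - j"]) auto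
  have IH: "card (Stab (code A) (Suc j)) \<le> prod_list (stabiliser_chain_from bads (18 - Suc j) (replicate (Suc j) (0, One4)) (reversed_rows 0 A) A (base_state (Suc j) (initial_state (light_words_of h A))))"
    using Cons j by (intro Cons.IH) auto
  show ?case
    using order.trans[OF chain_level[OF A h j, of bs] mult_le_mono2[OF IH]] unfolding n by simp
qed

text \<open>The factor 3 accounts for the scalar at the first coordinate.\<close>
theorem automorphism_bound:
  assumes A: "inv_mats A (conj_transpose 9 A)" and h: "h \<ge> 1" and t: "card (Stab (code A) 9) \<le> 1" and b: "length bads = 9"
  shows "card (Stab (code A) 0) \<le> 3 * prod_list (stabiliser_chain bads (reversed_rows 0 A) A (initial_state (light_words_of h A)))"
proof -
  obtain bs bads' where bads: "bads = bs # bads'" "length bads' = 9 - 1" using b by (cases bads) auto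
  have "card (Stab (code A) 1) \<le> prod_list (stabiliser_chain_from bads' 17 [(0, One4)] (reversed_rows 0 A) A (base_state 1 (initial_state (light_words_of h A))))"
    using chain_bound[OF A h t bads(2)] by simp
  from order.trans[OF chain_root[OF A h, of bs] mult_le_mono2[OF this]] show ?thesis by (simp add: bads mult.assoc)
qed

section \<open>Self-dual codes from unitary matrices\<close>

lemma conj_transpose_eq: "\<forall>r\<in>set m. length r = n \<Longrightarrow> conj_transpose n m = map (\<lambda>j. map (\<lambda>r. (r ! j) ^ 2) m) [0..<n]"
proof (induction n arbitrary: m)
  case (Suc n)
  have h: "heads m = map hd m" and t: "tls m = map tl m"
    using Suc.prems by (induction m) (auto simp: neq_Nil_conv length_Suc_conv)
  have e: "hd r = r ! 0" if "r \<in> set m" for r using Suc.prems that by (auto simp: length_Suc_conv)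
  have l: "\<forall>r\<in>set (tls m). length r = n" using Suc.prems by (simp add: t)
  have e2: "map (\<lambda>r. (r ! j) ^ 2) (map tl m) = map (\<lambda>r. (r ! Suc j) ^ 2) m" if "j < n" for j
    using that Suc.prems by (auto simp: nth_tl)
  then have "conj_transpose n (tls m) = map (\<lambda>j. map (\<lambda>r. (r ! Suc j) ^ 2) m) [0..<n]"
    unfolding Suc.IH[OF l] unfolding t by (rule map_cong[OF refl]) (simp add: e2[unfolded map_map])
  then show ?case using e by (simp add: h conj_word_def upt_conv_Cons map_Suc_upt[symmetric] o_def del: upt_Suc)
qed simp

fun row_products :: "word list \<Rightarrow> word list \<Rightarrow> word list" where
  "row_products [] B = []" | "row_products (r # rs) B = add_product (zero_word 9) r B # row_products rs B"
fun unit_rows :: "nat \<Rightarrow> nat \<Rightarrow> word list" where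
  "unit_rows 0 i = []" | "unit_rows (Suc n) i = unitrow 9 i # unit_rows n (Suc i)"
text \<open>\<open>A\<close> is unitary: \<open>A\<close> times its conjugate transpose is the identity, in both orders.\<close>
definition good :: "word list \<Rightarrow> bool" where
  "good A \<longleftrightarrow> lengths A = [9, 9, 9, 9, 9, 9, 9, 9, 9] \<and> row_products A (conj_transpose 9 A) = unit_rows 9 0 \<and> row_products (conj_transpose 9 A) A = unit_rows 9 0"

lemma row_products_map: "row_products rs B = map (enc B) rs"
  by (induction rs) (auto simp: zero_word_eq zero9_def enc_def)
lemma unit_rows_eq: "unit_rows n i = map (\<lambda>j. unitrow 9 (i + j)) [0..<n]"
  by (induction n i rule: unit_rows.induct) (auto simp: upt_conv_Cons map_Suc_upt[symmetric] o_def simp del: upt_Suc)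
lemma lengths_map: "lengths xs = map length xs" by (induction xs) auto

lemma good_props:
  assumes "good A"
  shows "inv_mats A (conj_transpose 9 A)"
    and "i < 9 \<Longrightarrow> j < 9 \<Longrightarrow> (\<Sum>k<9. A ! i ! k * (A ! j ! k) ^ 2) = (if i = j then 1 else 0)"
    and "i < 9 \<Longrightarrow> j < 9 \<Longrightarrow> (\<Sum>r<9. A ! r ! i * (A ! r ! j) ^ 2) = (if i = j then 1 else 0)"
proof -
  let ?B = "conj_transpose 9 A"
  have lensA: "map length A = [9, 9, 9, 9, 9, 9, 9, 9, 9]" and 1: "map (enc ?B) A = map (unitrow 9) [0..<9]"
    and 2: "map (enc A) ?B = map (unitrow 9) [0..<9]"
    using assms by (simp_all only: good_def lengths_map row_products_map unit_rows_eq add_0)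
  have len9: "length A = 9" using arg_cong[OF lensA, of length] by simp
  have "length r = 9" if "r \<in> set A" for r
  proof -
    from that have "length r \<in> set (map length A)" by simp
    then show ?thesis unfolding lensA by simp
  qed
  then have A: "is_mat A" using len9 unfolding is_mat_def by blast
  then have Beq: "?B = map (\<lambda>j. map (\<lambda>r. (r ! j) ^ 2) A) [0..<9]" by (intro conj_transpose_eq) (simp add: is_mat_def)
  have B: "is_mat ?B" unfolding Beq using len9 by (auto simp: is_mat_def)
  have Bn: "?B ! j ! i = (A ! i ! j) ^ 2" if "i < 9" "j < 9" for i j unfolding Beq using that len9 by simp
  have r: "(\<Sum>k<9. A ! i ! k * (A ! j ! k) ^ 2) = (if i = j then 1 else 0)" if "i < 9" "j < 9" for i j
  proof -
    have l: "length (A ! i) = 9" using A that by (simp add: is_mat_def)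
    have "map (enc ?B) A ! i = enc ?B (A ! i)" using len9 that by simp
    then have "enc ?B (A ! i) = unitrow 9 i" unfolding 1 using that by (simp del: upt_Suc upt_rec_numeral)
    moreover have "enc ?B (A ! i) ! j = (\<Sum>k<9. A ! i ! k * (A ! j ! k) ^ 2)"
      unfolding enc(2)[OF B l that(2)] using that Bn by (intro sum.cong refl arg_cong2[where f = "(*)"]) simp
    ultimately have "(\<Sum>k<9. A ! i ! k * (A ! j ! k) ^ 2) = unitrow 9 i ! j" by (simp only:)
    also have "\<dots> = (if i = j then 1 else 0)" by (rule unitrow_nth[OF that(2)])
    finally show ?thesis .
  qed
  have c: "(\<Sum>r<9. A ! r ! i * (A ! r ! j) ^ 2) = (if i = j then 1 else 0)" if "i < 9" "j < 9" for i j
  proof -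
    have l: "length (?B ! j) = 9" "length ?B = 9" using B that by (simp_all add: is_mat_def)
    have "map (enc A) ?B ! j = enc A (?B ! j)" using l that by simp
    then have "enc A (?B ! j) = unitrow 9 j" unfolding 2 using that by (simp del: upt_Suc upt_rec_numeral)
    moreover have "enc A (?B ! j) ! i = (\<Sum>r<9. A ! r ! i * (A ! r ! j) ^ 2)"
      unfolding enc(2)[OF A l(1) that(1)]
    proof (intro sum.cong refl)
      fix r :: nat assume "r \<in> {..<9}"
      then have "r < 9" by simp
      show "?B ! j ! r * A ! r ! i = A ! r ! i * (A ! r ! j) ^ 2"
        unfolding Bn[OF \<open>r < 9\<close> that(2)] by (rule mult.commute)
    qed
    ultimately have "(\<Sum>r<9. A ! r ! i * (A ! r ! j) ^ 2) = unitrow 9 j ! i" by (simp only:)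
    also have "\<dots> = (if j = i then 1 else 0)" by (rule unitrow_nth[OF that(1)])
    finally show ?thesis by (simp only: eq_commute)
  qed
  have "enc ?B (enc A x) = x" if x: "length x = 9" for x
  proof (rule nth_equalityI)
    note ex = enc[OF A x]
    show "length (enc ?B (enc A x)) = length x" using enc(1)[OF B ex(1)] x by simp
    fix i assume "i < length (enc ?B (enc A x))"
    then have i: "i < 9" using enc(1)[OF B ex(1)] by simp
    have "enc ?B (enc A x) ! i = (\<Sum>j<9. (\<Sum>l<9. x ! l * A ! l ! j) * (A ! i ! j) ^ 2)"
      unfolding enc(2)[OF B ex(1) i] using i ex(2) Bn by (intro sum.cong) auto
    also have "\<dots> = (\<Sum>l<9. x ! l * (\<Sum>j<9. A ! l ! j * (A ! i ! j) ^ 2))"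
      unfolding sum_distrib_left sum_distrib_right by (subst sum.swap) (simp add: mult.assoc)
    also have "\<dots> = (\<Sum>l<9. x ! l * (if l = i then 1 else 0))" using r i by (intro sum.cong) auto
    also have "\<dots> = x ! i" using i by (simp add: if_distrib[of "\<lambda>z. _ * z"] sum.delta cong: if_cong)
    finally show "enc ?B (enc A x) ! i = x ! i" .
  qed
  moreover have "enc A (enc ?B x) = x" if x: "length x = 9" for x
  proof (rule nth_equalityI)
    note ex = enc[OF B x]
    show "length (enc A (enc ?B x)) = length x" using enc(1)[OF A ex(1)] x by simp
    fix i assume "i < length (enc A (enc ?B x))"
    then have i: "i < 9" using enc(1)[OF A ex(1)] by simp
    have "enc A (enc ?B x) ! i = (\<Sum>j<9. (\<Sum>l<9. x ! l * (A ! j ! l) ^ 2) * A ! j ! i)"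
      unfolding enc(2)[OF A ex(1) i] 
    proof (intro sum.cong refl arg_cong2[where f = "(*)"])
      fix j :: nat assume "j \<in> {..<9}"
      then have "j < 9" by simp
      then show "enc ?B x ! j = (\<Sum>l<9. x ! l * (A ! j ! l) ^ 2)"
        unfolding ex(2)[OF \<open>j < 9\<close>] using Bn by (intro sum.cong) auto
    qed
    also have "\<dots> = (\<Sum>l<9. x ! l * (\<Sum>j<9. A ! j ! i * (A ! j ! l) ^ 2))"
      unfolding sum_distrib_left sum_distrib_right by (subst sum.swap) (simp add: mult_ac)
    also have "\<dots> = (\<Sum>l<9. x ! l * (if i = l then 1 else 0))" using c i by (intro sum.cong) auto
    also have "\<dots> = x ! i" using i by (simp add: if_distrib[of "\<lambda>z. _ * z"] sum.delta cong: if_cong)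
    finally show "enc A (enc ?B x) ! i = x ! i" .
  qed
  ultimately show "inv_mats A ?B" using A B by (simp add: inv_mats_def)
  show "i < 9 \<Longrightarrow> j < 9 \<Longrightarrow> (\<Sum>k<9. A ! i ! k * (A ! j ! k) ^ 2) = (if i = j then 1 else 0)" by (rule r)
  show "i < 9 \<Longrightarrow> j < 9 \<Longrightarrow> (\<Sum>r<9. A ! r ! i * (A ! r ! j) ^ 2) = (if i = j then 1 else 0)" by (rule c)
qed

text \<open>An arbitrary numbering of the coordinates, to translate between vectors and lists.\<close>
definition ix :: "nat \<Rightarrow> 18" where "ix = (SOME f. bij_betw f {..<18} UNIV)"
lemma bij_ix: "bij_betw ix {..<18} UNIV"
proof -
  have "\<exists>f. bij_betw f {..<18::nat} (UNIV :: 18 set)"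
    using ex_bij_betw_nat_finite[of "UNIV :: 18 set"] by (simp add: atLeast0LessThan)
  then show ?thesis unfolding ix_def by (rule someI_ex)
qed
definition nx :: "18 \<Rightarrow> nat" where "nx = inv_into {..<18} ix"
lemma ix_nx [simp]: "ix (nx k) = k"
  unfolding nx_def using bij_betw_inv_into_right[OF bij_ix] by simp
lemma nx_ix [simp]: "i < 18 \<Longrightarrow> nx (ix i) = i"
  unfolding nx_def using bij_betw_inv_into_left[OF bij_ix] by simp
lemma nx_less [simp]: "nx k < 18"
  using bij_betwE[OF bij_betw_inv_into[OF bij_ix]] by (auto simp: nx_def)

definition to_word :: "gf4 ^ 18 \<Rightarrow> word" where "to_word x = map (\<lambda>i. x $ ix i) [0..<18]"
definition of_word :: "word \<Rightarrow> gf4 ^ 18" where "of_word w = (\<chi> k. w ! nx k)"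
lemma length_to_word [simp]: "length (to_word x) = 18" by (simp add: to_word_def)
lemma nth_to_word [simp]: "i < 18 \<Longrightarrow> to_word x ! i = x $ ix i" by (simp add: to_word_def)
lemma of_word_to_word [simp]: "of_word (to_word x) = x" by (simp add: of_word_def vec_eq_iff)
lemma to_word_of_word: "length w = 18 \<Longrightarrow> to_word (of_word w) = w" by (rule nth_equalityI) (auto simp: of_word_def)
lemma sum_ix: "(\<Sum>k\<in>UNIV. f k) = (\<Sum>i<18. f (ix i))"
  using sum.reindex_bij_betw[OF bij_ix, of f] by simp
lemma inner_to_word: "hermitian_inner x y = (\<Sum>i<18. to_word x ! i * (to_word y ! i) ^ 2)"
  unfolding hermitian_inner_def sum_ix by (intro sum.cong) auto
lemma weight_to_word: "weight x = wt (to_word x)"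
proof -
  have "bij_betw ix {i. i < 18 \<and> to_word x ! i \<noteq> 0} {k. x $ k \<noteq> 0}"
    by (rule bij_betw_byWitness[of _ nx]) auto
  then show ?thesis by (simp add: weight_def wt_alt bij_betw_same_card)
qed

definition vcode :: "word list \<Rightarrow> (gf4 ^ 18) set" where "vcode A = {x. to_word x \<in> code A}"

lemma to_word_vcode: "is_mat A \<Longrightarrow> to_word ` vcode A = code A"
proof (intro set_eqI iffI)
  fix w assume A: "is_mat A" and "w \<in> code A"
  then have "to_word (of_word w) = w" using code_length to_word_of_word by blast
  with \<open>w \<in> code A\<close> show "w \<in> to_word ` vcode A" unfolding vcode_def by (metis imageI mem_Collect_eq)
qed (auto simp: vcode_def)

lemma code_iff: "is_mat A \<Longrightarrow> length w = 18 \<Longrightarrow> w \<in> code A \<longleftrightarrow> (\<forall>j<9. w ! (9 + j) = (\<Sum>i<9. w ! i * A ! i ! j))"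
proof -
  assume A: "is_mat A" and w: "length w = 18"
  have t: "length (take 9 w) = 9" using w by simp
  have "w \<in> code A \<longleftrightarrow> drop 9 w = enc A (take 9 w)"
  proof
    assume "drop 9 w = enc A (take 9 w)"
    then have "w = take 9 w @ enc A (take 9 w)" using append_take_drop_id[of 9 w] by simp
    then show "w \<in> code A" using t unfolding code_def by blast
  qed (auto simp: code_def)
  also have "\<dots> \<longleftrightarrow> (\<forall>j<9. drop 9 w ! j = enc A (take 9 w) ! j)"
    using enc(1)[OF A t] w by (simp add: list_eq_iff_nth_eq)
  also have "\<dots> \<longleftrightarrow> (\<forall>j<9. w ! (9 + j) = (\<Sum>i<9. w ! i * A ! i ! j))"
  proof -
    have "enc A (take 9 w) ! j = (\<Sum>i<9. w ! i * A ! i ! j)" if "j < 9" for j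
      unfolding enc(2)[OF A t that] by (intro sum.cong) auto
    then show ?thesis using w by simp
  qed
  finally show ?thesis .
qed

lemma subspace_vcode: assumes A: "is_mat A" shows "vec.subspace (vcode A)"
  unfolding vec.subspace_def vcode_def mem_Collect_eq
  by (auto simp: code_iff[OF A] algebra_simps sum.distrib sum_distrib_left)

lemma sum_18: "(\<Sum>i<18. f i) = (\<Sum>i<9. f i) + (\<Sum>j<9. f (9 + j))" for f :: "nat \<Rightarrow> gf4"
proof -
  have "(\<Sum>i<m + n. f i) = (\<Sum>i<m. f i) + (\<Sum>j<n. f (m + j))" for m n
    by (induction n) (simp_all add: add.assoc)
  from this[of 9 9] show ?thesis by (simp only: numeral_plus_numeral semiring_norm)
qed

text \<open>For a unitary \<open>A\<close> the rows of \<open>(I | A)\<close> are orthogonal to each other, as the characteristic is 2. Conversely, a vector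
orthogonal to all of them satisfies \<open>x' = x'' A*\<close> for its two halves, hence \<open>x' A = x''\<close>.\<close>
lemma self_dual_vcode:
  assumes g: "good A" shows "hermitian_self_dual (vcode A)"
proof -
  have A: "is_mat A" using good_props(1)[OF g] by (simp add: inv_mats_def)
  note rows = good_props(2)[OF g] and cols = good_props(3)[OF g]
  have mem: "x \<in> vcode A \<longleftrightarrow> (\<forall>j<9. to_word x ! (9 + j) = (\<Sum>i<9. to_word x ! i * A ! i ! j))" for x
    by (simp add: vcode_def code_iff[OF A] del: nth_to_word)
  have "hermitian_inner x y = 0" if x: "x \<in> vcode A" and y: "y \<in> vcode A" for x y
  proof -
    let ?x = "\<lambda>i. to_word x ! i" and ?y = "\<lambda>i. to_word y ! i"
    have "(\<Sum>j<9. ?x (9 + j) * (?y (9 + j)) ^ 2)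
       = (\<Sum>j<9. \<Sum>i<9. \<Sum>l<9. ?x i * ?y l ^ 2 * (A ! i ! j * (A ! l ! j) ^ 2))"
    proof (rule sum.cong[OF refl])
      fix j :: nat assume "j \<in> {..<9}"
      then have e: "?x (9 + j) = (\<Sum>i<9. ?x i * A ! i ! j)" "?y (9 + j) = (\<Sum>l<9. ?y l * A ! l ! j)"
        by (simp_all only: x[unfolded mem, rule_format] y[unfolded mem, rule_format] lessThan_iff)
      show "?x (9 + j) * (?y (9 + j)) ^ 2 = (\<Sum>i<9. \<Sum>l<9. ?x i * ?y l ^ 2 * (A ! i ! j * (A ! l ! j) ^ 2))"
        unfolding e gf4_sq_sum sum_product power_mult_distrib
        by (intro sum.cong refl) (simp only: ac_simps)
    qed
    also have "\<dots> = (\<Sum>i<9. \<Sum>l<9. ?x i * ?y l ^ 2 * (\<Sum>j<9. A ! i ! j * (A ! l ! j) ^ 2))"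
    proof -
      have "(\<Sum>j<9. \<Sum>i<9. \<Sum>l<9. ?x i * ?y l ^ 2 * (A ! i ! j * (A ! l ! j) ^ 2))
          = (\<Sum>i<9. \<Sum>j<9. \<Sum>l<9. ?x i * ?y l ^ 2 * (A ! i ! j * (A ! l ! j) ^ 2))" by (rule sum.swap)
      also have "\<dots> = (\<Sum>i<9. \<Sum>l<9. \<Sum>j<9. ?x i * ?y l ^ 2 * (A ! i ! j * (A ! l ! j) ^ 2))"
        by (intro sum.cong refl sum.swap)
      finally show ?thesis unfolding sum_distrib_left .
    qed
    also have "\<dots> = (\<Sum>i<9. \<Sum>l<9. ?x i * ?y l ^ 2 * (if i = l then 1 else 0))"
      by (intro sum.cong refl arg_cong2[where f = "(*)"] rows) (simp_all only: lessThan_iff)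
    also have "\<dots> = (\<Sum>i<9. ?x i * ?y i ^ 2)"
      by (intro sum.cong refl) (simp add: if_distrib[of "\<lambda>z. _ * z"] sum.delta del: nth_to_word cong: if_cong)
    finally show ?thesis unfolding inner_to_word sum_18 by (simp only: gf4_add_self)
  qed
  moreover have "x \<in> vcode A" if x: "x \<in> hermitian_dual (vcode A)" for x
  proof -
    let ?x = "\<lambda>i. to_word x ! i"
    have o: "?x i = (\<Sum>j<9. ?x (9 + j) * (A ! i ! j) ^ 2)" if i: "i < 9" for i
    proof -
      let ?w = "unitrow 9 i @ A ! i"
      have li: "length (A ! i) = 9" using A i by (simp add: is_mat_def)
      have "?w \<in> code A" unfolding code_def using enc_unitrow[OF A i] by (intro CollectI exI[of _ "unitrow 9 i"]) simp
      moreover have v: "to_word (of_word ?w) = ?w" using li by (intro to_word_of_word) simp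
      ultimately have "of_word ?w \<in> vcode A" by (simp add: vcode_def)
      then have "hermitian_inner x (of_word ?w) = 0" using x by (simp add: hermitian_dual_def)
      then have "(\<Sum>k<9. ?x k * (?w ! k) ^ 2) + (\<Sum>j<9. ?x (9 + j) * (?w ! (9 + j)) ^ 2) = 0"
        unfolding inner_to_word sum_18 v .
      moreover have "(\<Sum>k<9. ?x k * (?w ! k) ^ 2) = (\<Sum>k<9. if k = i then ?x k else 0)"
      proof (intro sum.cong refl)
        fix k :: nat assume "k \<in> {..<9}"
        then have "?w ! k = (if i = k then 1 else 0)" by (simp add: nth_append unitrow_nth)
        then show "?x k * (?w ! k) ^ 2 = (if k = i then ?x k else 0)" by (simp del: nth_to_word)
      qed
      moreover have "(\<Sum>j<9. ?x (9 + j) * (?w ! (9 + j)) ^ 2) = (\<Sum>j<9. ?x (9 + j) * (A ! i ! j) ^ 2)"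
        by (intro sum.cong refl) (simp add: nth_append del: nth_to_word)
      ultimately have "?x i + (\<Sum>j<9. ?x (9 + j) * (A ! i ! j) ^ 2) = 0"
        using i by (simp only: sum.delta finite_lessThan lessThan_iff if_True)
      then have "?x i = - (\<Sum>j<9. ?x (9 + j) * (A ! i ! j) ^ 2)" by (rule eq_neg_iff_add_eq_0[THEN iffD2])
      then show ?thesis by (simp only: uminus_gf4_def)
    qed
    show ?thesis unfolding mem
    proof (intro allI impI)
      fix j :: nat assume j: "j < 9"
      have "(\<Sum>i<9. ?x i * A ! i ! j) = (\<Sum>i<9. (\<Sum>k<9. ?x (9 + k) * (A ! i ! k) ^ 2) * A ! i ! j)"
        by (intro sum.cong refl arg_cong2[where f = "(*)"] o) (simp only: lessThan_iff)
      also have "\<dots> = (\<Sum>i<9. \<Sum>k<9. ?x (9 + k) * (A ! i ! j * (A ! i ! k) ^ 2))"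
        unfolding sum_distrib_right by (intro sum.cong refl) (simp only: ac_simps)
      also have "\<dots> = (\<Sum>k<9. ?x (9 + k) * (\<Sum>i<9. A ! i ! j * (A ! i ! k) ^ 2))"
        unfolding sum_distrib_left by (rule sum.swap)
      also have "\<dots> = (\<Sum>k<9. ?x (9 + k) * (if j = k then 1 else 0))"
        by (intro sum.cong refl arg_cong2[where f = "(*)"] cols j) (simp only: lessThan_iff)
      also have "\<dots> = ?x (9 + j)" using j by (simp add: if_distrib[of "\<lambda>z. _ * z"] sum.delta del: nth_to_word cong: if_cong)
      finally show "?x (9 + j) = (\<Sum>i<9. ?x i * A ! i ! j)" ..
    qed
  qed
  ultimately have "vcode A = hermitian_dual (vcode A)" unfolding hermitian_dual_def by blast
  then show ?thesis using subspace_vcode[OF A] by (simp add: hermitian_self_dual_def)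
qed

section \<open>Equivalence, class sizes and minimum weights\<close>

lemma vector_monomial:
  assumes "monomial_matrix M" "\<And>i j. M $ i $ j \<noteq> 0 \<longleftrightarrow> j = q i"
  shows "(x v* M) $ q i = M $ i $ q i * x $ i"
proof -
  have "inj q" using assms unfolding monomial_matrix_def inj_def by metis
  then have "M $ k $ q i = 0 \<longleftrightarrow> k \<noteq> i" for k using assms(2)[of k "q i"] by (auto simp: inj_def)
  then have "(\<Sum>k\<in>UNIV. M $ k $ q i * x $ k) = (\<Sum>k\<in>{i}. M $ k $ q i * x $ k)"
    by (intro sum.mono_neutral_right) auto
  then show ?thesis by (simp add: vector_matrix_mult_def mult.commute)
qed

lemma act_of_matrix:
  assumes M: "monomial_matrix M"
  obtains g where "g \<in> G" "\<And>x. to_word (x v* M) = act g (to_word x)"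
proof -
  obtain q where q: "bij q" "\<And>i j. M $ i $ j \<noteq> 0 \<longleftrightarrow> j = q i" using M monomial_matrix_iff_perm by blast
  define g where "g = ((\<lambda>i. if i < 18 then nx (q (ix i)) else i), restrict (\<lambda>i. M $ ix i $ q (ix i)) {..<18})"
  have f: "fst g i = (if i < 18 then nx (q (ix i)) else i)" for i by (simp add: g_def)
  have s: "snd g i = M $ ix i $ q (ix i)" if "i < 18" for i using that by (simp add: g_def)
  have "inj_on (fst g) {..<18}"
  proof (rule inj_onI)
    fix i j :: nat assume "i \<in> {..<18}" "j \<in> {..<18}" "fst g i = fst g j"
    then have l: "i < 18" "j < 18" "nx (q (ix i)) = nx (q (ix j))" by (auto simp: f)
    then have "q (ix i) = q (ix j)" by (metis ix_nx)
    then have "ix i = ix j" using q(1) by (simp add: bij_def inj_eq)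
    then show "i = j" using l by (metis nx_ix)
  qed
  moreover have "fst g ` {..<18} \<subseteq> {..<18}" by (auto simp: f)
  ultimately have "bij_betw (fst g) {..<18} {..<18}" by (simp add: bij_betw_def endo_inj_surj)
  then have "fst g permutes {..<18}" by (rule bij_imp_permutes) (simp add: f)
  moreover have "snd g i \<noteq> 0" if "i < 18" for i using q(2) s[OF that] by simp
  moreover have "snd g \<in> extensional {..<18}" by (simp add: g_def)
  ultimately have g: "g \<in> G" unfolding G_iff by blast
  have "to_word (x v* M) = act g (to_word x)" for x
  proof (rule act_eqI[OF g, symmetric])
    fix i :: nat assume i: "i < 18"
    have "to_word (x v* M) ! nx (q (ix i)) = (x v* M) $ q (ix i)" using nth_to_word[OF nx_less] by (simp only: ix_nx)
    then show "to_word (x v* M) ! fst g i = snd g i * to_word x ! i"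
      using i by (simp add: f s vector_monomial[OF M q(2)])
  qed simp
  then show ?thesis using g that by blast
qed

lemma matrix_of_act:
  assumes g: "g \<in> G"
  obtains M where "monomial_matrix M" "\<And>x. to_word (x v* M) = act g (to_word x)"
proof -
  have p: "fst g permutes {..<18}" and nz: "\<And>i. i < 18 \<Longrightarrow> snd g i \<noteq> 0" using g by (auto simp: G_iff)
  have pl: "fst g i < 18" if "i < 18" for i using permutes_in_image[OF p, of i] that by simp
  define q where "q i = ix (fst g (nx i))" for i
  define M where "M = (\<chi> i j. if j = q i then snd g (nx i) else 0)"
  have q: "M $ i $ j \<noteq> 0 \<longleftrightarrow> j = q i" for i j using nz[of "nx i"] by (simp add: M_def)
  have "inj q"
  proof (rule injI)
    fix i j assume "q i = q j"
    then have "fst g (nx i) = fst g (nx j)" unfolding q_def by (metis nx_ix pl nx_less)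
    then have "nx i = nx j" using permutes_inj[OF p] by (simp add: inj_eq)
    then show "i = j" by (metis ix_nx)
  qed
  then have "bij q" by (simp add: bij_def finite_UNIV_inj_surj)
  then have M: "monomial_matrix M" using q monomial_matrix_iff_perm by blast
  have "to_word (x v* M) = act g (to_word x)" for x
  proof (rule act_eqI[OF g, symmetric])
    fix i :: nat assume i: "i < 18"
    have "to_word (x v* M) ! fst g i = (x v* M) $ ix (fst g i)" using i pl by simp
    also have "ix (fst g i) = q (ix i)" using i by (simp add: q_def)
    also have "(x v* M) $ q (ix i) = M $ ix i $ q (ix i) * x $ ix i" by (rule vector_monomial[OF M q])
    finally show "to_word (x v* M) ! fst g i = snd g i * to_word x ! i" using i by (simp add: M_def)
  qed simp
  then show ?thesis using M that by blast
qed

lemma sq_mult_self: "a \<noteq> 0 \<Longrightarrow> (a :: gf4) * a ^ 2 = 1" by (simp add: gf4_cube)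

text \<open>The scalars enter as \<open>s * s^2 = 1\<close>.\<close>
lemma inner_monomial:
  fixes M :: "gf4 ^ 18 ^ 18"
  assumes M: "monomial_matrix M"
  shows "hermitian_inner (x v* M) (y v* M) = hermitian_inner x y"
proof -
  obtain g where g: "g \<in> G" and v: "\<And>x. to_word (x v* M) = act g (to_word x)" using act_of_matrix[OF M] by blast
  have p: "fst g permutes {..<18}" using g by (simp add: G_iff)
  have "hermitian_inner (x v* M) (y v* M) = (\<Sum>j<18. act g (to_word x) ! j * (act g (to_word y) ! j) ^ 2)"
    unfolding inner_to_word v ..
  also have "\<dots> = (\<Sum>i<18. act g (to_word x) ! fst g i * (act g (to_word y) ! fst g i) ^ 2)"
    by (rule sum.permute[OF p, unfolded o_def])
  also have "\<dots> = (\<Sum>i<18. to_word x ! i * (to_word y ! i) ^ 2)"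
  proof (intro sum.cong refl)
    fix i :: nat assume "i \<in> {..<18}"
    then have i: "i < 18" by simp
    have s: "snd g i * snd g i ^ 2 = 1" using g i by (simp add: G_iff sq_mult_self)
    have "act g (to_word x) ! fst g i * (act g (to_word y) ! fst g i) ^ 2 = (snd g i * snd g i ^ 2) * (to_word x ! i * (to_word y ! i) ^ 2)"
      unfolding act_nth[OF g i] power_mult_distrib by (simp only: ac_simps)
    then show "act g (to_word x) ! fst g i * (act g (to_word y) ! fst g i) ^ 2 = to_word x ! i * (to_word y ! i) ^ 2"
      by (simp only: s mult_1)
  qed
  finally show ?thesis unfolding inner_to_word .
qed

lemma weight_monomial: "monomial_matrix M \<Longrightarrow> weight ((x :: gf4 ^ 18) v* M) = weight x"
  by (metis act_of_matrix weight_to_word wt_act length_to_word)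

lemma weight_pos: "0 < weight x \<longleftrightarrow> x \<noteq> 0" for x :: "gf4 ^ 'n"
  by (auto simp: weight_def card_gt_0_iff vec_eq_iff)

lemma min_weight_alt: "min_weight C = (LEAST w. 0 < w \<and> w \<in> weight ` C)"
proof -
  have "(\<exists>c\<in>C. c \<noteq> 0 \<and> weight c = w) \<longleftrightarrow> 0 < w \<and> w \<in> weight ` C" for w
    unfolding weight_pos[symmetric] by auto
  then show ?thesis by (simp add: min_weight_def)
qed

lemma min_weight_equiv: "(C, D) \<in> code_equiv \<Longrightarrow> min_weight D = min_weight (C :: (gf4 ^ 18) set)"
  unfolding min_weight_alt code_equiv_def by (auto simp: image_image weight_monomial)

text \<open>Monomial matrices are unitary, since the nonzero scalars are cube roots of unity.\<close>
lemma self_dual_equiv: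
  assumes CD: "(C, D) \<in> code_equiv" and C: "hermitian_self_dual (C :: (gf4 ^ 18) set)"
  shows "hermitian_self_dual D"
proof -
  obtain M where D: "vec.subspace D" "D = (\<lambda>c. c v* M) ` C" and M: "monomial_matrix M"
    using CD by (auto simp: code_equiv_def)
  obtain N where "M ** N = mat 1" using monomial_matrix_inverse[OF M] by blast
  then have NM: "N ** M = mat 1" by (simp add: matrix_left_right_inverse)
  have "y \<in> D \<longleftrightarrow> y \<in> hermitian_dual D" for y
  proof -
    define x where "x = y v* N"
    have y: "y = x v* M" by (simp add: x_def vector_matrix_mul_assoc NM)
    have inj: "z = x" if "z v* M = x v* M" for z
    proof -
      have "(z v* M) v* N = (x v* M) v* N" using that by simp
      then show ?thesis by (simp add: vector_matrix_mul_assoc \<open>M ** N = mat 1\<close>)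
    qed
    have "y \<in> D \<longleftrightarrow> x \<in> C" unfolding D(2) y
    proof
      assume "x v* M \<in> (\<lambda>c. c v* M) ` C"
      then obtain z where "x v* M = z v* M" "z \<in> C" by (rule imageE)
      then show "x \<in> C" using inj[of z] by simp
    qed (rule imageI)
    also have "\<dots> \<longleftrightarrow> x \<in> hermitian_dual C" by (rule arg_cong[OF conjunct2[OF C[unfolded hermitian_self_dual_def]]])
    also have "\<dots> \<longleftrightarrow> y \<in> hermitian_dual D"
      unfolding D(2) y hermitian_dual_def by (simp only: mem_Collect_eq ball_simps inner_monomial[OF M])
    finally show ?thesis .
  qed
  then have "D = hermitian_dual D" by (rule set_eqI)
  with D(1) show ?thesis unfolding hermitian_self_dual_def by (rule conjI)
qed

lemma vcode_equivD:
  assumes "is_mat A" "is_mat B" "(vcode A, vcode B) \<in> code_equiv"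
  obtains g where "g \<in> G" "act g ` code A = code B"
proof -
  obtain M where M: "monomial_matrix M" "vcode B = (\<lambda>c. c v* M) ` vcode A"
    using assms(3) by (auto simp: code_equiv_def)
  obtain g where g: "g \<in> G" "\<And>x. to_word (x v* M) = act g (to_word x)" using act_of_matrix[OF M(1)] by blast
  have "code B = to_word ` vcode B" using to_word_vcode[OF assms(2)] by simp
  also have "\<dots> = act g ` to_word ` vcode A" unfolding M(2) by (simp add: image_image g(2))
  finally show ?thesis using to_word_vcode[OF assms(1)] g that by simp
qed

lemma orbit_equiv:
  assumes A: "is_mat A" and D: "D \<in> (\<lambda>g. act g ` code A) ` G"
  shows "D \<in> (`) to_word ` (code_equiv `` {vcode A})"
proof -
  obtain g where g: "g \<in> G" "D = act g ` code A" using D by blast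
  obtain M where M: "monomial_matrix M" "\<And>x. to_word (x v* M) = act g (to_word x)" using matrix_of_act[OF g(1)] by blast
  let ?E = "(\<lambda>c. c v* M) ` vcode A"
  have s: "vec.subspace (vcode A)" by (rule subspace_vcode[OF A])
  have "vec.subspace ?E" unfolding vec.subspace_def
  proof (intro conjI allI impI ballI)
    show "0 \<in> ?E" using vec.subspace_0[OF s] by (intro image_eqI[of _ _ 0]) simp_all
  next
    fix x y assume "x \<in> ?E" "y \<in> ?E"
    then obtain a b where "x = a v* M" "a \<in> vcode A" "y = b v* M" "b \<in> vcode A" by blast
    then show "x + y \<in> ?E"
      using vec.subspace_add[OF s] by (intro image_eqI[of _ _ "a + b"]) (simp_all add: vector_matrix_left_distrib)
  next
    fix c x assume "x \<in> ?E"
    then obtain a where "x = a v* M" "a \<in> vcode A" by blast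
    then show "c *s x \<in> ?E"
      using vec.subspace_scale[OF s] by (intro image_eqI[of _ _ "c *s a"]) (simp_all add: scalar_vector_matrix_assoc)
  qed
  then have "?E \<in> code_equiv `` {vcode A}" using s M(1) by (auto simp: code_equiv_def)
  moreover have "D = to_word ` ?E" unfolding g(2) to_word_vcode[OF A, symmetric] by (simp add: image_image M(2))
  ultimately show ?thesis by blast
qed

lemma good_is_mat: "good A \<Longrightarrow> is_mat A" using good_props(1) by (simp add: inv_mats_def)

text \<open>The equivalence class contains the orbit under the monomial group.\<close>
lemma class_size:
  assumes g: "good A" and h: "h \<ge> 1" and l: "length bads = 9"
    and m: "stabiliser_chain bads (reversed_rows 0 A) A (initial_state (light_words_of h A)) = ms"
  shows "fact 18 * 3 ^ 18 \<le> card (code_equiv `` {vcode A}) * (3 * prod_list ms)"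
proof -
  have A: "is_mat A" by (rule good_is_mat[OF g])
  have t: "card (Stab (code A) 9) \<le> 1" by (rule Stab_trivial[OF A good_props(3)[OF g]])
  have "card ((\<lambda>g. act g ` code A) ` G) \<le> card ((`) to_word ` (code_equiv `` {vcode A}))"
    by (intro card_mono) (use orbit_equiv[OF A] in auto)
  also have "\<dots> \<le> card (code_equiv `` {vcode A})" by (rule card_image_le) simp
  finally have c: "card ((\<lambda>g. act g ` code A) ` G) \<le> card (code_equiv `` {vcode A})" .
  have "fact 18 * 3 ^ 18 \<le> card ((\<lambda>g. act g ` code A) ` G) * (3 * prod_list ms)"
    unfolding m[symmetric] using code_length[OF A]
    by (intro card_orbit automorphism_bound[OF good_props(1)[OF g] h t l]) blast
  also have "\<dots> \<le> card (code_equiv `` {vcode A}) * (3 * prod_list ms)" by (rule mult_le_mono1[OF c])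
  finally show ?thesis .
qed

text \<open>The numbers of codewords of weight 2, 4, 6 and 8 up to scalars; for \<open>h = 2\<close> the last one is not computed and is 0.\<close>
definition weight_key :: "nat \<Rightarrow> word list \<Rightarrow> nat list" where "weight_key h A = lengths (fst (initial_state (light_words_of h A)))"

lemma weight_key_eq: "weight_key h A = map (\<lambda>n. length (of_weight n (light_words_of h A))) [2, 4, 6, 8]"
  by (simp add: weight_key_def initial_state_def lengths_map)

lemma set_wsel: "good A \<Longrightarrow> h \<ge> 1 \<Longrightarrow> n \<le> 2 * h + 2 \<Longrightarrow> set (of_weight n (light_words_of h A)) = {w \<in> code A. lead w = 1 \<and> wt w = n}"
  using words_spec(1)[OF good_props(1)] by (auto simp: of_weight_def light_words_of_def)

lemma length_wsel:
  assumes "good A" "h \<ge> 1" "n \<le> 2 * h + 2"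
  shows "length (of_weight n (light_words_of h A)) = card {w \<in> code A. lead w = 1 \<and> wt w = n}"
proof -
  have "distinct (of_weight n (light_words_of h A))"
    unfolding of_weight_def light_words_of_def by (intro distinct_filter words_spec(2)[OF good_props(1)[OF assms(1)] assms(2)])
  from distinct_card[OF this] show ?thesis unfolding set_wsel[OF assms] by simp
qed

text \<open>The correspondence between light words with which every search starts is in particular a bijection.\<close>
lemma weight_key_invariant:
  assumes g: "good A" "good B" and h: "h \<ge> 2" "h' \<ge> 2" and e: "(vcode A, vcode B) \<in> code_equiv"
  shows "take 3 (weight_key h A) = take 3 (weight_key h' B)"
proof -
  obtain g where G: "g \<in> G" "act g ` code A = code B"
    using vcode_equivD[OF good_is_mat good_is_mat e] g by blast
  have h1: "h \<ge> 1" "h' \<ge> 1" "(2 :: nat) \<ge> 1" using h by simp_all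
  interpret monomial "fst g" "snd g" by (rule G_monomial[OF G(1)])
  have "rels 0 [0..<18] (initial_state (light_words_of 2 A)) (initial_state (light_words_of 2 B))"
    by (rule initial_rels[OF good_props(1)[OF g(1)] good_props(1)[OF g(2)] h1(3) G])
  then have r: "list_all2 (relZ 0 [0..<18]) (fst (initial_state (light_words_of 2 A))) (fst (initial_state (light_words_of 2 B)))"
    by (simp only: rels_def)
  have rl: "length us = length vs" if rz: "relZ 0 [0..<18] us vs" for us vs
  proof -
    obtain f where "rel f 0 [0..<18] us vs" using rz unfolding relZ_def by blast
    then obtain cs where cs: "us = map (drop 0) cs" "mset vs = image_mset (\<lambda>c. proj [0..<18] (scl (f c) (T c))) (mset cs)"
      unfolding rel_def by blast
    show ?thesis using arg_cong[OF cs(2), of size] cs(1) by (simp del: upt_Suc upt_rec_numeral)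
  qed
  have "map length (fst (initial_state (light_words_of 2 A))) = map length (fst (initial_state (light_words_of 2 B)))"
    using r by (induction rule: list_all2_induct) (simp_all only: list.map rl)
  then have k: "weight_key 2 A = weight_key 2 B" by (simp only: weight_key_def lengths_map)
  have 2: "take 3 (weight_key k C) = take 3 (weight_key 2 C)" if "k \<ge> 2" "good C" for k C
  proof -
    have "length (of_weight n (light_words_of k C)) = length (of_weight n (light_words_of 2 C))" if "n \<le> 6" for n
      using length_wsel[OF \<open>good C\<close>, of k n] length_wsel[OF \<open>good C\<close>, of 2 n] that \<open>k \<ge> 2\<close> by simp
    from this[of 2] this[of 4] this[of 6] show ?thesis by (simp add: weight_key_eq)
  qed
  show ?thesis using 2[OF h(1) g(1)] 2[OF h(2) g(2)] k by simp
qed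

fun leading_zeros :: "nat list \<Rightarrow> nat" where
  "leading_zeros [] = 0" | "leading_zeros (x # xs) = (if x = 0 then Suc (leading_zeros xs) else 0)"

lemma leading_zeros_nth: "i < leading_zeros xs \<Longrightarrow> xs ! i = 0"
  by (induction xs arbitrary: i) (auto simp: nth_Cons split: nat.splits if_splits)

lemma weight_exists:
  assumes g: "good A" and h: "h \<ge> 1" and n: "n \<le> 2 * h + 2" "n > 0"
  shows "n \<in> weight ` vcode A \<longleftrightarrow> length (of_weight n (light_words_of h A)) > 0"
proof -
  have A: "is_mat A" by (rule good_is_mat[OF g])
  have "length (of_weight n (light_words_of h A)) > 0 \<longleftrightarrow> (\<exists>w\<in>code A. lead w = 1 \<and> wt w = n)"
  proof -
    have "length (of_weight n (light_words_of h A)) > 0 \<longleftrightarrow> set (of_weight n (light_words_of h A)) \<noteq> {}" by simp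
    then show ?thesis unfolding set_wsel[OF g h n(1)] by blast
  qed
  also have "\<dots> \<longleftrightarrow> (\<exists>w\<in>code A. wt w = n)"
  proof
    assume "\<exists>w\<in>code A. wt w = n"
    then obtain w where w: "w \<in> code A" "wt w = n" by blast
    then have l: "lead w \<noteq> 0" using n by (simp add: lead_eq_0)
    then have "lead (scl (inverse (lead w)) w) = 1 \<and> wt (scl (inverse (lead w)) w) = n"
      using w(2) by (simp add: lead_scl wt_scl)
    then show "\<exists>w\<in>code A. lead w = 1 \<and> wt w = n" using scl_code[OF A w(1)] by blast
  qed blast
  also have "\<dots> \<longleftrightarrow> n \<in> weight ` vcode A"
    unfolding to_word_vcode[OF A, symmetric] image_iff bex_simps weight_to_word by blast
  finally show ?thesis ..
qed

text \<open>All weights are even, and the key counts the words of weight \<open>2 i + 2\<close> at position \<open>i\<close>.\<close>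
lemma min_weight_vcode:
  assumes g: "good A" and h: "h \<ge> 1" and k: "weight_key h A = ks" and t: "leading_zeros ks = t" "t \<le> h" "t < 4" "ks ! t > 0"
  shows "min_weight (vcode A) = 2 * t + 2"
proof -
  have ks: "ks ! i = length (of_weight (2 * i + 2) (light_words_of h A))" if "i < 4" for i
  proof -
    have "i = 0 \<or> i = 1 \<or> i = 2 \<or> i = 3" using that by linarith
    then show ?thesis unfolding k[symmetric] weight_key_eq by (elim disjE) (simp_all add: numeral_eq_Suc)
  qed
  have sd: "vcode A \<subseteq> hermitian_dual (vcode A)" by (rule equalityD1[OF conjunct2[OF self_dual_vcode[OF g, unfolded hermitian_self_dual_def]]])
  show ?thesis unfolding min_weight_alt
  proof (rule Least_equality)
    show "0 < 2 * t + 2 \<and> 2 * t + 2 \<in> weight ` vcode A"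
    proof -
      have "length (of_weight (2 * t + 2) (light_words_of h A)) > 0" using t(4) unfolding ks[OF t(3)] .
      then show ?thesis using weight_exists[OF g h, of "2 * t + 2"] t(2) by simp
    qed
    fix w assume w: "0 < w \<and> w \<in> weight ` vcode A"
    then have "even w" using even_weight_of_self_orthogonal[OF sd] by blast
    then obtain v where v: "w = 2 * v" by blast
    define i where "i = v - 1"
    have "v \<ge> 1" using v w by simp
    then have i: "w = 2 * i + 2" unfolding v i_def by arith
    show "2 * t + 2 \<le> w"
    proof (rule ccontr)
      assume "\<not> 2 * t + 2 \<le> w"
      then have "i < t" using i by linarith
      then have "ks ! i = 0" using leading_zeros_nth[of i ks] t(1) by simp
      moreover have "i < 4" "w \<le> 2 * h + 2" using t i \<open>i < t\<close> by linarith+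
      ultimately have "length (of_weight w (light_words_of h A)) = 0" using ks[of i] unfolding i by simp
      then show False using weight_exists[OF g h \<open>w \<le> 2 * h + 2\<close>] w by simp
    qed
  qed
qed

lemma inequivalent_vcodes:
  assumes "good A" "good B" "h \<ge> 1" "\<not> may_be_equivalent A B (light_words_of h A) (light_words_of h B)"
  shows "(vcode A, vcode B) \<notin> code_equiv"
  using vcode_equivD[OF good_is_mat[OF assms(1)] good_is_mat[OF assms(2)]]
    inequivalentI[OF good_props(1)[OF assms(1)] good_props(1)[OF assms(2)] assms(3,4)] by blast

section \<open>Certificates and the counting argument\<close>

text \<open>A certified code: the matrix as a numeral, the candidates to be refuted at each of the nine levels of the stabiliser
chain, and the resulting orbit bounds. A family has the parameter \<open>h\<close> for the light words, the common weight
key, and the list of its codes.\<close>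
type_synonym entry = "int \<times> (nat \<times> gf4) list list \<times> nat list"
type_synonym family = "nat \<times> nat list \<times> entry list"

fun matrix_of :: "entry \<Rightarrow> word list" where "matrix_of (n, bads, ms) = chop 9 (decode n)"
text \<open>The light words of each code are computed once and shared by all searches.\<close>
fun prepare :: "nat \<Rightarrow> entry list \<Rightarrow> (word list \<times> word list) list"
  and prepare1 :: "nat \<Rightarrow> word list \<Rightarrow> entry list \<Rightarrow> (word list \<times> word list) list" where
  "prepare h [] = []" | "prepare h ((n, bads, ms) # es) = prepare1 h (chop 9 (decode n)) es"
| "prepare1 h A es = (A, words h A (conj_transpose 9 A)) # prepare h es"
fun valid1 :: "nat list \<Rightarrow> (nat \<times> gf4) list list \<Rightarrow> nat list \<Rightarrow> word list \<Rightarrow> state \<Rightarrow> bool" where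
  "valid1 key bads ms A (zs, ns) = (lengths zs = key \<and> length bads = 9 \<and> stabiliser_chain bads (reversed_rows 0 A) A (zs, ns) = ms)"
fun valid :: "nat list \<Rightarrow> entry list \<Rightarrow> (word list \<times> word list) list \<Rightarrow> bool" where
  "valid key es [] = True" | "valid key [] (p # ps) = True"
| "valid key ((n, bads, ms) # es) ((A, W) # ps) = (good A \<and> valid1 key bads ms A (initial_state W) \<and> valid key es ps)"
text \<open>The first code of a pair is the source of the search, whose cost can depend heavily on the direction.\<close>
fun new :: "word list \<Rightarrow> word list \<Rightarrow> (word list \<times> word list) list \<Rightarrow> bool" where
  "new A W [] = True" | "new A W ((B, V) # ps) = (\<not> may_be_equivalent A B W V \<and> new A W ps)"
fun all_new :: "(word list \<times> word list) list \<Rightarrow> bool" where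
  "all_new [] = True" | "all_new ((A, W) # ps) = (new A W ps \<and> all_new ps)"
definition check1 :: "nat list \<Rightarrow> entry list \<Rightarrow> (word list \<times> word list) list \<Rightarrow> bool" where
  "check1 key es ps = (valid key es ps \<and> all_new ps)"
fun check :: "family \<Rightarrow> bool" where "check (h, key, es) = check1 key es (prepare h es)"
fun checks :: "family list \<Rightarrow> bool" where "checks [] = True" | "checks (f # fs) = (check f \<and> checks fs)"
declare prepare.simps [exec] prepare1.simps [exec] valid1.simps [exec] valid.simps [exec] new.simps [exec] all_new.simps [exec]
  check1_def [exec] check.simps [exec] checks.simps [exec] may_be_equivalent_def [exec] good_def [exec] row_products.simps [exec] unit_rows.simps [exec]

lemma prepare_eq: "prepare h es = map (\<lambda>e. (matrix_of e, light_words_of h (matrix_of e))) es"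
  by (induction es) (auto simp: light_words_of_def simp del: words.simps)

fun sound :: "nat \<Rightarrow> nat list \<Rightarrow> entry \<Rightarrow> bool" where
  "sound h key (n, bads, ms) \<longleftrightarrow> good (matrix_of (n, bads, ms)) \<and> weight_key h (matrix_of (n, bads, ms)) = key \<and> length bads = 9 \<and>
     stabiliser_chain bads (reversed_rows 0 (matrix_of (n, bads, ms))) (matrix_of (n, bads, ms)) (initial_state (light_words_of h (matrix_of (n, bads, ms)))) = ms"

lemma valid_sound: "valid key es (map (\<lambda>e. (matrix_of e, light_words_of h (matrix_of e))) es) \<Longrightarrow> e \<in> set es \<Longrightarrow> sound h key e"
proof (induction es)
  case (Cons d es)
  obtain n bads ms where d: "d = (n, bads, ms)" by (cases d)
  obtain zs ns where z: "initial_state (light_words_of h (matrix_of d)) = (zs, ns)" by (cases "initial_state (light_words_of h (matrix_of d))")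
  have "sound h key d" using Cons.prems(1) z unfolding d by (simp add: weight_key_def del: matrix_of.simps)
  moreover have "valid key es (map (\<lambda>e. (matrix_of e, light_words_of h (matrix_of e))) es)" using Cons.prems(1) unfolding d by simp
  ultimately show ?case using Cons by auto
qed simp

lemma new_eq: "new A W ps \<longleftrightarrow> (\<forall>(B, V)\<in>set ps. \<not> may_be_equivalent A B W V)"
  by (induction ps) auto

lemma check_family:
  assumes c: "check (h, key, es)" and h: "h \<ge> 1"
  shows "\<And>e. e \<in> set es \<Longrightarrow> sound h key e"
    and "sorted_wrt (\<lambda>A B. (vcode A, vcode B) \<notin> code_equiv) (map matrix_of es)"
proof -
  have v: "valid key es (map (\<lambda>e. (matrix_of e, light_words_of h (matrix_of e))) es)"
    and a: "all_new (map (\<lambda>e. (matrix_of e, light_words_of h (matrix_of e))) es)"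
    using c by (simp_all add: check1_def prepare_eq)
  show s: "\<And>e. e \<in> set es \<Longrightarrow> sound h key e" by (rule valid_sound[OF v])
  have gd: "good (matrix_of e)" if "e \<in> set es" for e
  proof -
    obtain n bads ms where "e = (n, bads, ms)" by (cases e)
    then show ?thesis using s[OF that] by (simp del: matrix_of.simps)
  qed
  show "sorted_wrt (\<lambda>A B. (vcode A, vcode B) \<notin> code_equiv) (map matrix_of es)" using a gd
  proof (induction es)
    case (Cons d es)
    have "(vcode (matrix_of d), vcode (matrix_of e)) \<notin> code_equiv" if "e \<in> set es" for e
      using that Cons.prems by (intro inequivalent_vcodes[OF _ _ h]) (auto simp: new_eq)
    then show ?case using Cons by simp
  qed simp
qed

definition matrices :: "family list \<Rightarrow> word list list" where
  "matrices fs = concat (map (\<lambda>(h, key, es). map matrix_of es) fs)"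
definition class_sizes :: "family list \<Rightarrow> nat list" where
  "class_sizes fs = concat (map (\<lambda>(h, key, es). map (\<lambda>(n, bads, ms). fact 18 * 3 ^ 18 div (3 * prod_list ms)) es) fs)"
definition weights :: "family list \<Rightarrow> nat list" where
  "weights fs = concat (map (\<lambda>(h, key, es). map (\<lambda>_. 2 * leading_zeros key + 2) es) fs)"
text \<open>The minimum weight is at most \<open>2 h + 2\<close>, so that the key shows it; \<open>2 \<le> h\<close> makes the keys of
different families comparable.\<close>
definition proper :: "family \<Rightarrow> bool" where
  "proper = (\<lambda>(h, key, es). 2 \<le> h \<and> leading_zeros key \<le> h \<and> leading_zeros key < 4 \<and> 0 < key ! leading_zeros key)"

lemma checks_iff: "checks fs \<longleftrightarrow> (\<forall>f\<in>set fs. check f)" by (induction fs) auto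

text \<open>Codes of the same family are separated by search, codes of different families by the first three entries of the key.\<close>
lemma matrices_inequivalent:
  assumes "checks fs" "list_all proper fs" "distinct (map (\<lambda>(h, key, es). take 3 key) fs)"
  shows "sorted_wrt (\<lambda>A B. (vcode A, vcode B) \<notin> code_equiv) (matrices fs)"
  using assms
proof (induction fs)
  case (Cons f fs)
  obtain h key es where f: "f = (h, key, es)" by (cases f)
  have c: "check (h, key, es)" "h \<ge> 2" using Cons.prems by (auto simp: f proper_def)
  have "(vcode (matrix_of e), vcode (matrix_of e')) \<notin> code_equiv"
    if m: "e \<in> set es" "(h', key', es') \<in> set fs" "e' \<in> set es'" for e e' h' key' es'
  proof
    assume q: "(vcode (matrix_of e), vcode (matrix_of e')) \<in> code_equiv"
    have c': "check (h', key', es')" "h' \<ge> 2" using Cons.prems m(2) by (auto simp: checks_iff list_all_iff proper_def)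
    have "h \<ge> 1" "h' \<ge> 1" using c c' by simp_all
    from check_family(1)[OF c(1) this(1) m(1)] check_family(1)[OF c'(1) this(2) m(3)]
    have s: "sound h key e" "sound h' key' e'" .
    have s': "good (matrix_of e) \<and> weight_key h (matrix_of e) = key" if "sound h key e" for h key e
      using that by (cases e) (simp del: matrix_of.simps)
    have "take 3 key = take 3 key'" using weight_key_invariant[OF _ _ c(2) c'(2) q] s'[OF s(1)] s'[OF s(2)] by simp
    moreover have "take 3 key \<notin> (\<lambda>(h, key, es). take 3 key) ` set fs" using Cons.prems(3) by (simp add: f)
    ultimately show False using m(2) by force
  qed
  then have "\<forall>A\<in>set (map matrix_of es). \<forall>B\<in>set (matrices fs). (vcode A, vcode B) \<notin> code_equiv"
    unfolding matrices_def by fastforce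
  moreover have "sorted_wrt (\<lambda>A B. (vcode A, vcode B) \<notin> code_equiv) (map matrix_of es)"
    using check_family(2)[OF c(1)] c(2) by simp
  moreover have "sorted_wrt (\<lambda>A B. (vcode A, vcode B) \<notin> code_equiv) (matrices fs)" using Cons by simp
  moreover have "matrices (f # fs) = map matrix_of es @ matrices fs" by (simp add: matrices_def f)
  ultimately show ?case by (simp add: sorted_wrt_append)
qed (simp add: matrices_def)

lemma matrices_properties:
  assumes "checks fs" "list_all proper fs"
  shows "list_all2 (\<lambda>A n. good A \<and> n \<le> card (code_equiv `` {vcode A})) (matrices fs) (class_sizes fs)"
    and "map (\<lambda>A. min_weight (vcode A)) (matrices fs) = weights fs"
proof -
  have *: "good (matrix_of e)" "fact 18 * 3 ^ 18 div (3 * prod_list (snd (snd e))) \<le> card (code_equiv `` {vcode (matrix_of e)})"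
    "min_weight (vcode (matrix_of e)) = 2 * leading_zeros key + 2"
    if m: "(h, key, es) \<in> set fs" "e \<in> set es" for h key es e
  proof -
    have c: "check (h, key, es)" "proper (h, key, es)" using assms m(1) by (auto simp: checks_iff list_all_iff)
    then have h: "h \<ge> 1" by (simp add: proper_def)
    obtain n bads ms where e: "e = (n, bads, ms)" by (cases e)
    have s: "good (matrix_of e)" "weight_key h (matrix_of e) = key" "length bads = 9"
      "stabiliser_chain bads (reversed_rows 0 (matrix_of e)) (matrix_of e) (initial_state (light_words_of h (matrix_of e))) = ms"
      using check_family(1)[OF c(1) h m(2)] unfolding e by (simp_all del: matrix_of.simps)
    show "good (matrix_of e)" by (rule s(1))
    have "fact 18 * 3 ^ 18 \<le> card (code_equiv `` {vcode (matrix_of e)}) * (3 * prod_list ms)"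
      by (rule class_size[OF s(1) h s(3,4)])
    from div_le_mono[OF this, of "3 * prod_list ms"]
    show "fact 18 * 3 ^ 18 div (3 * prod_list (snd (snd e))) \<le> card (code_equiv `` {vcode (matrix_of e)})"
      unfolding e snd_conv by (rule order.trans) (cases "3 * prod_list ms = 0"; simp only: div_by_0 nonzero_mult_div_cancel_right le0 order.refl not_False_eq_True)
    show "min_weight (vcode (matrix_of e)) = 2 * leading_zeros key + 2"
      using min_weight_vcode[OF s(1) h s(2)] c(2) by (simp add: proper_def)
  qed
  show "list_all2 (\<lambda>A n. good A \<and> n \<le> card (code_equiv `` {vcode A})) (matrices fs) (class_sizes fs)" using *(1,2)
  proof (induction fs)
    case (Cons f fs)
    obtain h key es where f: "f = (h, key, es)" by (cases f)
    have "list_all2 (\<lambda>A n. good A \<and> n \<le> card (code_equiv `` {vcode A})) (map matrix_of es)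
        (map (\<lambda>(n, bads, ms). fact 18 * 3 ^ 18 div (3 * prod_list ms)) es)"
      unfolding list_all2_map1 list_all2_map2 list_all2_same
      using Cons.prems[of h key es] unfolding f by (auto simp del: matrix_of.simps)
    moreover have "list_all2 (\<lambda>A n. good A \<and> n \<le> card (code_equiv `` {vcode A})) (matrices fs) (class_sizes fs)"
      by (rule Cons.IH) (use Cons.prems in \<open>meson list.set_intros(2)\<close>)+
    ultimately show ?case by (simp add: matrices_def class_sizes_def f list_all2_appendI del: matrix_of.simps)
  qed (simp add: matrices_def class_sizes_def)
  show "map (\<lambda>A. min_weight (vcode A)) (matrices fs) = weights fs" using *(3)
  proof (induction fs)
    case (Cons f fs)
    obtain h key es where f: "f = (h, key, es)" by (cases f)
    have "map (\<lambda>e. min_weight (vcode (matrix_of e))) es = map (\<lambda>_. 2 * leading_zeros key + 2) es"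
      by (rule map_cong[OF refl]) (use Cons.prems[of h key es] f in simp)
    moreover have "map (\<lambda>A. min_weight (vcode A)) (matrices fs) = weights fs"
      by (rule Cons.IH) (use Cons.prems in \<open>meson list.set_intros(2)\<close>)
    ultimately show ?case by (simp add: matrices_def weights_def f o_def)
  qed (simp add: matrices_def weights_def)
qed

text \<open>The classes of the \<open>xs\<close> are disjoint subsets of \<open>S\<close> with total size at least \<open>sum_list ns\<close>, hence they cover \<open>S\<close>.\<close>
lemma count_classes:
  assumes R: "equiv V R" and S: "finite S" "S \<subseteq> V" and closed: "\<And>x y. (x, y) \<in> R \<Longrightarrow> x \<in> S \<Longrightarrow> y \<in> S"
    and xs: "set xs \<subseteq> S" "sorted_wrt (\<lambda>x y. (x, y) \<notin> R) xs"
    and ns: "list_all2 (\<lambda>x n. n \<le> card (R `` {x})) xs ns" "card S \<le> sum_list ns"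
    and P: "\<And>x y. (x, y) \<in> R \<Longrightarrow> P x \<longleftrightarrow> P y"
  shows "card ({x \<in> S. P x} // R) = length (filter P xs)"
proof -
  have cls: "R `` {x} \<subseteq> S" if "x \<in> S" for x using closed that by blast
  have le: "sum_list ns \<le> card (\<Union>x\<in>set xs. R `` {x})" using ns(1) xs
  proof (induction rule: list_all2_induct)
    case (Cons x xs n ns)
    have d: "R `` {x} \<inter> (\<Union>y\<in>set xs. R `` {y}) = {}"
    proof (rule ccontr)
      assume "\<not> ?thesis"
      then obtain y z where "y \<in> set xs" "(x, z) \<in> R" "(y, z) \<in> R" by blast
      moreover from this have "(x, y) \<in> R" using R unfolding equiv_def by (meson symD transD)
      ultimately show False using Cons.prems(2) by simp
    qed
    have f: "finite (R `` {x})" "finite (\<Union>y\<in>set xs. R `` {y})"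
      using Cons.prems(1) cls finite_subset[OF _ S(1)] by auto
    have "sum_list ns \<le> card (\<Union>y\<in>set xs. R `` {y})" using Cons by simp
    then have "n + sum_list ns \<le> card (R `` {x} \<union> (\<Union>y\<in>set xs. R `` {y}))"
      using Cons.hyps(1) by (simp add: card_Un_disjoint[OF f d] add_mono)
    then show ?case by simp
  qed simp
  have sub: "(\<Union>x\<in>set xs. R `` {x}) \<subseteq> S" using cls xs(1) by blast
  have "(\<Union>x\<in>set xs. R `` {x}) = S" by (rule card_seteq[OF S(1) sub order.trans[OF ns(2) le]])
  then have cover: "\<exists>x\<in>set xs. (x, y) \<in> R" if "y \<in> S" for y using that by blast
  have "{x \<in> S. P x} // R = (\<lambda>x. R `` {x}) ` set (filter P xs)"
  proof (intro set_eqI iffI)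
    fix D assume "D \<in> {x \<in> S. P x} // R"
    then obtain y where y: "y \<in> S" "P y" "D = R `` {y}" by (auto elim: quotientE)
    obtain x where x: "x \<in> set xs" "(x, y) \<in> R" using cover[OF y(1)] by blast
    have "D = R `` {x}" unfolding y(3) using equiv_class_eq[OF R x(2)] by simp
    then show "D \<in> (\<lambda>x. R `` {x}) ` set (filter P xs)" using x y P by auto
  next
    fix D assume "D \<in> (\<lambda>x. R `` {x}) ` set (filter P xs)"
    then show "D \<in> {x \<in> S. P x} // R" using xs(1) by (auto intro: quotientI)
  qed
  moreover have "distinct (map (\<lambda>x. R `` {x}) (filter P xs))"
    using xs
  proof (induction xs)
    case (Cons x xs)
    have "R `` {x} \<noteq> R `` {y}" if "y \<in> set xs" for y
    proof
      assume "R `` {x} = R `` {y}"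
      moreover have "x \<in> V" "y \<in> V" using Cons.prems(1) S(2) that by auto
      ultimately have "(x, y) \<in> R" using eq_equiv_class_iff[OF R] by blast
      then show False using Cons.prems(2) that by simp
    qed
    then show ?case using Cons by auto
  qed simp
  ultimately show ?thesis using distinct_card[of "map (\<lambda>x. R `` {x}) (filter P xs)"] by simp
qed

text \<open>Since the orbits reach the bound for the number of all self-dual codes, no class is missing from the list, and the
classes of a given minimum weight can be counted in the list.\<close>
theorem classification:
  assumes fs: "checks fs" "list_all proper fs" "distinct (map (\<lambda>(h, key, es). take 3 key) fs)"
    and T: "sum_list (class_sizes fs) = 3 * 9 * 33 * 129 * 513 * 2049 * 8193 * 32769 * 131073"
  shows "num_inequivalent {C :: (gf4 ^ 18) set. hermitian_self_dual C \<and> Q (min_weight C)} = length (filter Q (weights fs))"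
proof -
  let ?S = "{C :: (gf4 ^ 18) set. hermitian_self_dual C}"
  note props = matrices_properties[OF fs(1,2)]
  have good: "good A" if "A \<in> set (matrices fs)" for A
    using props(1) that by (auto simp: list_all2_conv_all_nth in_set_conv_nth)
  have "card ({C \<in> ?S. Q (min_weight C)} // code_equiv) = length (filter (\<lambda>C. Q (min_weight C)) (map vcode (matrices fs)))"
  proof (rule count_classes[OF equiv_code_equiv])
    show "finite ?S" by simp
    show "?S \<subseteq> {C. vec.subspace C}" by (auto simp: hermitian_self_dual_def)
    show "y \<in> ?S" if "(x, y) \<in> code_equiv" "x \<in> ?S" for x y using self_dual_equiv[OF that(1)] that(2) by simp
    show "set (map vcode (matrices fs)) \<subseteq> ?S" using self_dual_vcode good by auto
    show "sorted_wrt (\<lambda>x y. (x, y) \<notin> code_equiv) (map vcode (matrices fs))"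
      using matrices_inequivalent[OF fs] by (simp add: sorted_wrt_map)
    show "list_all2 (\<lambda>x n. n \<le> card (code_equiv `` {x})) (map vcode (matrices fs)) (class_sizes fs)"
      unfolding list_all2_map1 by (rule list_all2_mono[OF props(1)]) blast
    show "card ?S \<le> sum_list (class_sizes fs)" unfolding T by (rule self_dual_codes_bound_18)
    show "Q (min_weight x) \<longleftrightarrow> Q (min_weight y)" if "(x, y) \<in> code_equiv" for x y :: "(gf4 ^ 18) set"
      using min_weight_equiv[OF that] by simp
  qed
  also have "\<dots> = length (filter Q (weights fs))" unfolding props(2)[symmetric] by (simp add: filter_map o_def)
  finally show ?thesis by (simp add: num_inequivalent_def)
qed

section \<open>The certificates of the 245 codes\<close>

text \<open>The families are in lexicographically decreasing order of their keys. Fifteen codes are not equivalent to their conjugates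
under the Frobenius automorphism, and their conjugates are listed as well. The last family is the extremal code.\<close>
definition families_1 :: "family list" where
 "families_1 = [
 (2, [9, 108, 756, 0],
  [(6211387533842969342099639657269447176716260737280,
    [[], [], [], [], [], [], [], [], []], [18, 48, 42, 36, 30, 24, 18, 12, 6])])]"

definition families_2 :: "family list" where
 "families_2 = [
 (2, [6, 60, 456, 0],
  [(6583185557792560394443015110112714623910083035140,
    [[], [], [], [], [], [], [], [], []], [12, 30, 18, 24, 18, 15, 12, 6, 4])]),
 (2, [5, 44, 356, 0],
  [(6588535079716795242904327888291749715275256168449,
    [[], [], [], [], [], [], [], [], []], [10, 24, 24, 18, 7, 12, 6, 6, 4])])]"

definition families_3 :: "family list" where
 "families_3 = [
 (2, [4, 28, 256, 0],
  [(5937353379808151515959735838625086672713294597152,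
    [[], [], [], [], [], [], [], [], []], [10, 8, 24, 6, 18, 1, 12, 4, 6]),
   (8780804265408034893471065654880171261464634458113,
    [[], [], [], [], [], [], [], [], []], [8, 30, 18, 15, 12, 6, 12, 1, 4])])]"

definition families_4 :: "family list" where
 "families_4 = [
 (2, [3, 39, 291, 0],
  [(5961261047578507510578258351649793868452742841100,
    [[], [], [], [], [], [], [], [], []], [12, 18, 18, 15, 12, 6, 15, 4, 4])]),
 (2, [3, 24, 216, 0],
  [(8677667801048632537497395843321441617406210384128,
    [[], [], [], [], [], [], [], [], []], [12, 18, 10, 12, 6, 8, 1, 6, 4])]),
 (2, [3, 21, 201, 0],
  [(5851454211796928236021268544674868428725569105920,
    [[(5, One4), (8, One4), (10, One4), (11, One4), (12, One4)], [], [], [], [], [], [], [], []], [7, 6, 18, 12, 6, 15, 4, 1, 4])]),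
 (2, [3, 15, 171, 0],
  [(7410285051531330337842100487381815965579895230499,
    [[], [], [], [], [], [], [], [], []], [12, 4, 18, 12, 6, 1, 6, 1, 4])]),
 (2, [3, 12, 156, 0],
  [(5944134089568092968277312294543469984961218273760,
    [[], [], [], [], [], [], [], [], []], [12, 18, 12, 24, 6, 3, 1, 1, 4])]),
 (2, [2, 32, 236, 0],
  [(6588270480230669089484142743798542213013429158032,
    [[], [], [], [], [], [], [], [], []], [8, 18, 12, 7, 15, 6, 6, 4, 4])]),
 (2, [2, 24, 196, 0],
  [(8420765639145749661345920675984147242208133942784,
    [[], [], [], [], [], [], [], [], []], [14, 12, 12, 6, 10, 1, 8, 6, 4])]),
 (2, [2, 17, 161, 0],
  [(8472148140686681117394488047025232211218924590337,
    [[], [], [], [], [], [], [], [], []], [14, 12, 6, 6, 4, 7, 1, 6, 4])]),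
 (2, [2, 14, 146, 0],
  [(10605182061954182778686348840206552701189792989648,
    [[], [], [], [], [], [], [], [], []], [8, 12, 15, 6, 6, 4, 4, 1, 1]),
   (6123076253820715476413253067712205404956287598036,
    [[], [], [], [], [], [], [], [], []], [10, 12, 1, 15, 12, 6, 12, 1, 4])]),
 (2, [2, 12, 136, 0],
  [(7690027027154621073787765153774614330992125030594,
    [[], [], [], [], [], [], [], [], []], [8, 6, 1, 12, 6, 4, 6, 1, 4])]),
 (2, [2, 9, 121, 0],
  [(11417004513090727249287398842371696345725777936828,
    [[], [], [], [], [], [], [], [], []], [12, 12, 6, 4, 1, 6, 1, 4, 1])]),
 (2, [2, 8, 116, 0],
  [(6485773852487305243463208732768615959068415889828,
    [[], [], [], [], [], [], [], [], []], [8, 3, 4, 12, 1, 6, 6, 1, 4])]),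
 (2, [2, 6, 106, 0],
  [(7342301743576643700331896613530132348666241928196,
    [[], [], [], [], [], [], [], [], []], [12, 12, 8, 6, 4, 1, 1, 1, 1])]),
 (2, [2, 5, 101, 0],
  [(9066084762764977864831545903865007327714198955051,
    [[], [], [], [], [], [], [], [], []], [8, 12, 3, 1, 12, 2, 6, 1, 1])]),
 (2, [2, 3, 91, 0],
  [(7932707629399074366634622612711318793036002796611,
    [[], [], [], [], [], [], [], [], []], [14, 13, 12, 6, 6, 1, 1, 1, 1])]),
 (2, [1, 28, 196, 0],
  [(10596601387396331241557030064972924534621454270640,
    [[], [], [], [], [], [], [], [], []], [16, 24, 7, 7, 6, 6, 6, 4, 4]),
   (8677671220167795797821397104884838007854202900496,
    [[], [], [], [], [], [], [], [], []], [16, 14, 12, 10, 1, 8, 6, 6, 4])])]"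

definition families_5 :: "family list" where
 "families_5 = [
 (2, [1, 25, 181, 0],
  [(5937361748075069473386733242860254802070920249535,
    [[], [], [], [], [], [], [], [], []], [10, 1, 8, 6, 18, 4, 15, 4, 6]),
   (9568268548234480592610088919173435099229121648648,
    [[], [], [], [], [], [], [], [], []], [10, 18, 15, 12, 1, 15, 4, 6, 4])])]"

definition families_6 :: "family list" where
 "families_6 = [
 (2, [1, 15, 131, 0],
  [(7684316839967543963992329935383621370153578729824,
    [[], [], [], [], [], [], [], [], []], [1, 6, 10, 15, 8, 4, 6, 1, 4])]),
 (2, [1, 13, 121, 0],
  [(6211383072124108779649117163918679692516233452794,
    [[], [], [], [], [], [], [], [], []], [4, 21, 15, 1, 6, 1, 4, 4, 6]),
   (10257635760836374285904256285918963584871657640208,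
    [[], [], [], [], [], [], [], [], []], [10, 8, 6, 6, 4, 1, 6, 1, 4]),
   (7050618673413755474897217253787962247290001852016,
    [[], [], [], [], [], [], [], [], []], [10, 15, 12, 6, 4, 1, 6, 1, 4]),
   (8448325608985293918181134265825573193829673390848,
    [[], [], [], [], [], [], [], [], []], [7, 6, 6, 8, 6, 4, 1, 4, 1])]),
 (2, [1, 12, 116, 0],
  [(10528138407450259744945745620723619550205580424418,
    [[], [], [], [], [], [], [], [], []], [16, 6, 6, 8, 6, 4, 1, 4, 1])]),
 (2, [1, 9, 101, 0],
  [(6896911314074101154399543584900759138635251531020,
    [[], [], [], [], [], [], [], [], []], [8, 6, 6, 4, 1, 6, 4, 1, 1]),
   (7314305735299442291184744293105030941885583633844,
    [[], [], [], [], [], [], [], [], []], [5, 6, 3, 4, 4, 1, 1, 6, 4])]),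
 (2, [1, 8, 96, 0],
  [(5918092508517696198029226555524879015512849713216,
    [[], [], [], [], [], [], [], [], []], [8, 24, 6, 6, 1, 1, 4, 1, 4])]),
 (2, [1, 7, 91, 0],
  [(7830156065290596110277444209417607234239477303932,
    [[], [], [], [], [], [], [], [], []], [8, 15, 6, 3, 3, 4, 4, 1, 1]),
   (7036074678723721336202328875916611437685169262753,
    [[], [], [], [], [], [], [], [], []], [12, 1, 6, 4, 1, 6, 4, 4, 1]),
   (5930225758657816398912662448583136507056655304169,
    [[], [], [], [], [], [], [], [], []], [12, 6, 1, 4, 4, 6, 1, 1, 4])]),
 (2, [1, 6, 86, 0],
  [(10476069401318593396996892454025947120154685062353,
    [[], [], [], [], [], [], [], [], []], [12, 6, 4, 6, 1, 4, 1, 1, 1])]),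
 (2, [1, 5, 81, 0],
  [(11631731435642881438376866582754807714403957566276,
    [[], [], [], [], [], [], [], [], []], [8, 3, 6, 1, 6, 4, 4, 1, 1]),
   (8944305014714308279398481856309665957526798074899,
    [[], [], [], [], [], [], [], [], []], [6, 6, 1, 4, 1, 4, 4, 1, 1]),
   (6085945713321725689804185597848134859839043059966,
    [[], [], [], [], [], [], [], [], []], [8, 6, 1, 1, 6, 4, 4, 1, 1])])]"

definition families_7 :: "family list" where
 "families_7 = [
 (2, [1, 4, 76, 0],
  [(5863144421599486070491050105969666189318970218670,
    [[], [], [], [], [], [], [], [], []], [6, 4, 12, 2, 1, 1, 1, 1, 6]),
   (5848237320747540956097030302862692680230767102158,
    [[], [], [], [], [], [], [], [], []], [16, 1, 2, 12, 4, 1, 1, 6, 4]),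
   (8860418035207285954127072494598577806283219809331,
    [[], [], [], [], [], [], [], [], [(0, Omega), (0, Omega_bar), (1, One4), (1, Omega_bar), (7, Omega), (7, Omega_bar), (9, One4), (9, Omega_bar)]], [16, 24, 12, 3, 6, 1, 1, 1, 4])]),
 (2, [1, 3, 71, 0],
  [(6269951702897256435117275312901701933407017544708,
    [[(4, One4), (16, One4)], [], [], [], [], [], [], [], []], [2, 4, 4, 6, 1, 4, 1, 1, 1]),
   (6211398787687247708320393675247791346601694661140,
    [[(5, One4)], [], [], [], [], [], [], [], []], [3, 8, 1, 1, 4, 1, 1, 4, 6]),
   (6414408804592670306567845258190924518761002382288,
    [[], [], [], [], [], [], [], [], []], [12, 4, 6, 1, 4, 1, 1, 4, 1])]),
 (2, [1, 2, 66, 0],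
  [(10974822685799477758844267201155858946932506545496,
    [[], [], [], [], [], [], [], [], []], [8, 4, 6, 3, 1, 1, 1, 1, 1]),
   (8158150360585942685759356643799041288729735007052,
    [[], [], [], [], [], [], [], [], []], [8, 2, 4, 6, 1, 1, 1, 1, 1])]),
 (2, [1, 1, 61, 0],
  [(7903211881864105376802322648416469542014689629724,
    [[], [], [], [], [], [], [], [], []], [4, 3, 6, 2, 6, 1, 1, 1, 1]),
   (10617168802061727364949702165679187561998219740160,
    [[], [], [], [], [], [], [], [], []], [2, 12, 2, 1, 6, 1, 1, 1, 1])]),
 (2, [1, 0, 56, 0],
  [(9746496962016717262115688308955769620189686583585,
    [[], [], [], [], [], [], [], [], []], [16, 5, 4, 6, 3, 1, 1, 1, 1]),
   (7244991592500190873821209924583721545572631795910,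
    [[(1, One4), (3, One4), (5, One4), (6, One4), (7, One4), (8, One4), (15, One4), (16, One4)], [], [], [], [], [], [], [], []], [8, 3, 6, 2, 1, 1, 1, 1, 1]),
   (6389074312799510624402176574358035834716912076346,
    [[(1, One4), (2, One4), (3, One4), (5, One4), (6, One4), (8, One4), (13, One4), (14, One4)], [], [], [], [], [], [], [], []], [8, 7, 6, 1, 1, 1, 1, 6, 1]),
   (6187488980553502406330777971914820016742995634611,
    [[(5, One4), (7, One4), (8, One4), (12, One4), (14, One4), (15, One4)], [], [], [], [], [], [], [], []], [10, 1, 12, 6, 1, 1, 1, 1, 1])]),
 (2, [0, 45, 18, 0],
  [(6862207081222787969978733506834192897702694355024,
    [[], [], [], [], [], [], [], [], []], [18, 36, 15, 18, 15, 15, 4, 4, 4])])]"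

definition families_8 :: "family list" where
 "families_8 = [
 (2, [0, 36, 168, 0],
  [(8871777516237711064559192746871557608394643816704,
    [[], [], [], [], [], [], [], [], []], [18, 16, 14, 12, 10, 8, 1, 6, 4])]),
 (2, [0, 30, 78, 0],
  [(8794711588314560770130792659399818216391644872784,
    [[], [], [], [], [], [], [], [], []], [12, 18, 10, 15, 8, 4, 6, 1, 4])]),
 (2, [0, 27, 90, 0],
  [(8928864385159088955506799163379401690362443743425,
    [[(5, One4), (6, One4), (7, One4), (11, One4), (13, One4)], [], [], [], [], [], [], [], []], [7, 6, 18, 15, 4, 15, 4, 1, 4])])]"

definition families_9 :: "family list" where
 "families_9 = [
 (2, [0, 24, 156, 0],
  [(6943654872616492191934835817968053088507690026273,
    [[], [], [], [], [], [], [], [], []], [10, 12, 24, 15, 1, 7, 6, 4, 4]),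
   (5913091595624686948550921143399974744507546649536,
    [[], [], [], [], [], [], [], [], []], [10, 24, 7, 8, 6, 6, 4, 1, 4])])]"

definition families_10 :: "family list" where
 "families_10 = [
 (2, [0, 21, 114, 0],
  [(6131635104635879441147006267671337742152786523532,
    [[], [], [], [], [], [], [], [], []], [12, 18, 15, 4, 1, 4, 1, 6, 4])]),
 (2, [0, 20, 100, 0],
  [(6260143368197459731041812651529062157898057842703,
    [[], [], [], [], [], [], [], [], []], [12, 10, 8, 15, 6, 4, 4, 1, 1])]),
 (2, [0, 18, 126, 0],
  [(6512710754800961000836211544662509251097185251716,
    [[], [], [], [], [], [], [], [], []], [12, 18, 24, 15, 3, 4, 1, 4, 1])]),
 (2, [0, 18, 114, 0],
  [(8699093563188028229408688877066645985405520847376,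
    [[], [], [], [], [], [], [], [], []], [12, 10, 8, 6, 1, 6, 4, 4, 1])]),
 (2, [0, 17, 85, 0],
  [(6817263240180015172093519224454095123475276566544,
    [[(2, One4), (3, One4), (6, One4), (7, One4), (9, One4), (10, One4), (12, One4)], [], [], [], [], [], [], [], []], [10, 8, 7, 6, 6, 4, 4, 1, 1])]),
 (2, [0, 16, 68, 0],
  [(6080079363583239482463860106720397834225605884928,
    [[], [], [], [], [], [], [], [], []], [10, 8, 6, 8, 6, 1, 1, 4, 4])]),
 (2, [0, 16, 8, 0],
  [(9039852399030100711406610850773965370266673620977,
    [[], [], [], [], [], [], [(0, Omega), (0, Omega_bar), (2, One4), (2, Omega), (6, One4), (6, Omega_bar), (8, One4), (8, Omega)], [(0, Omega), (0, Omega_bar), (2, Omega), (2, Omega_bar), (4, One4), (4, Omega_bar), (6, Omega), (6, Omega_bar)], []], [10, 24, 6, 15, 4, 1, 4, 4, 1])]),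
 (2, [0, 15, 84, 0],
  [(10756620719236348064424044796639623900390659770432,
    [[], [], [], [], [], [], [], [], []], [14, 12, 6, 1, 7, 6, 4, 4, 1]),
   (11417981632228345619389428038333716939282102238459,
    [[], [], [], [], [], [], [], [], []], [6, 7, 15, 4, 6, 1, 1, 4, 4])]),
 (2, [0, 15, 30, 0],
  [(10416070926649993058498630850769791911290474848196,
    [[], [], [], [], [], [], [], [], []], [15, 30, 15, 12, 12, 1, 1, 1, 4])]),
 (2, [0, 13, 89, 0],
  [(6054920552637317377482173848827352304787254352896,
    [[], [], [], [], [], [], [], [], []], [10, 8, 6, 1, 6, 4, 4, 1, 1])]),
 (2, [0, 13, 74, 0],
  [(6040473229459892738059148779391346549230378643455,
    [[], [], [], [], [], [], [], [], []], [10, 15, 12, 1, 6, 1, 1, 4, 4])]),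
 (2, [0, 12, 96, 0],
  [(7203771758154769266912850033682269248792419246157,
    [[], [], [], [], [], [], [], [], []], [8, 15, 6, 12, 1, 4, 4, 1, 1]),
   (10300835092206401880066064405861215926526601770312,
    [[], [], [], [], [], [], [], [], []], [16, 6, 8, 6, 4, 1, 4, 1, 1]),
   (7347480957571867455242055400964781894927247420214,
    [[], [], [], [], [], [], [], [], []], [10, 8, 24, 6, 1, 1, 4, 1, 4]),
   (8790424359777575769567634542778559753214234814275,
    [[], [], [], [], [], [], [], [], []], [8, 15, 12, 15, 12, 1, 1, 1, 4])]),
 (2, [0, 12, 60, 0],
  [(5847730022360943317184446194618702726713402012149,
    [[], [], [], [], [], [], [], [], []], [8, 6, 15, 1, 4, 1, 1, 4, 4])]),
 (2, [0, 12, 48, 0],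
  [(7687887560362108433885009978793633749035354423572,
    [[], [], [], [], [], [], [], [], []], [16, 8, 6, 6, 4, 1, 4, 1, 1])]),
 (2, [0, 11, 82, 0],
  [(7196367555561366014542327084198677611912947279615,
    [[], [], [], [], [], [], [], [], []], [5, 3, 4, 1, 6, 4, 6, 4, 1]),
   (6990577576459006668896292285123243774192830976256,
    [[], [], [], [], [], [], [], [], []], [7, 4, 1, 6, 6, 4, 4, 1, 1])])]"

definition families_11 :: "family list" where
 "families_11 = [
 (2, [0, 11, 28, 0],
  [(6227098058248249789555186504200483270350289551936,
    [[], [], [], [], [], [], [], [], [(0, Omega), (0, Omega_bar), (4, One4), (4, Omega), (5, One4), (5, Omega_bar), (8, Omega), (8, Omega_bar)]], [5, 36, 1, 4, 1, 6, 4, 1, 4]),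
   (6231384218253627881827476967204875971264295502656,
    [[], [], [], [], [], [], [], [], [(0, Omega_bar), (0, Omega), (4, One4), (4, Omega_bar), (5, One4), (5, Omega), (8, Omega_bar), (8, Omega)]], [5, 36, 1, 4, 1, 6, 4, 1, 4])]),
 (2, [0, 10, 74, 0],
  [(9651157262351924021124157673055845921426629276687,
    [[], [], [], [], [], [], [], [], []], [8, 6, 4, 1, 4, 6, 4, 1, 1])]),
 (2, [0, 10, 50, 0],
  [(7251850078257374685535614411236106918514614927380,
    [[], [], [], [], [], [], [], [], []], [8, 6, 6, 1, 4, 4, 1, 4, 1])]),
 (2, [0, 9, 81, 0],
  [(8684105885591068636630195847342393162127907894583,
    [[], [], [], [], [], [], [], [], []], [7, 6, 24, 3, 1, 4, 4, 1, 1]),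
   (8775440035746815651398090528872010061445928794628,
    [[], [], [], [], [], [], [], [], []], [18, 4, 2, 6, 1, 4, 6, 1, 4])]),
 (2, [0, 9, 78, 0],
  [(10937266837656380323522118665962658061649577169184,
    [[(2, One4), (5, One4), (8, One4), (10, One4), (11, One4), (13, One4)], [], [], [], [], [], [], [], []], [12, 4, 6, 6, 1, 4, 4, 1, 1])]),
 (2, [0, 9, 72, 0],
  [(6703572485740139823906425672545888216156769762354,
    [[], [], [], [], [], [], [], [], []], [6, 15, 4, 4, 4, 1, 1, 1, 1])]),
 (2, [0, 9, 69, 0],
  [(9140994402382132693325897884540773885131167887140,
    [[], [], [], [], [], [], [], [], []], [8, 6, 6, 4, 1, 1, 4, 1, 1])]),
 (2, [0, 9, 54, 0],
  [(7334637282786089751546606622091435864004451369007,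
    [[], [], [], [], [], [], [], [], []], [5, 12, 3, 4, 1, 1, 1, 6, 4]),
   (7858515119403572862210540063114220124204832132130,
    [[], [], [(1, Omega), (2, One4), (6, Omega), (8, Omega), (10, Omega_bar), (11, Omega)], [], [], [], [], [], []], [18, 4, 6, 6, 4, 4, 1, 1, 1])]),
 (2, [0, 9, 33, 0],
  [(8410681499554823528169668921548093482565719184289,
    [[], [], [], [], [], [], [], [], [(3, Omega_bar)]], [18, 12, 4, 1, 6, 4, 1, 4, 1])])]"

definition families_12 :: "family list" where
 "families_12 = [
 (3, [0, 9, 6, 1125],
  [(10978153776476363115172287029038927097935492108841,
    [[], [], [], [], [], [], [], [], []], [18, 4, 1, 1, 12, 6, 4, 4, 1])])]"

definition families_13 :: "family list" where
 "families_13 = [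
 (2, [0, 8, 76, 0],
  [(7623377113645096871427291781461430520528065602596,
    [[], [], [], [], [], [], [], [], []], [8, 24, 6, 4, 1, 1, 4, 1, 1]),
   (10875993305063212442227064253939403003017878969737,
    [[], [], [], [], [], [], [], [], []], [5, 24, 3, 4, 4, 1, 4, 1, 1])]),
 (2, [0, 8, 64, 0],
  [(6732866831454691033485850868334107180453968217283,
    [[], [], [], [], [], [], [], [], []], [8, 6, 4, 1, 1, 4, 1, 4, 1]),
   (6584211048816834578652021244609760221892220629040,
    [[], [], [], [], [], [], [], [], []], [8, 6, 1, 2, 4, 4, 4, 1, 1])]),
 (2, [0, 8, 40, 0],
  [(6488290045940979344435322155987531352742172582080,
    [[], [], [], [], [], [], [], [], [(0, Omega), (0, Omega_bar), (4, One4), (4, Omega_bar), (7, One4), (7, Omega), (8, Omega), (8, Omega_bar)]], [5, 3, 12, 1, 1, 4, 4, 1, 4])]),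
 (2, [0, 7, 71, 0],
  [(11497910847958848062432784592648229347402848046661,
    [[], [], [], [], [], [], [], [], []], [8, 6, 1, 12, 2, 4, 1, 1, 1])]),
 (2, [0, 7, 68, 0],
  [(9589507251467125233260877296129091154095480423743,
    [[], [], [], [], [], [], [], [], []], [12, 4, 1, 1, 6, 4, 4, 1, 1]),
   (7145293611917256564197225069905871414396135374896,
    [[], [], [], [], [], [], [], [], []], [4, 1, 6, 6, 4, 1, 1, 4, 1])]),
 (2, [0, 7, 62, 0],
  [(6274182367590756930850066790231430051118560003425,
    [[], [], [], [], [], [], [], [], []], [8, 15, 4, 1, 1, 1, 1, 1, 4]),
   (6074466577220271307476793480762824405145101766632,
    [[], [], [], [], [], [], [], [], []], [4, 1, 6, 6, 1, 1, 1, 4, 4])]),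
 (2, [0, 7, 59, 0],
  [(8775925153948049680563703869189176113372543655968,
    [[], [], [], [], [], [], [], [], []], [4, 1, 6, 6, 1, 4, 4, 1, 1])]),
 (2, [0, 7, 50, 0],
  [(6235657038539735492203835884758224559807335782181,
    [[], [], [], [], [], [], [], [], []], [4, 1, 1, 6, 1, 6, 1, 4, 4]),
   (6235662962200022751036683798196172380057047160373,
    [[], [], [], [], [], [], [], [], []], [4, 1, 1, 6, 1, 6, 1, 4, 4])]),
 (2, [0, 7, 44, 0],
  [(6919298844626079522745539227238283670891879001088,
    [[], [], [], [], [], [], [], [], [(0, Omega), (0, Omega_bar), (6, One4), (6, Omega), (7, One4), (7, Omega), (8, One4), (8, Omega_bar)]], [5, 24, 3, 1, 1, 4, 1, 1, 4])]),
 (2, [0, 7, 32, 0],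
  [(7044900363373858592717459380823504291293314252503,
    [[], [], [], [], [], [], [], [], []], [12, 1, 4, 1, 1, 6, 1, 4, 4]),
   (6685234033306696864045322751994996001524652010390,
    [[], [], [], [], [], [], [], [], []], [12, 1, 4, 1, 1, 6, 1, 4, 4])])]"

definition families_14 :: "family list" where
 "families_14 = [
 (2, [0, 6, 66, 0],
  [(11611126597494875239553665615825435463134436444144,
    [[], [], [], [], [], [], [], [], []], [12, 18, 4, 2, 1, 1, 4, 1, 1]),
   (6445729147367998838329109380273840431304463755213,
    [[], [], [], [], [], [], [], [], []], [5, 12, 9, 2, 4, 1, 1, 1, 1]),
   (10146948356453323833622584399522177762287601250641,
    [[], [], [], [], [], [], [(0, Omega), (0, Omega_bar), (1, Omega), (1, Omega_bar), (6, One4), (6, Omega_bar), (10, Omega), (10, Omega_bar)], [], []], [6, 24, 12, 1, 1, 4, 4, 1, 1]),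
   (9830654597032535414453619839255365561773802647253,
    [[], [], [], [], [], [], [], [], []], [6, 24, 4, 4, 4, 1, 1, 1, 1])]),
 (2, [0, 6, 63, 0],
  [(9662481258624220033426597652318163258207474437455,
    [[], [], [], [], [], [], [], [], []], [12, 4, 1, 6, 1, 1, 1, 4, 1])]),
 (2, [0, 6, 54, 0],
  [(6138599214328018453319931945996452351142594820161,
    [[], [], [], [], [], [], [], [], []], [12, 1, 1, 4, 1, 4, 6, 1, 4])]),
 (2, [0, 6, 39, 0],
  [(10568733559017218702565768240766820841936220172373,
    [[], [], [(1, One4)], [], [], [], [], [], []], [12, 18, 1, 1, 1, 4, 1, 4, 1])]),
 (2, [0, 6, 18, 0],
  [(8083938894156475319047343622968728135487359989304,
    [[], [], [], [(0, Omega), (0, Omega_bar), (5, One4), (5, Omega_bar), (10, Omega), (10, Omega_bar), (11, One4), (11, Omega), (13, One4), (13, Omega), (14, One4), (14, Omega_bar)], [], [], [], [], []], [12, 8, 4, 6, 1, 1, 1, 1, 4])]),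
 (2, [0, 5, 61, 0],
  [(6116251890563994396719405825582387127668858928533,
    [[], [], [], [], [], [], [], [], []], [8, 2, 6, 4, 4, 1, 1, 1, 1]),
   (7535882886661013193687779955060679758819567475136,
    [[], [], [], [], [], [], [], [], []], [8, 18, 1, 1, 4, 1, 1, 1, 4])]),
 (2, [0, 5, 58, 0],
  [(7067468385283666212966081143620792785752377613813,
    [[], [], [], [(1, Omega_bar)], [], [], [], [], []], [6, 1, 4, 1, 1, 4, 4, 1, 1]),
   (7991438401289579859848982238651180450011989080012,
    [[], [(2, Omega_bar)], [], [], [], [], [], [], []], [6, 1, 1, 1, 4, 4, 1, 4, 1]),
   (6983812016804737840889682088382315432137883662499,
    [[], [], [], [], [], [], [], [], []], [6, 4, 1, 2, 4, 4, 1, 1, 1]),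
   (11326817403395392712649450237836930201913410959726,
    [[], [], [], [], [], [], [], [], []], [6, 1, 4, 1, 1, 1, 1, 4, 4])]),
 (2, [0, 5, 52, 0],
  [(9637147806858366202385402686588026514378706963067,
    [[], [], [], [], [], [], [], [], []], [6, 4, 1, 4, 1, 4, 1, 1, 1]),
   (6431568720350201691751158480031804412076912232081,
    [[], [], [], [], [], [], [], [], []], [6, 1, 12, 4, 1, 1, 1, 4, 1]),
   (10430330415247327299483537411467018479229208765778,
    [[], [], [(1, One4), (3, One4), (5, Omega_bar), (8, One4), (9, Omega_bar), (10, One4)], [], [], [], [], [], [(0, Omega), (0, Omega_bar), (5, One4), (5, Omega), (7, One4), (7, Omega_bar), (9, One4), (9, Omega)]], [13, 15, 6, 1, 1, 1, 1, 1, 4])]),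
 (2, [0, 5, 49, 0],
  [(6442240500025300791083632603500961211483936069768,
    [[], [], [], [], [], [], [], [], []], [8, 6, 4, 4, 1, 1, 1, 1, 1])])]"

definition families_15 :: "family list" where
 "families_15 = [
 (2, [0, 5, 40, 0],
  [(8772222960688334651262320329883290983025954793854,
    [[], [], [], [], [], [], [], [], []], [6, 1, 1, 4, 1, 1, 1, 4, 4]),
   (10235151845715924707355299012664292676110026554731,
    [[], [], [], [], [], [], [], [], []], [6, 1, 1, 4, 1, 1, 1, 4, 4])]),
 (2, [0, 5, 34, 0],
  [(6091494953248668991491578452170972984830743941638,
    [[], [], [], [], [], [], [], [], []], [8, 6, 1, 1, 4, 1, 1, 1, 4])]),
 (2, [0, 5, 25, 0],
  [(8770618384588236709213465133006544524998200640605,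
    [[], [], [], [], [], [], [], [], []], [8, 3, 6, 1, 1, 1, 4, 1, 4])]),
 (2, [0, 4, 56, 0],
  [(6642595695170640455206208019275367269303897436610,
    [[], [], [], [], [], [], [], [], []], [2, 4, 8, 4, 1, 4, 1, 1, 1]),
   (7259524292667297230197012104217437617332895344732,
    [[], [], [], [], [], [], [], [], []], [6, 12, 1, 2, 1, 4, 1, 1, 1]),
   (5868133777058441486290429783671739938262712529220,
    [[], [], [], [], [], [], [], [], []], [16, 3, 4, 2, 1, 1, 4, 1, 4]),
   (11206759418320047278988929863828892018234819701694,
    [[], [], [], [], [], [], [], [(5, Omega_bar)], [(6, Omega)]], [16, 12, 1, 1, 4, 4, 2, 1, 1]),
   (7327818664876052993299478619865801066403451240987,
    [[], [], [], [], [], [], [], [(2, One4), (5, One4)], []], [16, 4, 24, 4, 3, 1, 1, 1, 1]),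
   (6614582559734052046119362333434550287566255204780,
    [[(2, One4), (3, One4), (4, One4), (5, One4), (9, One4), (11, One4), (12, One4), (17, One4)], [], [], [], [], [], [], [(0, Omega), (0, Omega_bar), (1, Omega), (1, Omega_bar), (6, Omega), (6, Omega_bar), (7, One4), (7, Omega_bar)], []], [8, 3, 4, 1, 4, 1, 1, 4, 1])]),
 (2, [0, 4, 53, 0],
  [(10532749978283401153448362440927689833895112160560,
    [[], [], [], [], [], [], [], [], []], [6, 4, 4, 1, 1, 1, 1, 1, 1])]),
 (2, [0, 4, 47, 0],
  [(11552857141438240069761334997027103396676917413218,
    [[], [], [], [(1, One4)], [], [], [], [], []], [6, 4, 4, 1, 1, 1, 1, 1, 1])])]"

definition families_16 :: "family list" where
 "families_16 = [
 (2, [0, 4, 44, 0],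
  [(11549132573500131337682692047333748196967126547918,
    [[(4, One4)], [], [], [], [], [], [], [], []], [1, 4, 4, 4, 1, 1, 1, 4, 1]),
   (9102457529448929473918686787715431536103977422569,
    [[], [], [], [], [], [], [], [], []], [6, 2, 4, 1, 1, 1, 1, 4, 1]),
   (6947143388860346273126739264170144508982140707097,
    [[], [], [], [], [], [], [], [], []], [2, 4, 1, 4, 1, 4, 1, 1, 4])]),
 (2, [0, 4, 20, 0],
  [(6178663845877438434394470473870034800979946644597,
    [[(2, One4), (7, One4), (11, One4), (17, One4)], [], [], [], [], [], [], [], [(2, One4)]], [12, 8, 4, 1, 4, 1, 1, 1, 1])]),
 (2, [0, 4, 8, 0],
  [(6839125187505420080103370130028945192742108906647,
    [[], [], [], [(0, Omega), (0, Omega_bar), (1, One4), (1, Omega), (4, Omega), (4, Omega_bar), (8, One4), (8, Omega_bar), (10, One4), (10, Omega_bar), (11, One4), (11, Omega), (12, One4), (12, Omega), (13, One4), (13, Omega)], [], [(4, One4)], [(4, Omega_bar)], [(6, Omega)], []], [16, 1, 4, 8, 4, 1, 1, 1, 1])]),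
 (2, [0, 3, 51, 0],
  [(9008877769400851599829239968058911924272334324085,
    [[], [], [], [], [], [], [], [], []], [12, 2, 1, 1, 4, 4, 1, 1, 1]),
   (5983736612583372648850181595574647073498932528345,
    [[], [], [], [], [], [], [], [], []], [6, 1, 1, 1, 1, 4, 4, 1, 4]),
   (8938869225213236222728249805852776063360249380253,
    [[], [], [], [], [], [], [], [], []], [6, 4, 6, 2, 1, 1, 1, 1, 1]),
   (8163368401818489207624852069671496639290812715457,
    [[], [], [], [(4, Omega_bar), (11, One4)], [], [], [], [], []], [6, 12, 12, 1, 1, 1, 4, 1, 1])])]"

definition families_17 :: "family list" where
 "families_17 = [
 (2, [0, 3, 48, 0],
  [(9812267099161265639007651057643367092587511989332,
    [[(1, One4), (4, One4), (10, One4), (11, One4), (14, One4)], [], [], [], [], [], [], [], []], [1, 1, 4, 4, 1, 1, 4, 1, 1]),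
   (7675665257359780865463296325937744879301976777856,
    [[(2, One4), (5, One4), (6, One4), (9, One4)], [], [], [], [], [], [], [], []], [8, 1, 4, 1, 4, 1, 1, 1, 1]),
   (7149927224795949062353769457275357086036782433207,
    [[(1, One4), (13, One4), (14, One4), (16, One4)], [], [], [], [], [], [], [], []], [2, 1, 4, 1, 4, 1, 4, 1, 1]),
   (9562028037734078788793165875596396279734968465226,
    [[(3, One4), (9, One4), (11, One4), (14, One4)], [], [], [], [], [], [], [], []], [8, 1, 1, 4, 4, 1, 1, 1, 1]),
   (9087924697995483992039666527872538624371503186167,
    [[(2, One4), (5, One4)], [], [], [], [], [], [], [], []], [4, 1, 1, 4, 4, 1, 4, 1, 1]),
   (9952455382095054956880897431577008152496150488391,
    [[(1, One4), (3, One4), (5, One4), (8, One4), (9, One4), (14, One4)], [], [], [], [], [], [], [], []], [6, 1, 6, 1, 1, 1, 1, 4, 1]),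
   (11554490607985088561336325945293979756618484581460,
    [[(1, One4), (4, One4), (10, One4), (11, One4), (14, One4)], [], [], [], [], [], [], [], []], [1, 1, 4, 4, 1, 1, 4, 1, 1])]),
 (2, [0, 3, 42, 0],
  [(8722746939311433173831351500019755539979634084574,
    [[(1, One4), (2, One4), (5, One4), (9, One4), (11, One4)], [], [], [], [], [], [], [], []], [1, 1, 1, 4, 1, 1, 4, 4, 1]),
   (5973721313667214997176004562861973042486033004278,
    [[(1, One4), (4, One4), (5, One4), (9, One4), (12, One4)], [], [], [], [], [], [], [], []], [1, 1, 4, 4, 1, 1, 4, 1, 1]),
   (10773689495367791484374862104320496223995909304372,
    [[], [], [], [], [], [], [], [], []], [12, 8, 4, 1, 1, 1, 1, 1, 1]),
   (6889023395209001305137200866649907048566355038168,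
    [[(2, One4), (7, One4), (8, One4), (15, One4)], [], [], [], [], [], [], [], []], [8, 3, 4, 1, 4, 1, 1, 1, 1])]),
 (2, [0, 3, 39, 0],
  [(10869930594977644331970789422005298433630315980862,
    [[(1, One4), (3, One4), (4, One4), (5, One4), (9, One4), (14, One4)], [], [], [], [], [], [], [], []], [6, 2, 1, 1, 1, 1, 6, 1, 4]),
   (7589042243372170973727126970082979374016180749780,
    [[(3, One4), (5, One4), (10, One4), (16, One4)], [], [], [], [], [], [], [], []], [8, 1, 1, 4, 4, 1, 1, 1, 1]),
   (5916599826206403173883263719227214152718728827466,
    [[], [], [], [], [], [], [], [], []], [12, 1, 2, 4, 1, 1, 1, 4, 1])]),
 (2, [0, 3, 30, 0],
  [(6556013256155794290951516703320521188763880350452,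
    [[(3, One4), (8, One4), (10, One4), (11, One4)], [], [], [], [], [], [], [], []], [8, 1, 1, 4, 1, 1, 4, 1, 1]),
   (6441738314463448969621992876218183116206831203236,
    [[(3, One4), (8, One4), (10, One4), (11, One4)], [], [], [], [], [], [], [], []], [8, 1, 1, 4, 1, 1, 4, 1, 1])]),
 (2, [0, 3, 24, 0],
  [(6698507124081569645885171293766322592310958633469,
    [[], [], [], [], [], [], [], [], []], [12, 1, 1, 1, 1, 1, 4, 4, 1]),
   (11679826327447363097471214653656337038190060691753,
    [[], [], [], [], [], [], [(0, Omega), (0, Omega_bar), (2, Omega), (2, Omega_bar), (4, One4), (4, Omega_bar), (5, One4), (5, Omega_bar)], [], []], [12, 24, 3, 3, 2, 1, 4, 1, 1])])]"

definition families_18 :: "family list" where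
 "families_18 = [
 (2, [0, 3, 12, 0],
  [(7168798366405223482677887212693990611478034518553,
    [[], [], [], [], [], [], [], [], []], [6, 4, 2, 4, 4, 1, 1, 1, 1]),
   (6890128604622392447211266704051396245920175624989,
    [[], [], [], [], [], [], [], [], []], [6, 4, 2, 4, 4, 1, 1, 1, 1])]),
 (2, [0, 2, 46, 0],
  [(8417557200134535700159667903790037468403318397224,
    [[], [], [], [], [], [], [], [], []], [8, 1, 4, 1, 1, 1, 1, 1, 1]),
   (8685552498854062145283971206182839693754999629806,
    [[(4, One4), (5, One4), (11, One4), (16, One4)], [], [], [], [], [], [], [], []], [4, 2, 2, 1, 4, 1, 1, 1, 1]),
   (6124212240356625177586590939372231466014186015385,
    [[], [], [], [], [], [], [], [], []], [8, 3, 1, 4, 1, 1, 1, 1, 1]),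
   (6233691079957099723733202537349239623916402220057,
    [[(3, One4), (6, One4), (8, One4), (13, One4)], [], [], [], [], [], [], [], []], [4, 3, 2, 4, 1, 1, 1, 1, 1]),
   (7780463845295992026968809413011319039691875414451,
    [[], [], [], [], [], [], [], [], []], [8, 4, 3, 4, 1, 1, 1, 1, 1])]),
 (2, [0, 2, 43, 0],
  [(8176723216290773893478749429779775673057907851483,
    [[], [], [], [], [], [], [], [], []], [8, 1, 4, 1, 1, 1, 1, 1, 1]),
   (8633225214149598288659184295762453873604510877688,
    [[(3, One4), (4, One4), (8, One4), (17, One4)], [], [], [], [], [], [], [], []], [4, 1, 1, 4, 1, 1, 1, 1, 1]),
   (11201447707559084895872812036841650573806701412844,
    [[(5, One4), (9, One4), (14, One4), (17, One4)], [], [], [], [], [], [], [], []], [4, 1, 1, 1, 1, 4, 1, 1, 1]),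
   (10063978194510376299244275111019411300634659483996,
    [[], [], [], [], [], [], [], [], []], [8, 1, 4, 1, 1, 1, 1, 1, 1]),
   (8917004393540349494875115023234545968005758614464,
    [[(2, One4), (3, One4), (5, One4), (9, One4)], [], [], [], [], [], [], [], []], [4, 2, 4, 1, 1, 1, 1, 1, 1]),
   (7579597338512710035663203935605124128111613593860,
    [[], [], [], [], [], [], [], [], []], [8, 2, 1, 1, 4, 1, 1, 1, 1])])]"

definition families_19 :: "family list" where
 "families_19 = [
 (2, [0, 2, 37, 0],
  [(9138134845702181274805518318665186424340144037452,
    [[(3, One4), (9, One4), (10, One4), (16, One4)], [], [], [], [], [], [], [], []], [4, 1, 1, 4, 1, 1, 1, 1, 1]),
   (10536577258944210632823486219149725876326664351414,
    [[(4, One4), (7, One4), (11, One4), (15, One4)], [], [], [], [], [], [], [], []], [4, 1, 3, 1, 4, 2, 1, 1, 1]),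
   (6068904602587167855440237774527098039560220757218,
    [[], [], [], [], [], [], [], [], []], [8, 12, 1, 1, 1, 1, 1, 1, 1]),
   (6154606721974945370781214435806279575450249365683,
    [[], [], [], [], [], [], [], [], []], [8, 12, 1, 1, 1, 1, 1, 1, 1])]),
 (2, [0, 2, 34, 0],
  [(8937599815848987952569786012877653555548328755458,
    [[], [], [], [], [], [], [], [], []], [8, 1, 4, 1, 1, 1, 1, 1, 1]),
   (11490243059859034054678371240045451477321177905591,
    [[(3, One4), (11, One4), (13, One4), (15, One4)], [], [], [], [], [], [], [], []], [4, 4, 1, 4, 1, 1, 1, 1, 1]),
   (7153300451528324508216531415479703090272706583656,
    [[], [], [], [], [], [], [], [], []], [8, 4, 1, 1, 1, 1, 1, 1, 1])]),
 (2, [0, 2, 25, 0],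
  [(7868041538144566157270723854802379080171328769759,
    [[], [], [], [], [], [], [], [], []], [8, 2, 1, 1, 4, 1, 1, 1, 1]),
   (7965340646653496922895023953672526318793451834266,
    [[], [], [], [], [], [], [], [], []], [8, 2, 1, 1, 4, 1, 1, 1, 1])]),
 (2, [0, 2, 19, 0],
  [(11367192051036921263888891402989477858043594134162,
    [[], [], [(15, Omega)], [], [], [], [], [], []], [8, 3, 1, 2, 4, 1, 1, 1, 1])])]"

definition families_20 :: "family list" where
 "families_20 = [
 (2, [0, 1, 41, 0],
  [(7699192215935439474188996514575008075818729868155,
    [[], [], [], [], [], [], [], [], []], [4, 1, 6, 1, 1, 1, 1, 1, 1]),
   (11185420228074805000007513927959010596837556884952,
    [[], [], [], [], [], [], [], [], []], [4, 6, 1, 1, 1, 1, 1, 1, 1]),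
   (6976536042821195575519117374769241584439558428530,
    [[], [], [], [], [], [], [], [], []], [4, 1, 2, 4, 1, 1, 1, 1, 1]),
   (11373294606879684224802150393565393765332939674411,
    [[], [], [], [], [], [], [], [], []], [4, 3, 2, 1, 1, 1, 1, 1, 1]),
   (6369018254379498670952848491576848461344317608090,
    [[], [], [], [], [], [], [], [], []], [4, 24, 1, 1, 1, 1, 1, 1, 1]),
   (10229280041396897281557364848988490086798203725444,
    [[], [], [], [], [], [], [], [], []], [4, 6, 1, 1, 1, 1, 1, 1, 1])]),
 (2, [0, 1, 38, 0],
  [(8312933268939938170385986931654697383995368815657,
    [[], [], [], [], [], [], [], [], []], [4, 2, 1, 1, 1, 1, 1, 1, 1]),
   (10542637379460060162550841314187318595240317349787,
    [[], [(13, Omega), (15, One4)], [], [], [], [], [], [], []], [4, 2, 1, 1, 1, 1, 1, 1, 1]),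
   (11658866619563060860785336218677981396714005284090,
    [[], [], [], [], [], [], [], [], []], [4, 2, 1, 1, 1, 1, 1, 1, 1]),
   (6163899159135581751653703683712380142494921166415,
    [[], [], [], [], [], [], [], [], []], [4, 6, 1, 1, 2, 1, 1, 1, 1]),
   (7076412582351248321846747708057157104878887062276,
    [[], [], [], [], [], [], [], [], []], [4, 4, 1, 1, 1, 1, 1, 1, 1]),
   (7797616953767918600152991795730185428053178224314,
    [[], [], [], [], [], [], [], [], []], [4, 3, 1, 1, 1, 1, 1, 1, 1]),
   (8586870032799527197681599524250782242105861089341,
    [[], [], [], [], [], [], [], [], []], [4, 2, 1, 1, 1, 1, 1, 1, 1]),
   (9768841179992102476737866857367322704609924695215,
    [[], [], [], [], [], [], [], [], []], [4, 2, 1, 1, 1, 1, 1, 1, 1])])]"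

definition families_21 :: "family list" where
 "families_21 = [
 (2, [0, 1, 32, 0],
  [(11639800617747005657303095538484238049821442471596,
    [[], [], [], [], [], [], [], [], []], [4, 3, 2, 1, 1, 1, 1, 1, 1]),
   (6785507141496040741108708333636333824216891538829,
    [[], [], [], [], [], [], [], [], []], [4, 3, 2, 1, 1, 1, 1, 1, 1]),
   (8148713796065295484604271915708951817019043433185,
    [[], [], [], [], [], [], [], [], []], [4, 6, 2, 1, 1, 1, 1, 1, 1]),
   (8508462513963403520720736970937027708033892962225,
    [[], [], [], [], [], [], [], [], []], [4, 6, 2, 1, 1, 1, 1, 1, 1]),
   (7196558099733327144740277920772848000108722127080,
    [[], [(6, Omega_bar), (8, Omega)], [], [], [], [], [], [], []], [4, 2, 1, 1, 1, 1, 1, 1, 1])]),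
 (2, [0, 1, 29, 0],
  [(10048281577816797744516248720055267014727227406766,
    [[], [(3, One4), (9, Omega)], [], [], [], [], [], [], []], [4, 2, 1, 1, 1, 1, 1, 1, 1]),
   (8009725235358452749149795819724832939913268718822,
    [[], [], [], [], [], [], [], [], []], [4, 6, 4, 1, 1, 1, 1, 1, 1])]),
 (2, [0, 1, 20, 0],
  [(11416382192566595830621619939844226155501583207440,
    [[], [(6, Omega_bar), (12, One4)], [], [], [], [], [], [], []], [4, 6, 2, 1, 1, 1, 1, 1, 1]),
   (9562120177531222656225289356467405974462522918928,
    [[], [(6, Omega), (12, One4)], [], [], [], [], [], [], []], [4, 6, 2, 1, 1, 1, 1, 1, 1])]),
 (2, [0, 1, 14, 0],
  [(10105824108514425939214817681257769009427626991680,
    [[], [(1, One4), (1, Omega), (1, Omega_bar), (2, One4), (2, Omega), (2, Omega_bar), (3, One4), (3, Omega), (3, Omega_bar), (6, One4), (6, Omega), (6, Omega_bar), (7, One4), (7, Omega), (7, Omega_bar), (9, One4), (9, Omega), (9, Omega_bar), (12, One4), (12, Omega), (12, Omega_bar)], [(2, One4), (6, One4), (8, Omega_bar), (11, Omega_bar)], [], [], [], [], [], []], [4, 21, 2, 1, 1, 1, 1, 1, 1])])]"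

definition families_22 :: "family list" where
 "families_22 = [
 (2, [0, 0, 36, 0],
  [(10425974727744251542499038294678109088629133348586,
    [[(4, One4), (7, One4), (8, One4), (9, One4), (10, One4), (11, One4), (13, One4), (15, One4), (16, One4), (17, One4)], [], [], [], [], [], [], [], []], [8, 1, 3, 1, 1, 1, 1, 1, 1]),
   (5994983309314001028786637141166995062307479248398,
    [[(1, One4), (4, One4), (5, One4), (6, One4), (8, One4), (9, One4), (11, One4), (12, One4), (15, One4)], [], [], [], [], [], [], [], []], [9, 1, 1, 1, 1, 1, 1, 1, 1]),
   (7532483894912398862251065778141851755270951853407,
    [[(1, One4), (2, One4), (3, One4), (6, One4), (8, One4), (10, One4), (12, One4), (13, One4), (14, One4), (15, One4), (16, One4), (17, One4)], [], [], [], [], [], [], [], []], [6, 1, 2, 1, 1, 1, 1, 1, 1]),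
   (9820478037200433893827825172770785448433435600465,
    [[(3, One4), (4, One4), (6, One4), (7, One4), (8, One4), (9, One4), (10, One4), (11, One4), (12, One4), (13, One4), (14, One4), (15, One4), (16, One4), (17, One4)], [], [], [], [], [], [], [], []], [4, 1, 2, 1, 1, 1, 1, 1, 1]),
   (6665743900071512308326640067330384767090663465396,
    [[], [], [], [], [], [], [], [], []], [18, 8, 1, 3, 1, 1, 1, 1, 1]),
   (7177442953377235040896033848766813302103093013954,
    [[(1, One4), (2, One4), (4, One4), (6, One4), (7, One4), (8, One4), (9, One4), (10, One4), (11, One4), (14, One4), (15, One4), (17, One4)], [(7, Omega_bar)], [], [], [], [], [], [], []], [6, 1, 1, 1, 1, 1, 1, 1, 1]),
   (6373964130285264990454252327965310711801363481795,
    [[(9, One4), (11, One4)], [], [], [], [], [], [], [], []], [16, 2, 1, 1, 1, 1, 1, 1, 1]),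
   (11294324403448096185045122801573521704476306349765,
    [[(10, One4), (11, One4)], [], [], [], [], [], [], [], []], [16, 8, 3, 1, 1, 1, 1, 1, 1]),
   (11581432194698404731965700264030960832365498444112,
    [[], [], [], [], [], [], [], [], []], [18, 9, 8, 3, 1, 2, 1, 1, 1]),
   (11690088585824021589616744313938373274959150418692,
    [[(4, One4), (5, One4), (6, One4), (9, One4), (10, One4), (13, One4)], [], [], [], [], [], [], [], []], [12, 6, 1, 1, 1, 1, 1, 1, 1])])]"

definition families_23 :: "family list" where
 "families_23 = [
 (2, [0, 0, 33, 0],
  [(11682746249575147743004479066634496180442107557658,
    [[(1, One4), (2, One4), (3, One4), (4, One4), (6, One4), (7, One4), (8, One4), (9, One4), (10, One4), (11, One4), (12, One4), (13, One4), (14, One4), (15, One4), (16, One4), (17, One4)], [(14, Omega)], [], [], [], [], [], [], []], [2, 1, 2, 1, 1, 1, 1, 1, 1]),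
   (6381238573349656981425554928067379016174050372518,
    [[(2, One4), (3, One4), (4, One4), (5, One4), (6, One4), (7, One4), (8, One4), (9, One4), (10, One4), (11, One4), (12, One4), (13, One4), (14, One4), (15, One4), (16, One4), (17, One4)], [], [], [], [], [], [], [], []], [2, 1, 1, 2, 1, 1, 1, 1, 1]),
   (7817715847324041415682328481936844836681407817605,
    [[(1, One4), (2, One4), (3, One4), (5, One4), (8, One4), (9, One4), (10, One4), (13, One4), (17, One4)], [], [], [], [], [], [], [], []], [9, 1, 2, 1, 1, 1, 1, 1, 1]),
   (7330258363643628006746557487845112321301668655069,
    [[(1, One4), (2, One4), (3, One4), (4, One4), (6, One4), (7, One4), (8, One4), (9, One4), (10, One4), (11, One4), (12, One4), (13, One4), (14, One4), (15, One4), (16, One4), (17, One4)], [], [], [], [], [], [], [], []], [2, 1, 1, 1, 1, 1, 1, 1, 1]),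
   (7494911795735697757910895954874713466065689384824,
    [[(2, One4), (4, One4), (5, One4), (6, One4), (7, One4), (8, One4), (9, One4), (10, One4), (11, One4), (12, One4), (13, One4), (14, One4), (15, One4), (16, One4)], [], [], [], [], [], [], [], []], [4, 1, 1, 1, 1, 1, 1, 1, 1]),
   (9824287546781452748275233300357257942321443320990,
    [[(1, One4), (2, One4), (3, One4), (4, One4), (5, One4), (6, One4), (7, One4), (8, One4), (9, One4), (10, One4), (11, One4), (12, One4), (13, One4), (15, One4), (16, One4), (17, One4)], [], [], [], [], [], [], [], []], [2, 1, 2, 1, 1, 1, 1, 1, 1]),
   (9840122213032534416717202713683926462115300659655,
    [[(1, One4), (2, One4), (3, One4), (4, One4), (5, One4), (6, One4), (7, One4), (8, One4), (10, One4), (13, One4), (14, One4), (16, One4)], [], [], [], [], [], [], [], []], [6, 1, 2, 1, 1, 1, 1, 1, 1]),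
   (9472836066215860567161945808065076366463282655121,
    [[(1, One4), (2, One4), (3, One4), (4, One4), (5, One4), (6, One4), (7, One4), (9, One4), (10, One4), (11, One4), (13, One4), (17, One4)], [], [], [], [], [], [], [], []], [6, 2, 1, 1, 1, 1, 1, 1, 1]),
   (11647409686278238349601158787955486956312378007185,
    [[], [], [], [], [], [], [], [], []], [18, 5, 2, 2, 1, 1, 1, 1, 1])])]"

definition families_24 :: "family list" where
 "families_24 = [
 (2, [0, 0, 27, 0],
  [(6986979067949543948515137069904722591925505714257,
    [[(2, One4), (3, One4), (4, One4), (5, One4), (6, One4), (7, One4), (9, One4), (10, One4), (11, One4), (12, One4), (13, One4), (14, One4), (15, One4), (17, One4)], [], [], [], [], [], [], [], []], [4, 1, 1, 1, 1, 1, 1, 1, 1]),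
   (10452892625263031899866613532225173950433135589813,
    [[(3, One4), (4, One4), (5, One4), (7, One4), (8, One4), (9, One4), (10, One4), (12, One4), (13, One4), (15, One4), (16, One4), (17, One4)], [], [], [], [], [], [], [], []], [6, 2, 1, 1, 1, 1, 1, 1, 1]),
   (9086633746533195063021597340693271288968575938021,
    [[(3, One4), (4, One4), (5, One4), (7, One4), (8, One4), (9, One4), (10, One4), (12, One4), (13, One4), (15, One4), (16, One4), (17, One4)], [], [], [], [], [], [], [], []], [6, 2, 1, 1, 1, 1, 1, 1, 1])]),
 (2, [0, 0, 24, 0],
  [(6098742396406212762447386516637905638053183328265,
    [[(1, One4), (3, One4), (4, One4), (5, One4), (7, One4), (9, One4), (10, One4), (11, One4), (15, One4)], [(6, One4), (14, Omega)], [], [], [], [], [], [], []], [9, 2, 1, 1, 1, 1, 1, 1, 1]),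
   (8050858850710559167728447851233683069569043590938,
    [[(2, One4), (3, One4), (4, One4), (6, One4), (7, One4), (8, One4), (9, One4), (10, One4), (11, One4), (12, One4), (13, One4), (14, One4), (15, One4), (17, One4)], [], [], [], [], [], [], [], []], [4, 1, 1, 1, 2, 1, 1, 1, 1]),
   (8187818615809483370537116547960212826533506288518,
    [[(1, One4), (2, One4), (5, One4), (8, One4), (12, One4), (13, One4), (14, One4), (16, One4), (17, One4)], [], [], [], [], [], [], [], []], [9, 4, 2, 1, 1, 1, 1, 1, 1]),
   (10092339319062842152170389470312992358385814411244,
    [[(3, One4), (13, One4)], [], [], [], [], [], [], [], []], [16, 1, 6, 1, 1, 1, 1, 1, 1])]),
 (2, [0, 0, 15, 0],
  [(6707624253613508568789868895816086904708900568827,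
    [[(2, One4), (3, One4), (11, One4)], [], [], [], [], [], [], [], []], [15, 4, 1, 1, 1, 1, 1, 1, 1]),
   (7077549108479169226602256904431178774505110825902,
    [[(2, One4), (3, One4), (11, One4)], [], [], [], [], [], [], [], []], [15, 4, 1, 1, 1, 1, 1, 1, 1])]),
 (2, [0, 0, 9, 0],
  [(6125597246226204443968247092339319288562219930328,
    [[], [(2, Omega), (4, Omega_bar), (11, Omega), (13, Omega_bar), (14, Omega), (16, Omega_bar)], [], [(2, Omega), (14, Omega)], [(12, One4)], [], [(1, Omega_bar)], [], [(1, One4)]], [18, 6, 1, 2, 1, 1, 1, 1, 1]),
   (7503692799036498895551855932457226461444842654581,
    [[(1, One4), (3, One4), (5, One4), (6, One4), (7, One4), (9, One4), (11, One4), (12, One4), (17, One4)], [], [], [], [], [], [], [], []], [9, 9, 6, 2, 1, 1, 1, 1, 1])])]"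

definition families_25 :: "family list" where
 "families_25 = [
 (3, [0, 0, 0, 918],
  [(9065293142872936711415008844019397900004825940890,
    [[(3, One4)], [(2, One4), (2, Omega), (2, Omega_bar)], [(2, Omega), (3, One4), (7, Omega_bar), (9, One4), (10, Omega_bar), (11, Omega_bar), (12, One4), (13, One4), (14, Omega_bar), (15, Omega_bar)], [], [], [], [], [], []], [17, 48, 5, 1, 2, 1, 1, 1, 1])])]"

section \<open>Verification and the classification\<close>

lemma checks_1: "checks families_1"
  by (simp only: families_1_def exec)
lemma checks_2: "checks families_2"
  by (simp only: families_2_def exec)
lemma checks_3: "checks families_3"
  by (simp only: families_3_def exec)
lemma checks_4: "checks families_4"
  by (simp only: families_4_def exec)
lemma checks_5: "checks families_5"
  by (simp only: families_5_def exec)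
lemma checks_6: "checks families_6"
  by (simp only: families_6_def exec)
lemma checks_7: "checks families_7"
  by (simp only: families_7_def exec)
lemma checks_8: "checks families_8"
  by (simp only: families_8_def exec)
lemma checks_9: "checks families_9"
  by (simp only: families_9_def exec)
lemma checks_10: "checks families_10"
  by (simp only: families_10_def exec)
lemma checks_11: "checks families_11"
  by (simp only: families_11_def exec)
lemma checks_12: "checks families_12"
  by (simp only: families_12_def exec)
lemma checks_13: "checks families_13"
  by (simp only: families_13_def exec)
lemma checks_14: "checks families_14"
  by (simp only: families_14_def exec)
lemma checks_15: "checks families_15"
  by (simp only: families_15_def exec)
lemma checks_16: "checks families_16"
  by (simp only: families_16_def exec)
lemma checks_17: "checks families_17"
  by (simp only: families_17_def exec)
lemma checks_18: "checks families_18"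
  by (simp only: families_18_def exec)
lemma checks_19: "checks families_19"
  by (simp only: families_19_def exec)
lemma checks_20: "checks families_20"
  by (simp only: families_20_def exec)
lemma checks_21: "checks families_21"
  by (simp only: families_21_def exec)
lemma checks_22: "checks families_22"
  by (simp only: families_22_def exec)
lemma checks_23: "checks families_23"
  by (simp only: families_23_def exec)
lemma checks_24: "checks families_24"
  by (simp only: families_24_def exec)
lemma checks_25: "checks families_25"
  by (simp only: families_25_def exec)

definition families :: "family list" where
  "families = families_1 @ families_2 @ families_3 @ families_4 @ families_5 @ families_6 @ families_7 @ families_8 @ families_9 @ families_10 @ families_11 @ families_12 @ families_13 @ families_14 @ families_15 @ families_16 @ families_17 @ families_18 @ families_19 @ families_20 @ families_21 @ families_22 @ families_23 @ families_24 @ families_25"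
lemmas families_defs = families_def families_1_def families_2_def families_3_def families_4_def families_5_def families_6_def families_7_def families_8_def families_9_def families_10_def families_11_def families_12_def families_13_def families_14_def families_15_def families_16_def families_17_def families_18_def families_19_def families_20_def families_21_def families_22_def families_23_def families_24_def families_25_def

lemma checks_append: "checks (fs @ gs) \<longleftrightarrow> checks fs \<and> checks gs" by (auto simp: checks_iff)
lemma checks_families: "checks families"
  unfolding families_def checks_append by (intro conjI checks_1 checks_2 checks_3 checks_4 checks_5 checks_6 checks_7 checks_8 checks_9 checks_10 checks_11 checks_12 checks_13 checks_14 checks_15 checks_16 checks_17 checks_18 checks_19 checks_20 checks_21 checks_22 checks_23 checks_24 checks_25)

lemma proper_families: "list_all proper families"
  by (simp add: families_defs proper_def)

lemma families_keys: "distinct (map (\<lambda>(h, key, es). take 3 key) families)"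
  by (simp add: families_defs)

text \<open>With this identity, the listed classes exhaust the self-dual codes.\<close>
lemma families_mass: "sum_list (class_sizes families) = 3 * 9 * 33 * 129 * 513 * 2049 * 8193 * 32769 * 131073"
  by (simp add: families_defs class_sizes_def fact_numeral)

lemma families_weights: "weights families = replicate 55 2 @ replicate 159 4 @ replicate 30 6 @ [8]"
  by (simp add: families_defs weights_def numeral_eq_Suc)

theorem theorem6:
  shows "num_inequivalent {C :: (gf4 ^ 18) set. hermitian_self_dual C} = 245
    \<and> num_inequivalent {C :: (gf4 ^ 18) set. extremal C} = 1
    \<and> num_inequivalent {C :: (gf4 ^ 18) set. hermitian_self_dual C \<and> min_weight C = 8} = 1
    \<and> num_inequivalent {C :: (gf4 ^ 18) set. hermitian_self_dual C \<and> min_weight C = 6} = 30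
    \<and> num_inequivalent {C :: (gf4 ^ 18) set. hermitian_self_dual C \<and> min_weight C = 4} = 159
    \<and> num_inequivalent {C :: (gf4 ^ 18) set. hermitian_self_dual C \<and> min_weight C = 2} = 55"
proof -
  note cl = classification[OF checks_families proper_families families_keys families_mass, unfolded families_weights]
  have ext: "extremal C \<longleftrightarrow> hermitian_self_dual C \<and> min_weight C = 8" for C :: "(gf4 ^ 18) set"
    by (simp add: extremal_def)
  have w: "num_inequivalent {C :: (gf4 ^ 18) set. hermitian_self_dual C \<and> min_weight C = m}
    = (if m = 2 then 55 else 0) + (if m = 4 then 159 else 0) + (if m = 6 then 30 else 0) + (if m = 8 then 1 else 0)" for m
    unfolding cl[of "\<lambda>w. w = m"] by (simp only: filter_append filter_replicate length_append) simp
  have "num_inequivalent {C :: (gf4 ^ 18) set. hermitian_self_dual C} = 245"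
    using cl[of "\<lambda>_. True"] by simp
  then show ?thesis unfolding ext w by simp
qed

end
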